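(* Let $f$ be a known distribution on $\mathbb{R}^d$ with covariance matrix $\Sigma$. For any $0<r^2\le\|\Sigma\|$, let $R=r^2I_d$ and let $\mathcal{I}_R$ be the $R$-smoothed Fisher information matrix of $f$. Let $0<\eta<1$ be any constant, and let $\hat\lambda$ be the output of the high-dimensional global MLE algorithm (defined in the context) run with failure probability $\delta$, smoothing $R$, approximation parameter $\eta$, and $n$ i.i.d. samples from $f^\lambda$, where $\lambda\in\mathbb{R}^d$ is unknown. Then $$ \|\hat\lambda-\lambda\|_2 \le (1+\eta)\sqrt{\frac{\mathrm{Tr}(\mathcal{I}_R^{-1})}{n}} + 5\sqrt{\frac{\|\mathcal{I}_R^{-1}\|\log\frac4\delta}{n}} $$ with probability $1-\delta$, for $$ n > O_\eta\left(\left(\frac{\|\Sigma\|}{r^2}\right)^2\left(\log\frac2\delta + d_{\mathrm{eff}}(\mathcal{I}_R^{-1}) + \frac{d_{\mathrm{eff}}(\Sigma)^2}{d_{\mathrm{eff}}(\mathcal{I}_R^{-1})}\right)\right). $$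
   Context: $f^\lambda(x)=f(x-\lambda)$ is $f$ translated by $\lambda$. $f_R=f*\mathcal{N}(0,R)$ is the $R$-smoothed distribution (identified with its density), with score $s_R(x)=\nabla\log f_R(x)$ and Fisher information matrix $\mathcal{I}_R=\mathbb{E}_{x\sim f_R}[s_R(x)s_R(x)^T]$. $\|A\|$ is the operator norm of a matrix $A$, and $d_{\mathrm{eff}}(A)=\mathrm{Tr}(A)/\|A\|$ for positive semidefinite $A$. $O_\eta(\cdot)$ hides a constant depending only on $\eta$. Heavy-tailed mean estimator (known result). There are universal constants $C_0,C_1,C_2$ such that for every $m,d$ and $\delta'>2^{-m/C_2}$ there is an algorithm, running in time $O(md)+(d\log(1/\delta'))^{C_0}$, which, given $m$ i.i.d. copies of any random variable $X$ on $\mathbb{R}^d$ with mean $\mu$ and covariance $\Sigma$, outputs $\hat\mu$ with $\|\hat\mu-\mu\|\le C_1\left(\sqrt{\mathrm{Tr}(\Sigma)/m}+\sqrt{\|\Sigma\|\log(1/\delta')/m}\right)$ with probability at least $1-\delta'$. Local MLE. Input: $f$, $R$, samples $x_1,\dots,x_m$ from $f^\lambda$, an initial estimate $\lambda_1$. Perturb each sample independently, $x_i'=x_i+\mathcal{N}(0,R)$; let $\hat\epsilon=\frac1m\sum_{i=1}^m\mathcal{I}_R^{-1}s_R(x_i'-\lambda_1)$; return $\lambda_1-\hat\epsilon$. High-dimensional global MLE. Input: $\delta$, $f$, $n$ samples from $f^\lambda$, $R$, $\eta$. (1) Using the first $\eta/C$ fraction of the samples, for a large constant $C$, compute an initial estimate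 $\lambda_1$ of $\lambda$ with the heavy-tailed mean estimator above (failure probability $\delta/2$), taking $f$ to have mean zero so that the mean of $f^\lambda$ is $\lambda$ (in general, subtract the known mean of $f$ from $\hat\mu$). (2) Run the local MLE on the remaining $1-\eta/C$ fraction of the samples with smoothing $R$ and initial estimate $\lambda_1$; return its output $\hat\lambda$. The probability is over the samples and the Gaussian perturbations. *)

theory Defs
  imports "HOL-Probability.Probability" "Jordan_Normal_Form.Gauss_Jordan_Elimination"
    "Jordan_Normal_Form.Determinant"
begin

text \<open>
  The constants in the estimation bounds do not depend on the dimension, so the dimension \<open>d\<close>
  is a natural number rather than a type: a point of \<open>d\<close>-dimensional space is an
  (extensional) function on \<open>{..<d}\<close>, its Euclidean norm is \<^const>\<open>L2_set\<close>, and matrices are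
  those of \<^theory>\<open>Jordan_Normal_Form.Matrix\<close>.
\<close>

section \<open>Euclidean space of dimension d\<close>

definition Rd :: "nat \<Rightarrow> (nat \<Rightarrow> real) measure" where
  "Rd d = PiM {..<d} (\<lambda>_. borel)"

definition lborel_Rd :: "nat \<Rightarrow> (nat \<Rightarrow> real) measure" where
  "lborel_Rd d = PiM {..<d} (\<lambda>_. lborel)"

definition vadd :: "nat \<Rightarrow> (nat \<Rightarrow> real) \<Rightarrow> (nat \<Rightarrow> real) \<Rightarrow> nat \<Rightarrow> real" where
  "vadd d x y = (\<lambda>i\<in>{..<d}. x i + y i)"

definition vsub :: "nat \<Rightarrow> (nat \<Rightarrow> real) \<Rightarrow> (nat \<Rightarrow> real) \<Rightarrow> nat \<Rightarrow> real" where
  "vsub d x y = (\<lambda>i\<in>{..<d}. x i - y i)"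

definition vnorm :: "nat \<Rightarrow> (nat \<Rightarrow> real) \<Rightarrow> real" where
  "vnorm d x = L2_set x {..<d}"

definition mat_app :: "real Matrix.mat \<Rightarrow> (nat \<Rightarrow> real) \<Rightarrow> nat \<Rightarrow> real" where
  "mat_app A x = (\<lambda>i\<in>{..<dim_row A}. Matrix.vec_index (A *\<^sub>v Matrix.vec (dim_col A) x) i)"

definition mat_trace :: "real Matrix.mat \<Rightarrow> real" where
  "mat_trace A = (\<Sum>i<dim_row A. A $$ (i, i))"

definition op_norm :: "real Matrix.mat \<Rightarrow> real" where
  "op_norm A = (SUP x\<in>{x. vnorm (dim_col A) x \<le> 1}. vnorm (dim_row A) (mat_app A x))"

definition d_eff :: "real Matrix.mat \<Rightarrow> real" where
  "d_eff A = mat_trace A / op_norm A"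

text \<open>Unspecified for singular matrices.\<close>

definition mat_inv :: "real Matrix.mat \<Rightarrow> real Matrix.mat" where
  "mat_inv A = the (mat_inverse A)"


section \<open>Distributions, smoothing, score and Fisher information\<close>

text \<open>Probability distributions for which the covariance matrix exists; no density is assumed.\<close>

definition finite_cov_distribution :: "nat \<Rightarrow> (nat \<Rightarrow> real) measure \<Rightarrow> bool" where
  "finite_cov_distribution d P \<longleftrightarrow>
     prob_space P \<and> sets P = sets (Rd d) \<and> (\<forall>i<d. integrable P (\<lambda>x. (x i)\<^sup>2))"

definition mean_vec :: "nat \<Rightarrow> (nat \<Rightarrow> real) measure \<Rightarrow> nat \<Rightarrow> real" where
  "mean_vec d P = (\<lambda>i\<in>{..<d}. \<integral>x. x i \<partial>P)"

definition cov_mat :: "nat \<Rightarrow> (nat \<Rightarrow> real) measure \<Rightarrow> real Matrix.mat" where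
  "cov_mat d P = Matrix.mat d d
     (\<lambda>(i, j). \<integral>x. (x i - mean_vec d P i) * (x j - mean_vec d P j) \<partial>P)"

text \<open>The law of \<open>x + \<lambda>\<close> for \<open>x \<sim> f\<close>, i.e. the density \<open>f\<close> shifted to \<open>f(x - \<lambda>)\<close>.\<close>

definition translate ::
  "nat \<Rightarrow> (nat \<Rightarrow> real) measure \<Rightarrow> (nat \<Rightarrow> real) \<Rightarrow> (nat \<Rightarrow> real) measure" where
  "translate d f l = distr f (Rd d) (\<lambda>x. vadd d x l)"

text \<open>Density and law of \<open>N(0, R)\<close>, for positive definite \<open>R\<close>.\<close>

definition gauss_density :: "nat \<Rightarrow> real Matrix.mat \<Rightarrow> (nat \<Rightarrow> real) \<Rightarrow> real" where
  "gauss_density d R z =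
     exp (- (\<Sum>i<d. z i * mat_app (mat_inv R) z i) / 2) / sqrt ((2 * pi) ^ d * Determinant.det R)"

definition gauss :: "nat \<Rightarrow> real Matrix.mat \<Rightarrow> (nat \<Rightarrow> real) measure" where
  "gauss d R = density (lborel_Rd d) (\<lambda>z. ennreal (gauss_density d R z))"

text \<open>The convolution of \<open>f\<close> with \<open>N(0, R)\<close>: its everywhere-defined smooth density, and its law.\<close>

definition smoothed_density ::
  "nat \<Rightarrow> (nat \<Rightarrow> real) measure \<Rightarrow> real Matrix.mat \<Rightarrow> (nat \<Rightarrow> real) \<Rightarrow> real" where
  "smoothed_density d f R x = (\<integral>y. gauss_density d R (vsub d x y) \<partial>f)"

definition smoothed ::
  "nat \<Rightarrow> (nat \<Rightarrow> real) measure \<Rightarrow> real Matrix.mat \<Rightarrow> (nat \<Rightarrow> real) measure" where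
  "smoothed d f R = density (lborel_Rd d) (\<lambda>x. ennreal (smoothed_density d f R x))"

text \<open>The gradient is the vector of partial derivatives.\<close>

definition score ::
  "nat \<Rightarrow> (nat \<Rightarrow> real) measure \<Rightarrow> real Matrix.mat \<Rightarrow> (nat \<Rightarrow> real) \<Rightarrow> nat \<Rightarrow> real" where
  "score d f R x =
     (\<lambda>i\<in>{..<d}. deriv (\<lambda>t. ln (smoothed_density d f R (x(i := t)))) (x i))"

definition fisher ::
  "nat \<Rightarrow> (nat \<Rightarrow> real) measure \<Rightarrow> real Matrix.mat \<Rightarrow> real Matrix.mat" where
  "fisher d f R = Matrix.mat d d
     (\<lambda>(i, j). \<integral>x. score d f R x i * score d f R x j \<partial>smoothed d f R)"


section \<open>The heavy-tailed mean estimator\<close>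

text \<open>
  \<open>est d m \<delta>'\<close> maps \<open>m\<close> samples to an estimate of the mean. Only the accuracy guarantee is
  recorded, not the running time.
\<close>

definition heavy_tailed_mean_estimator ::
  "real \<Rightarrow> real \<Rightarrow> (nat \<Rightarrow> nat \<Rightarrow> real \<Rightarrow> (nat \<Rightarrow> nat \<Rightarrow> real) \<Rightarrow> nat \<Rightarrow> real) \<Rightarrow> bool" where
  "heavy_tailed_mean_estimator C\<^sub>1 C\<^sub>2 est \<longleftrightarrow>
     (\<forall>d m \<delta>'. 0 < d \<and> 2 powr (- (real m / C\<^sub>2)) < \<delta>' \<and> \<delta>' < 1 \<longrightarrow>
        est d m \<delta>' \<in> PiM {..<m} (\<lambda>_. Rd d) \<rightarrow>\<^sub>M Rd d \<and>
        (\<forall>P. finite_cov_distribution d P \<longrightarrow>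
           measure (PiM {..<m} (\<lambda>_. P))
             {xs \<in> space (PiM {..<m} (\<lambda>_. P)).
                vnorm d (vsub d (est d m \<delta>' xs) (mean_vec d P)) \<le>
                  C\<^sub>1 * (sqrt (mat_trace (cov_mat d P) / real m)
                        + sqrt (op_norm (cov_mat d P) * ln (1 / \<delta>') / real m))}
           \<ge> 1 - \<delta>'))"


section \<open>The algorithms\<close>

text \<open>
  Randomness is an explicit argument: \<open>zs i\<close> is the Gaussian perturbation of the sample \<open>xs i\<close>.
\<close>

definition local_mle ::
  "nat \<Rightarrow> (nat \<Rightarrow> real) measure \<Rightarrow> real Matrix.mat \<Rightarrow> nat \<Rightarrow> (nat \<Rightarrow> nat \<Rightarrow> real) \<Rightarrow>
   (nat \<Rightarrow> nat \<Rightarrow> real) \<Rightarrow> (nat \<Rightarrow> real) \<Rightarrow> nat \<Rightarrow> real" where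
  "local_mle d f R m xs zs l1 =
     (let \<epsilon> = (\<lambda>i\<in>{..<d}. 1 / real m *
           (\<Sum>k<m. mat_app (mat_inv (fisher d f R))
                       (score d f R (vsub d (vadd d (xs k) (zs k)) l1)) i))
      in vsub d l1 \<epsilon>)"

text \<open>
  The first \<open>\<lfloor>\<eta> n / C\<rfloor>\<close> samples are used for the initial estimate, the remaining ones for
  the local MLE. The known mean of \<open>f\<close> is subtracted, so \<open>f\<close> need not be centred.
\<close>

definition global_mle ::
  "real \<Rightarrow> (nat \<Rightarrow> nat \<Rightarrow> real \<Rightarrow> (nat \<Rightarrow> nat \<Rightarrow> real) \<Rightarrow> nat \<Rightarrow> real) \<Rightarrow> nat \<Rightarrow> real \<Rightarrow>
   (nat \<Rightarrow> real) measure \<Rightarrow> nat \<Rightarrow> real Matrix.mat \<Rightarrow> real \<Rightarrow>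
   (nat \<Rightarrow> nat \<Rightarrow> real) \<Rightarrow> (nat \<Rightarrow> nat \<Rightarrow> real) \<Rightarrow> nat \<Rightarrow> real" where
  "global_mle C est d \<delta> f n R \<eta> xs zs =
     (let m = nat \<lfloor>\<eta> / C * real n\<rfloor>;
          l1 = vsub d (est d m (\<delta> / 2) (restrict xs {..<m})) (mean_vec d f)
      in local_mle d f R (n - m) (\<lambda>k. xs (m + k)) (\<lambda>k. zs (m + k)) l1)"

definition sample_space ::
  "nat \<Rightarrow> (nat \<Rightarrow> real) measure \<Rightarrow> nat \<Rightarrow> real Matrix.mat \<Rightarrow> (nat \<Rightarrow> real) \<Rightarrow>
   ((nat \<Rightarrow> nat \<Rightarrow> real) \<times> (nat \<Rightarrow> nat \<Rightarrow> real)) measure" where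
  "sample_space d f n R l =
     PiM {..<n} (\<lambda>_. translate d f l) \<Otimes>\<^sub>M PiM {..<n} (\<lambda>_. gauss d R)"

end

(*
  Write p for the density of the smoothed law, s for its score, and P for the conditional expectation
  of the noise z given x = y + z (y ~ f, z ~ N(0, r^2)).  Both w.s(x) = P[- w.z / r^2] and
  p(x + c) / p(x) = P[exp(- c.z / r^2 - |c|^2 / (2 r^2))] are posterior means.  Since P contracts L2,
  the bias of the local step at distance |c| is second order in |c| / r.  Jensen's inequality for P shows
  that log p is semiconvex, so a large score persists along a step of length r on which the density grows
  exponentially; hence all higher moments of the score in a direction are controlled by its second
  moment, without logarithmic loss, and the summands of the local step are subgamma with variance
  proxy J, the inverse information matrix.

  A PAC-Bayesian argument (Gaussian prior on the dual variable, posterior shifted towards the observed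
  deviation and truncated to where the moment generating function is controlled) turns this into the
  bound sqrt(Tr J) + O(sqrt(|J| log(1/delta))) for the norm of the normalized sum.  The covariance inequality
  gives |J| <= 4 |Sigma|, so the first stage is accurate enough for both estimates.
*)

theory Submission
  imports Defs
begin

section \<open>Coordinates\<close>

text \<open>The leading factor 1 + \<eta> forces every remainder to be relative to the variance
  \<open>info w\<close> of the score in direction w: a sub-Gaussian bound with the crude proxy
  |w|^2/r^2 would have the wrong size. Yet the moment generating function is controlled only for |w|
  up to a multiple of r; this is why the Gaussian mixture must be truncated and why n has to
  dominate log(1/\<delta>) and d_eff(J). The centre of the local step is random, but it comes from
  samples the step does not use, so moment bounds are proved for a fixed centre with error e and
  integrated afterwards. Summands are centred at their true mean \<open>drift\<close>; the gap
  between e and J times the drift is a bias of size sqrt(|J|) |e|^2/r^2. As |e|^2 is of order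
  |\<Sigma>| (d_eff(\<Sigma>) + log(1/\<delta>))/n, keeping this bias below sqrt(Tr J / n) is the
  origin of the term d_eff(\<Sigma>)^2/d_eff(J). No spectral decomposition occurs: J enters through
  the identity E[(Jv.s)(w.s)] = v.w for the score s.\<close>

definition ip :: "nat \<Rightarrow> (nat \<Rightarrow> real) \<Rightarrow> (nat \<Rightarrow> real) \<Rightarrow> real" where
  "ip d x y = (\<Sum>i<d. x i * y i)"

lemma ip_commute: "ip d x y = ip d y x"
  by (simp add: ip_def mult.commute)

lemma ip_add_left: "ip d (\<lambda>i. x i + y i) z = ip d x z + ip d y z"
  and ip_add_right: "ip d z (\<lambda>i. x i + y i) = ip d z x + ip d z y"
  and ip_diff_left: "ip d (\<lambda>i. x i - y i) z = ip d x z - ip d y z"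
  and ip_diff_right: "ip d z (\<lambda>i. x i - y i) = ip d z x - ip d z y"
  and ip_scale_left: "ip d (\<lambda>i. c * x i) z = c * ip d x z"
  and ip_scale_right: "ip d z (\<lambda>i. c * x i) = c * ip d z x"
  and ip_minus_left: "ip d (\<lambda>i. - x i) z = - ip d x z"
  and ip_minus_right: "ip d z (\<lambda>i. - x i) = - ip d z x"
  by (simp_all add: ip_def algebra_simps sum.distrib sum_subtractf sum_distrib_left sum_negf)

lemmas ip_linear = ip_add_left ip_add_right ip_diff_left ip_diff_right ip_scale_left
  ip_scale_right ip_minus_left ip_minus_right

text \<open>\<open>ip\<close> and \<open>vnorm\<close> read only coordinates below d. Points can
  therefore be written as plain pointwise functions and exchanged for the extensional
  \<open>vadd\<close> and \<open>vsub\<close> by congruence.\<close>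

lemma ip_cong:
  "(\<And>i. i < d \<Longrightarrow> x i = x' i) \<Longrightarrow> (\<And>i. i < d \<Longrightarrow> y i = y' i) \<Longrightarrow> ip d x y = ip d x' y'"
  by (simp add: ip_def)

lemma ip_self_nonneg [simp]: "0 \<le> ip d x x"
  by (simp add: ip_def sum_nonneg)

lemma vnorm_sq: "(vnorm d x)\<^sup>2 = ip d x x"
  by (simp add: vnorm_def L2_set_def ip_def sum_nonneg power2_eq_square)

lemma vnorm_nonneg [simp]: "0 \<le> vnorm d x"
  by (simp add: vnorm_def)

lemma vnorm_eq_sqrt: "vnorm d x = sqrt (ip d x x)"
  by (metis vnorm_sq vnorm_nonneg real_sqrt_unique)

lemma vnorm_cong: "(\<And>i. i < d \<Longrightarrow> x i = y i) \<Longrightarrow> vnorm d x = vnorm d y"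
  by (simp add: vnorm_def L2_set_def)

lemma vnorm_triangle: "vnorm d (\<lambda>i. x i + y i) \<le> vnorm d x + vnorm d y"
  unfolding vnorm_def by (rule L2_set_triangle_ineq)

lemma vnorm_scale: "vnorm d (\<lambda>i. c * x i) = \<bar>c\<bar> * vnorm d x"
  by (simp add: vnorm_eq_sqrt ip_linear real_sqrt_mult flip: mult.assoc power2_eq_square)

lemma vnorm_minus: "vnorm d (\<lambda>i. - x i) = vnorm d x"
  by (simp add: vnorm_eq_sqrt ip_linear)

lemma abs_ip_le: "\<bar>ip d x y\<bar> \<le> vnorm d x * vnorm d y"
proof -
  have "\<bar>ip d x y\<bar> \<le> (\<Sum>i<d. \<bar>x i\<bar> * \<bar>y i\<bar>)"
    unfolding ip_def by (rule order_trans[OF sum_abs]) (simp add: abs_mult)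
  also have "\<dots> \<le> vnorm d x * vnorm d y"
    unfolding vnorm_def by (rule L2_set_mult_ineq)
  finally show ?thesis .
qed

lemma ip_sq_le: "(ip d x y)\<^sup>2 \<le> ip d x x * ip d y y"
  using power_mono[OF abs_ip_le[of d x y], of 2]
  by (simp add: power_mult_distrib vnorm_sq)

lemma vnorm_zero_iff: "vnorm d x = 0 \<longleftrightarrow> (\<forall>i<d. x i = 0)"
  by (auto simp: vnorm_def L2_set_eq_0_iff)

lemma component_measurable [measurable_dest]:
  "h \<in> M \<rightarrow>\<^sub>M Rd d \<Longrightarrow> i < d \<Longrightarrow> (\<lambda>x. h x i) \<in> borel_measurable M"
  unfolding Rd_def by (rule measurable_compose[where N="PiM {..<d} (\<lambda>_. borel)"]) auto

lemma coordinate_measurable [measurable (raw)]: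
  "i < d \<Longrightarrow> (\<lambda>x. x i) \<in> borel_measurable (Rd d)"
  unfolding Rd_def by auto

lemma ip_measurable [measurable (raw)]:
  assumes [measurable]: "\<And>i. i < d \<Longrightarrow> (\<lambda>x. g x i) \<in> borel_measurable M"
    "\<And>i. i < d \<Longrightarrow> (\<lambda>x. h x i) \<in> borel_measurable M"
  shows "(\<lambda>x. ip d (g x) (h x)) \<in> borel_measurable M"
  unfolding ip_def by (intro borel_measurable_sum borel_measurable_times) auto

lemma vnorm_measurable [measurable (raw)]:
  assumes [measurable]: "\<And>i. i < d \<Longrightarrow> (\<lambda>x. g x i) \<in> borel_measurable M"
  shows "(\<lambda>x. vnorm d (g x)) \<in> borel_measurable M"
  unfolding vnorm_eq_sqrt by measurable

lemma measurable_RdI: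
  assumes "\<And>i. i < d \<Longrightarrow> (\<lambda>x. h x i) \<in> borel_measurable M"
    and "\<And>x. x \<in> space M \<Longrightarrow> h x \<in> extensional {..<d}"
  shows "h \<in> M \<rightarrow>\<^sub>M Rd d"
  unfolding Rd_def using assms by (intro measurable_PiM_single') (auto simp: PiE_iff)

lemma vadd_measurable [measurable (raw)]:
  assumes [measurable]: "\<And>i. i < d \<Longrightarrow> (\<lambda>x. g x i) \<in> borel_measurable M"
    "\<And>i. i < d \<Longrightarrow> (\<lambda>x. h x i) \<in> borel_measurable M"
  shows "(\<lambda>x. vadd d (g x) (h x)) \<in> M \<rightarrow>\<^sub>M Rd d"
  by (rule measurable_RdI) (auto simp: vadd_def)

lemma vsub_measurable [measurable (raw)]:
  assumes [measurable]: "\<And>i. i < d \<Longrightarrow> (\<lambda>x. g x i) \<in> borel_measurable M"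
    "\<And>i. i < d \<Longrightarrow> (\<lambda>x. h x i) \<in> borel_measurable M"
  shows "(\<lambda>x. vsub d (g x) (h x)) \<in> M \<rightarrow>\<^sub>M Rd d"
  by (rule measurable_RdI) (auto simp: vsub_def)

lemma vadd_coordinate_measurable [measurable (raw)]:
  assumes "i < d" "(\<lambda>x. g x i) \<in> borel_measurable M" "(\<lambda>x. h x i) \<in> borel_measurable M"
  shows "(\<lambda>x. vadd d (g x) (h x) i) \<in> borel_measurable M"
  using assms by (simp add: vadd_def)

lemma vsub_coordinate_measurable [measurable (raw)]:
  assumes "i < d" "(\<lambda>x. g x i) \<in> borel_measurable M" "(\<lambda>x. h x i) \<in> borel_measurable M"
  shows "(\<lambda>x. vsub d (g x) (h x) i) \<in> borel_measurable M"
  using assms by (simp add: vsub_def)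

lemma fst_coordinate_measurable [measurable (raw)]:
  assumes "i < d" and [measurable]: "g \<in> M \<rightarrow>\<^sub>M Rd d \<Otimes>\<^sub>M K"
  shows "(\<lambda>x. fst (g x) i) \<in> borel_measurable M"
  by (rule component_measurable[OF _ assms(1)]) measurable

lemma snd_coordinate_measurable [measurable (raw)]:
  assumes "i < d" and [measurable]: "g \<in> M \<rightarrow>\<^sub>M K \<Otimes>\<^sub>M Rd d"
  shows "(\<lambda>x. snd (g x) i) \<in> borel_measurable M"
  by (rule component_measurable[OF _ assms(1)]) measurable

section \<open>Lebesgue measure on R^d and its invariance under translation and reflection\<close>

lemma sets_lborel_Rd [measurable_cong, simp]: "sets (lborel_Rd d) = sets (Rd d)"
  unfolding lborel_Rd_def Rd_def by (rule sets_PiM_cong) auto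

lemma space_Rd: "space (Rd d) = extensional {..<d}"
  by (auto simp: Rd_def space_PiM PiE_def)

lemma space_lborel_Rd [simp]: "space (lborel_Rd d) = space (Rd d)"
  by (rule sets_eq_imp_space_eq) simp

interpretation lborel_prod: product_sigma_finite "\<lambda>_. lborel :: real measure"
  by standard

lemma sigma_finite_lborel_Rd: "sigma_finite_measure (lborel_Rd d)"
  unfolding lborel_Rd_def by (rule lborel_prod.sigma_finite) simp

text \<open>The preimage of a box under a coordinatewise map is a box, and boxes determine the
  product measure, so invariance in each coordinate suffices.\<close>

lemma lborel_Rd_map:
  assumes meas [measurable]: "\<And>i. i < d \<Longrightarrow> \<phi> i \<in> borel_measurable borel"
    and \<phi>: "\<And>i. i < d \<Longrightarrow> distr lborel borel (\<phi> i) = (lborel :: real measure)"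
  shows "distr (lborel_Rd d) (lborel_Rd d) (\<lambda>x. \<lambda>i\<in>{..<d}. \<phi> i (x i)) = lborel_Rd d"
  unfolding lborel_Rd_def
proof (rule lborel_prod.PiM_eqI)
  let ?M = "PiM {..<d} (\<lambda>_. lborel :: real measure)" and ?g = "\<lambda>x. \<lambda>i\<in>{..<d}. \<phi> i (x i)"
  fix A :: "nat \<Rightarrow> real set"
  assume A: "\<And>i. i \<in> {..<d} \<Longrightarrow> A i \<in> sets lborel"
  interpret finite_product_sigma_finite "\<lambda>_. lborel :: real measure" "{..<d}"
    by standard auto
  have g: "?g \<in> ?M \<rightarrow>\<^sub>M ?M"
    by (rule measurable_restrict) (use meas in auto)
  have pre: "?g -` Pi\<^sub>E {..<d} A \<inter> space ?M = Pi\<^sub>E {..<d} (\<lambda>i. \<phi> i -` A i)"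
    by (auto simp: space_PiM PiE_iff)
  have m: "\<phi> i -` A i \<in> sets lborel" if "i < d" for i
    using A[of i] that measurable_sets[OF meas[OF that], of "A i"] by simp
  have em: "emeasure lborel (\<phi> i -` A i) = emeasure lborel (A i)" if "i < d" for i
    using A[of i] that meas[OF that] emeasure_distr[of "\<phi> i" lborel borel "A i"]
    by (simp add: \<phi>)
  have "emeasure ?M (Pi\<^sub>E {..<d} (\<lambda>i. \<phi> i -` A i)) = (\<Prod>i\<in>{..<d}. emeasure lborel (\<phi> i -` A i))"
    using m by (intro measure_times) auto
  then show "emeasure (distr ?M ?M ?g) (Pi\<^sub>E {..<d} A) = (\<Prod>i\<in>{..<d}. emeasure lborel (A i))"
    using A em by (subst emeasure_distr[OF g]) (auto simp: pre intro!: sets_PiM_I_finite)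
qed simp_all

lemma lborel_Rd_vadd: "distr (lborel_Rd d) (lborel_Rd d) (\<lambda>x. vadd d x c) = lborel_Rd d"
proof -
  have "(\<lambda>x. vadd d x c) = (\<lambda>x. \<lambda>i\<in>{..<d}. c i + x i)"
    by (simp add: vadd_def add.commute)
  then show ?thesis
    using lborel_Rd_map[of d "\<lambda>i t. c i + t"] by (simp add: lborel_distr_plus)
qed

lemma lborel_Rd_minus:
  "distr (lborel_Rd d) (lborel_Rd d) (\<lambda>x. vsub d (\<lambda>_. 0) x) = lborel_Rd d"
  using lborel_Rd_map[of d "\<lambda>_. uminus"] by (simp add: lborel_distr_uminus vsub_def)

lemma nn_integral_lborel_Rd_vadd:
  assumes [measurable]: "g \<in> borel_measurable (Rd d)"
  shows "(\<integral>\<^sup>+x. g (vadd d x c) \<partial>lborel_Rd d) = (\<integral>\<^sup>+x. g x \<partial>lborel_Rd d)"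
  by (subst (2) lborel_Rd_vadd[symmetric, of _ c], subst nn_integral_distr) auto

section \<open>Isotropic Gaussian measures\<close>

definition gd :: "nat \<Rightarrow> real \<Rightarrow> (nat \<Rightarrow> real) \<Rightarrow> real" where
  "gd d r z = exp (- (ip d z z / (2 * r\<^sup>2))) / sqrt (2 * pi * r\<^sup>2) ^ d"

text \<open>Used in two roles: at scale r as the smoothing noise, and at scale 1 as the prior over
  directions in the concentration argument.\<close>

definition gaussN :: "nat \<Rightarrow> real \<Rightarrow> (nat \<Rightarrow> real) measure" where
  "gaussN d r = density (lborel_Rd d) (\<lambda>z. ennreal (gd d r z))"

lemma gd_pos: "0 < r \<Longrightarrow> 0 < gd d r z"
  by (simp add: gd_def)

lemma gd_nonneg [simp]: "0 \<le> gd d r z"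
  by (simp add: gd_def)

lemma gd_cong: "(\<And>i. i < d \<Longrightarrow> x i = y i) \<Longrightarrow> gd d r x = gd d r y"
  unfolding gd_def by (simp cong: ip_cong)

lemma gd_measurable [measurable (raw)]:
  assumes [measurable]: "\<And>i. i < d \<Longrightarrow> (\<lambda>x. g x i) \<in> borel_measurable M"
  shows "(\<lambda>x. gd d r (g x)) \<in> borel_measurable M"
  unfolding gd_def by measurable

lemma gd_measurable' [measurable]: "gd d r \<in> borel_measurable (Rd d)"
  using gd_measurable[of d "\<lambda>x. x" "Rd d" r] by simp

lemma sets_gaussN [measurable_cong, simp]: "sets (gaussN d r) = sets (Rd d)"
  by (simp add: gaussN_def)

lemma space_gaussN [simp]: "space (gaussN d r) = space (Rd d)"
  by (rule sets_eq_imp_space_eq) simp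

lemma gd_prod: "gd d r z = (\<Prod>i<d. normal_density 0 r (z i))"
proof -
  have "(\<Prod>i<d. normal_density 0 r (z i)) = (\<Prod>i<d. exp (- (z i * z i / (2 * r\<^sup>2)))) / sqrt (2 * pi * r\<^sup>2) ^ d"
    by (simp add: normal_density_def power2_eq_square prod_dividef)
  also have "(\<Prod>i<d. exp (- (z i * z i / (2 * r\<^sup>2)))) = exp (- (ip d z z / (2 * r\<^sup>2)))"
    by (simp add: ip_def exp_sum sum_negf sum_divide_distrib flip: sum_negf)
  finally show ?thesis
    by (simp add: gd_def)
qed

text \<open>Expand |z + c|^2. The exponential factor is the Cameron-Martin likelihood ratio; it
  returns as the function whose posterior mean is the density ratio, and as the cost of shifting the
  prior.\<close>

lemma gd_shift:
  "gd d r (\<lambda>i. z i + c i) = gd d r z * exp (- (ip d c z / r\<^sup>2) - ip d c c / (2 * r\<^sup>2))"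
proof -
  have "ip d (\<lambda>i. z i + c i) (\<lambda>i. z i + c i) / (2 * r\<^sup>2)
      = ip d z z / (2 * r\<^sup>2) + ip d c z / r\<^sup>2 + ip d c c / (2 * r\<^sup>2)"
    by (simp add: ip_linear ip_commute[of d z c] add_divide_distrib)
  then show ?thesis
    by (simp add: gd_def flip: exp_add)
qed

lemma gd_vsub_vadd:
  "gd d r (vsub d (vadd d x c) y)
    = exp (- (ip d c (vsub d x y) / r\<^sup>2) - ip d c c / (2 * r\<^sup>2)) * gd d r (vsub d x y)"
proof -
  have "gd d r (vsub d (vadd d x c) y) = gd d r (\<lambda>i. vsub d x y i + c i)"
    by (rule gd_cong) (simp add: vsub_def vadd_def)
  then show ?thesis by (simp add: gd_shift)
qed

lemma nn_integral_gaussN: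
  "g \<in> borel_measurable (Rd d) \<Longrightarrow>
    (\<integral>\<^sup>+z. g z \<partial>gaussN d r) = (\<integral>\<^sup>+z. ennreal (gd d r z) * g z \<partial>lborel_Rd d)"
  unfolding gaussN_def by (rule nn_integral_density) auto

lemma integral_gaussN:
  "g \<in> borel_measurable (Rd d) \<Longrightarrow>
    (\<integral>z. g z \<partial>gaussN d r) = (\<integral>z. gd d r z * g z \<partial>lborel_Rd d)" for g :: "(nat \<Rightarrow> real) \<Rightarrow> real"
  unfolding gaussN_def by (subst integral_density) auto

lemma prob_space_gaussN: assumes "0 < r" shows "prob_space (gaussN d r)"
proof
  have "emeasure (gaussN d r) (space (gaussN d r)) = (\<integral>\<^sup>+z. (\<Prod>i<d. ennreal (normal_density 0 r (z i))) \<partial>lborel_Rd d)"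
    using nn_integral_gaussN[of "\<lambda>_. 1" d r] by (simp add: gd_prod prod_ennreal)
  also have "\<dots> = (\<Prod>i<d. (\<integral>\<^sup>+x. ennreal (normal_density 0 r x) \<partial>lborel))"
    unfolding lborel_Rd_def by (rule lborel_prod.product_nn_integral_prod) auto
  also have "(\<integral>\<^sup>+x. ennreal (normal_density 0 r x) \<partial>lborel) = 1"
    using assms prob_space_normal_density[of r 0] 
    by (simp add: prob_space_def prob_space_axioms_def emeasure_density)
  finally show "emeasure (gaussN d r) (space (gaussN d r)) = 1" by simp
qed

text \<open>Cameron-Martin formula: translation invariance of Lebesgue measure combined with
  \<open>gd_shift\<close>. Nonnegative integrals spare any prior integrability of the tilted
  integrand.\<close>

lemma nn_integral_gaussN_shift:
  assumes [measurable]: "g \<in> borel_measurable (Rd d)"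
  shows "(\<integral>\<^sup>+z. g z \<partial>gaussN d r)
    = (\<integral>\<^sup>+z. g (vadd d z v) * ennreal (exp (- (ip d v z / r\<^sup>2) - ip d v v / (2 * r\<^sup>2))) \<partial>gaussN d r)"
proof -
  have "(\<integral>\<^sup>+z. g z \<partial>gaussN d r) = (\<integral>\<^sup>+z. ennreal (gd d r (vadd d z v)) * g (vadd d z v) \<partial>lborel_Rd d)"
    by (simp add: nn_integral_gaussN)
      (rule nn_integral_lborel_Rd_vadd[symmetric], measurable)
  also have "\<dots> = (\<integral>\<^sup>+z. ennreal (gd d r z) * (g (vadd d z v)
      * ennreal (exp (- (ip d v z / r\<^sup>2) - ip d v v / (2 * r\<^sup>2)))) \<partial>lborel_Rd d)"
  proof (rule nn_integral_cong)
    fix z :: "nat \<Rightarrow> real"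
    have "gd d r (vadd d z v) = gd d r (\<lambda>i. z i + v i)"
      by (rule gd_cong) (simp add: vadd_def)
    then show "ennreal (gd d r (vadd d z v)) * g (vadd d z v) = ennreal (gd d r z) * (g (vadd d z v)
      * ennreal (exp (- (ip d v z / r\<^sup>2) - ip d v v / (2 * r\<^sup>2))))"
      by (simp add: gd_shift ennreal_mult mult_ac)
  qed
  also have "\<dots> = (\<integral>\<^sup>+z. g (vadd d z v) * ennreal (exp (- (ip d v z / r\<^sup>2) - ip d v v / (2 * r\<^sup>2))) \<partial>gaussN d r)"
    by (rule nn_integral_gaussN[symmetric]) measurable
  finally show ?thesis .
qed

text \<open>The density is even. This removes odd moments, and later the linear term over a
  symmetric truncation set.\<close>

lemma integral_gaussN_minus:
  fixes g :: "(nat \<Rightarrow> real) \<Rightarrow> real"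
  assumes [measurable]: "g \<in> borel_measurable (Rd d)"
  shows "(\<integral>z. g (vsub d (\<lambda>_. 0) z) \<partial>gaussN d r) = (\<integral>z. g z \<partial>gaussN d r)"
proof -
  have eq: "gd d r z = gd d r (vsub d (\<lambda>_. 0) z)" for z
    by (simp add: gd_def vsub_def ip_def)
  have "(\<integral>z. g (vsub d (\<lambda>_. 0) z) \<partial>gaussN d r)
      = (\<integral>z. gd d r (vsub d (\<lambda>_. 0) z) * g (vsub d (\<lambda>_. 0) z) \<partial>lborel_Rd d)"
    by (subst integral_gaussN) (auto simp flip: eq)
  also have "\<dots> = (\<integral>z. gd d r z * g z \<partial>distr (lborel_Rd d) (lborel_Rd d) (\<lambda>x. vsub d (\<lambda>_. 0) x))"
    by (rule integral_distr[symmetric]) auto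
  also have "\<dots> = (\<integral>z. g z \<partial>gaussN d r)"
    by (simp add: lborel_Rd_minus integral_gaussN)
  finally show ?thesis .
qed

lemma gaussN_second_moment:
  assumes r: "0 < r" and ij: "i < d" "j < d"
  shows "integrable (gaussN d r) (\<lambda>z. z i * z j)"
    and "(\<integral>z. z i * z j \<partial>gaussN d r) = (if i = j then r\<^sup>2 else 0)"
proof -
  \<comment> \<open>Each factor of the product density takes along whichever of z_i and z_j lives in
    its coordinate, so the mixed moment is a product of one-dimensional moments.\<close>
  define F where "F k t = normal_density 0 r t * ((if k = i then t else 1) * (if k = j then t else 1))"
    for k t
  have m1: "has_bochner_integral lborel (\<lambda>t. normal_density 0 r t * t) 0"
    using normal_moment_nz_1[of r 0] r by simp
  have m2: "has_bochner_integral lborel (\<lambda>t. normal_density 0 r t * (t * t)) (r\<^sup>2)"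
    using normal_moment_even[OF r, of 0 1] by (simp add: power2_eq_square)
  have m0: "has_bochner_integral lborel (\<lambda>t. normal_density 0 r t) 1"
    using r integrable_normal_density[OF r, of 0] integral_normal_density[OF r, of 0] by (simp add: has_bochner_integral_iff)
  have F: "has_bochner_integral lborel (F k)
      (if k = i then if k = j then r\<^sup>2 else 0 else if k = j then 0 else 1)" for k
    unfolding F_def using m0 m1 m2 by (auto)
  have prodF: "gd d r z * (z i * z j) = (\<Prod>k<d. F k (z k))" for z
  proof -
    have "(\<Prod>k<d. F k (z k)) = (\<Prod>k<d. normal_density 0 r (z k)) *
        ((\<Prod>k<d. if k = i then z k else 1) * (\<Prod>k<d. if k = j then z k else 1))"
      by (simp add: F_def prod.distrib)
    then show ?thesis
      using ij by (simp add: gd_prod)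
  qed
  have int: "integrable (lborel_Rd d) (\<lambda>z. \<Prod>k<d. F k (z k))"
    unfolding lborel_Rd_def
    by (rule lborel_prod.product_integrable_prod) (use F in \<open>auto simp: has_bochner_integral_iff\<close>)
  have [measurable]: "(\<lambda>z. z i) \<in> borel_measurable (Rd d)" "(\<lambda>z. z j) \<in> borel_measurable (Rd d)"
    using ij by measurable
  show "integrable (gaussN d r) (\<lambda>z. z i * z j)"
    unfolding gaussN_def by (subst integrable_density) (auto simp: prodF int)
  have "(\<integral>z. z i * z j \<partial>gaussN d r) = (\<integral>z. (\<Prod>k<d. F k (z k)) \<partial>lborel_Rd d)"
    by (simp add: integral_gaussN prodF)
  also have "\<dots> = (\<Prod>k<d. integral\<^sup>L lborel (F k))"
    unfolding lborel_Rd_def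
    by (rule lborel_prod.product_integral_prod) (use F in \<open>auto simp: has_bochner_integral_iff\<close>)
  also have "\<dots> = (\<Prod>k<d. if k = i then if k = j then r\<^sup>2 else 0 else if k = j then 0 else 1)"
    by (intro prod.cong refl has_bochner_integral_integral_eq F)
  also have "\<dots> = (if i = j then r\<^sup>2 else 0)"
  proof (cases "i = j")
    case True
    then have "(\<Prod>k<d. if k = i then if k = j then r\<^sup>2 else 0 else if k = j then 0 else 1) = (\<Prod>k<d. if k = i then r\<^sup>2 else 1)"
      by (intro prod.cong) auto
    with True ij show ?thesis by simp
  next
    case False
    have "(\<Prod>k<d. if k = i then if k = j then r\<^sup>2 else 0 else if k = j then 0 else 1) = (0::real)"
      using ij False by (intro prod_zero bexI[of _ i]) auto
    with False show ?thesis by simp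
  qed
  finally show "(\<integral>z. z i * z j \<partial>gaussN d r) = (if i = j then r\<^sup>2 else 0)" .
qed

lemma integral_double_sum:
  fixes F :: "nat \<Rightarrow> nat \<Rightarrow> 'a \<Rightarrow> real"
  assumes "\<And>i j. i < d \<Longrightarrow> j < d \<Longrightarrow> integrable M (F i j)"
  shows "integrable M (\<lambda>x. \<Sum>i<d. \<Sum>j<d. a i j * F i j x)"
    and "(\<integral>x. (\<Sum>i<d. \<Sum>j<d. a i j * F i j x) \<partial>M) = (\<Sum>i<d. \<Sum>j<d. a i j * (\<integral>x. F i j x \<partial>M))"
proof -
  have int: "integrable M (\<lambda>x. \<Sum>j<d. a i j * F i j x)" if "i < d" for i
    by (intro Bochner_Integration.integrable_sum integrable_mult_right assms) (use that in auto)
  show "integrable M (\<lambda>x. \<Sum>i<d. \<Sum>j<d. a i j * F i j x)"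
    by (intro Bochner_Integration.integrable_sum[where f="\<lambda>i x. \<Sum>j<d. a i j * F i j x"] int) auto
  have "(\<integral>x. (\<Sum>i<d. \<Sum>j<d. a i j * F i j x) \<partial>M) = (\<Sum>i<d. \<integral>x. (\<Sum>j<d. a i j * F i j x) \<partial>M)"
    using int by (subst Bochner_Integration.integral_sum) auto
  also have "\<dots> = (\<Sum>i<d. \<Sum>j<d. a i j * (\<integral>x. F i j x \<partial>M))"
    using assms by (intro sum.cong refl) (subst Bochner_Integration.integral_sum, auto)
  finally show "(\<integral>x. (\<Sum>i<d. \<Sum>j<d. a i j * F i j x) \<partial>M)
      = (\<Sum>i<d. \<Sum>j<d. a i j * (\<integral>x. F i j x \<partial>M))" .
qed

lemma gaussN_bilinear_moment:
  assumes r: "0 < r"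
  shows "integrable (gaussN d r) (\<lambda>z. ip d v z * ip d w z)"
    and "(\<integral>z. ip d v z * ip d w z \<partial>gaussN d r) = r\<^sup>2 * ip d v w"
proof -
  have eq: "ip d v z * ip d w z = (\<Sum>i<d. \<Sum>j<d. v i * w j * (z i * z j))" for z
    by (simp add: ip_def sum_product mult_ac)
  show "integrable (gaussN d r) (\<lambda>z. ip d v z * ip d w z)"
    unfolding eq by (intro integral_double_sum gaussN_second_moment r)
  have "(\<integral>z. ip d v z * ip d w z \<partial>gaussN d r) = (\<Sum>i<d. \<Sum>j<d. v i * w j * (\<integral>z. z i * z j \<partial>gaussN d r))"
    unfolding eq by (intro integral_double_sum gaussN_second_moment r)
  also have "\<dots> = (\<Sum>i<d. \<Sum>j<d. if i = j then r\<^sup>2 * (v i * w i) else 0)"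
    by (intro sum.cong refl) (simp add: gaussN_second_moment r)
  also have "\<dots> = r\<^sup>2 * ip d v w"
    by (simp add: ip_def sum_distrib_left)
  finally show "(\<integral>z. ip d v z * ip d w z \<partial>gaussN d r) = r\<^sup>2 * ip d v w" .
qed

lemma gaussN_linear_moment:
  assumes r: "0 < r"
  shows "integrable (gaussN d r) (\<lambda>z. ip d w z)" and "(\<integral>z. ip d w z \<partial>gaussN d r) = 0"
proof -
  interpret prob_space "gaussN d r" by (rule prob_space_gaussN[OF r])
  have sq: "integrable (gaussN d r) (\<lambda>z. (ip d w z)\<^sup>2)"
    using gaussN_bilinear_moment(1)[OF r, of d w w] by (simp add: power2_eq_square)
  show "integrable (gaussN d r) (\<lambda>z. ip d w z)"
    by (rule square_integrable_imp_integrable[OF _ sq]) measurable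
  have "(\<integral>z. ip d w z \<partial>gaussN d r) = (\<integral>z. ip d w (vsub d (\<lambda>_. 0) z) \<partial>gaussN d r)"
    by (rule integral_gaussN_minus[symmetric]) measurable
  also have "\<dots> = (\<integral>z. - ip d w z \<partial>gaussN d r)"
    by (intro Bochner_Integration.integral_cong refl) (simp add: vsub_def ip_def sum_negf)
  finally show "(\<integral>z. ip d w z \<partial>gaussN d r) = 0" by simp
qed

lemma gaussN_mgf:
  assumes r: "0 < r"
  shows "(\<integral>\<^sup>+z. ennreal (exp (- (ip d c z / r\<^sup>2) - ip d c c / (2 * r\<^sup>2))) \<partial>gaussN d r) = 1"
proof -
  interpret prob_space "gaussN d r" by (rule prob_space_gaussN[OF r])
  show ?thesis
    using nn_integral_gaussN_shift[of "\<lambda>_. 1" d r c] by (simp add: emeasure_space_1[unfolded space_gaussN])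
qed

section \<open>Smoothing and posterior means\<close>

text \<open>\<open>mat_inv\<close> unpacks an option and says nothing for \<open>None\<close>; a
  two-sided inverse makes A a unit of the matrix ring, which excludes that case.\<close>

lemma mat_inv_unique:
  assumes A: "A \<in> carrier_mat n n" and B: "B \<in> carrier_mat n n" and AB: "A * B = 1\<^sub>m n"
  shows "mat_inv A = B"
proof -
  have BA: "B * A = 1\<^sub>m n"
    by (rule mat_mult_left_right_inverse[OF A B AB])
  show ?thesis
  proof (cases "mat_inverse A")
    case None
    then have "A \<notin> Units (ring_mat TYPE(real) n ())"
      by (rule mat_inverse(1)[OF A])
    moreover have "A \<in> Units (ring_mat TYPE(real) n ())"
      using A B AB BA by (auto simp: Units_def ring_mat_def)
    ultimately show ?thesis by simp
  next
    case (Some B')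
    then have B': "B' * A = 1\<^sub>m n" "B' \<in> carrier_mat n n"
      using mat_inverse(2)[OF A Some] by auto
    have "B' * (A * B) = B'"
      unfolding AB using B'(2) by (rule right_mult_one_mat)
    moreover have "B' * (A * B) = B"
      using assoc_mult_mat[OF B'(2) A B] B'(1) left_mult_one_mat[OF B] by simp
    ultimately have "B' = B" by simp
    then show ?thesis
      using Some by (simp add: mat_inv_def)
  qed
qed

lemma gauss_density_isotropic:
  assumes r: "0 < r"
  shows "gauss_density d (r\<^sup>2 \<cdot>\<^sub>m 1\<^sub>m d) z = gd d r z"
proof -
  have inv: "mat_inv (r\<^sup>2 \<cdot>\<^sub>m 1\<^sub>m d) = (1 / r\<^sup>2) \<cdot>\<^sub>m (1\<^sub>m d :: real mat)"
    by (rule mat_inv_unique[of _ d]) (use r in \<open>auto simp: mult_smult_distrib mult_smult_assoc_mat[of _ d d]\<close>)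
  have app: "mat_app ((1 / r\<^sup>2) \<cdot>\<^sub>m (1\<^sub>m d :: real mat)) z i = z i / r\<^sup>2" if "i < d" for i
  proof -
    have "Matrix.row ((1 / r\<^sup>2) \<cdot>\<^sub>m (1\<^sub>m d :: real mat)) i \<bullet> Matrix.vec d z = (\<Sum>j<d. (if i = j then 1 / r\<^sup>2 else 0) * z j)"
      using that by (auto simp: scalar_prod_def lessThan_atLeast0 intro!: sum.cong)
    also have "\<dots> = z i / r\<^sup>2"
      using that by (simp add: if_distrib[of "\<lambda>x. x * _"] cong: if_cong)
    finally show ?thesis
      using that by (simp add: mat_app_def)
  qed
  have det: "Determinant.det (r\<^sup>2 \<cdot>\<^sub>m (1\<^sub>m d :: real mat)) = (r\<^sup>2) ^ d"
    by (simp add: det_smult)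
  have "(\<Sum>i<d. z i * mat_app ((1 / r\<^sup>2) \<cdot>\<^sub>m (1\<^sub>m d :: real mat)) z i) = ip d z z / r\<^sup>2"
    by (simp add: app ip_def sum_divide_distrib)
  moreover have "sqrt ((2 * pi) ^ d * (r\<^sup>2) ^ d) = sqrt (2 * pi * r\<^sup>2) ^ d"
    by (simp add: power_mult_distrib real_sqrt_mult real_sqrt_power)
  ultimately show ?thesis
    by (simp add: gauss_density_def inv det gd_def)
qed

lemma gauss_isotropic: "0 < r \<Longrightarrow> gauss d (r\<^sup>2 \<cdot>\<^sub>m 1\<^sub>m d) = gaussN d r"
  by (simp add: gauss_def gaussN_def gauss_density_isotropic)

text \<open>Follows from v <= 1 + v^2/2 <= exp(v^2/2) with v = u/r. It bounds |z| times the Gaussian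
  density uniformly, which dominates the integrands of the smoothed density and of its
  derivative.\<close>

lemma mult_exp_neg_sq_le:
  assumes "0 < (r::real)"
  shows "u * exp (- (u\<^sup>2 / (2 * r\<^sup>2))) \<le> r"
proof -
  have "u / r \<le> 1 + (u / r)\<^sup>2 / 2"
    using sum_squares_bound[of "u / r" 1] by simp
  also have "\<dots> \<le> exp ((u / r)\<^sup>2 / 2)"
    by (rule exp_ge_add_one_self)
  also have "(u / r)\<^sup>2 / 2 = u\<^sup>2 / (2 * r\<^sup>2)"
    by (simp add: power_divide)
  finally show ?thesis
    using assms by (simp add: exp_minus field_simps)
qed

lemma gd_le: "gd d r z \<le> gd d r (\<lambda>_. 0)"
  by (simp add: gd_def ip_def divide_right_mono sum_nonneg divide_nonneg_nonneg)

lemma ip_gd_le: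
  assumes r: "0 < r"
  shows "\<bar>ip d w z\<bar> * gd d r z \<le> vnorm d w * r * gd d r (\<lambda>_. 0)"
proof -
  have "\<bar>ip d w z\<bar> * gd d r z \<le> vnorm d w * (vnorm d z * gd d r z)"
    by (simp add: abs_ip_le mult_right_mono flip: mult.assoc)
  also have "vnorm d z * gd d r z \<le> r * gd d r (\<lambda>_. 0)"
    using mult_exp_neg_sq_le[OF r, of "vnorm d z"]
    by (simp add: gd_def ip_def[of d "\<lambda>_. 0"] vnorm_sq divide_right_mono)
  finally show ?thesis
    by (simp add: mult_left_mono mult.assoc)
qed

section \<open>The smoothed density, its law, and posterior means of the noise\<close>

locale smoothing =
  fixes d :: nat and f :: "(nat \<Rightarrow> real) measure" and r :: real
  assumes r_pos [simp]: "0 < r" and fin_cov: "finite_cov_distribution d f"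
begin

abbreviation "N \<equiv> gaussN d r"

sublocale f: prob_space f
  using fin_cov by (simp add: finite_cov_distribution_def)

sublocale N: prob_space N
  by (rule prob_space_gaussN) simp

lemma sets_f [measurable_cong, simp]: "sets f = sets (Rd d)"
  using fin_cov by (simp add: finite_cov_distribution_def)

lemma space_f [simp]: "space f = space (Rd d)"
  by (rule sets_eq_imp_space_eq) simp

sublocale lf: pair_sigma_finite "lborel_Rd d" f
  by (simp add: pair_sigma_finite_def sigma_finite_lborel_Rd f.sigma_finite_measure_axioms)

definition dens :: "(nat \<Rightarrow> real) \<Rightarrow> real" where
  "dens x = (\<integral>y. gd d r (vsub d x y) \<partial>f)"

text \<open>The conditional mean of \<open>h z\<close> given \<open>y + z = x\<close>, where \<open>y\<close> has law \<open>f\<close> and \<open>z\<close> is the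
  smoothing noise.\<close>

definition post :: "((nat \<Rightarrow> real) \<Rightarrow> real) \<Rightarrow> (nat \<Rightarrow> real) \<Rightarrow> real" where
  "post h x = (\<integral>y. h (vsub d x y) * gd d r (vsub d x y) \<partial>f) / dens x"

abbreviation "sm \<equiv> smoothed d f (r\<^sup>2 \<cdot>\<^sub>m 1\<^sub>m d)"

lemma smoothed_density_eq: "smoothed_density d f (r\<^sup>2 \<cdot>\<^sub>m 1\<^sub>m d) = dens"
  by (simp add: fun_eq_iff smoothed_density_def dens_def gauss_density_isotropic)

lemma sm_eq: "sm = density (lborel_Rd d) (\<lambda>x. ennreal (dens x))"
  by (simp add: smoothed_def smoothed_density_eq)

lemma sets_sm [measurable_cong, simp]: "sets sm = sets (Rd d)"
  by (simp add: sm_eq)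

lemma space_sm [simp]: "space sm = space (Rd d)"
  by (rule sets_eq_imp_space_eq) simp

lemma integrable_gd_vsub: "integrable f (\<lambda>y. gd d r (vsub d x y))"
proof (rule f.integrable_const_bound[where B="gd d r (\<lambda>_. 0)"])
  show "AE y in f. norm (gd d r (vsub d x y)) \<le> gd d r (\<lambda>_. 0)"
    using gd_le by simp
qed measurable

lemma integrable_ip_gd_vsub: "integrable f (\<lambda>y. ip d w (vsub d x y) * gd d r (vsub d x y))"
proof (rule f.integrable_const_bound[where B="vnorm d w * r * gd d r (\<lambda>_. 0)"])
  show "AE y in f. norm (ip d w (vsub d x y) * gd d r (vsub d x y)) \<le> vnorm d w * r * gd d r (\<lambda>_. 0)"
    using ip_gd_le[of r d w] by (simp add: abs_mult)
qed measurable

lemma dens_pos [simp]: "0 < dens x"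
  unfolding dens_def using f.not_empty
  by (intro f.integral_less_AE_space[of "\<lambda>_. 0", simplified] integrable_gd_vsub)
    (auto simp: gd_pos f.emeasure_space_1[simplified])

lemma dens_nonneg [simp]: "0 \<le> dens x" and dens_nonzero [simp]: "dens x \<noteq> 0"
  using dens_pos[of x] by linarith+

lemma dens_cong: "(\<And>i. i < d \<Longrightarrow> x i = y i) \<Longrightarrow> dens x = dens y"
  unfolding dens_def by (intro Bochner_Integration.integral_cong refl gd_cong) (auto simp: vsub_def)

lemma dens_measurable [measurable]: "dens \<in> borel_measurable (Rd d)"
  unfolding dens_def
  by (rule f.borel_measurable_lebesgue_integral) measurable

lemma post_measurable [measurable]:
  assumes [measurable]: "h \<in> borel_measurable (Rd d)"
  shows "post h \<in> borel_measurable (Rd d)"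
proof -
  have "(\<lambda>x. \<integral>y. h (vsub d x y) * gd d r (vsub d x y) \<partial>f) \<in> borel_measurable (Rd d)"
    by (rule f.borel_measurable_lebesgue_integral) measurable
  then show ?thesis
    unfolding post_def by measurable
qed

lemma ennreal_dens: "ennreal (dens x) = (\<integral>\<^sup>+y. ennreal (gd d r (vsub d x y)) \<partial>f)"
  unfolding dens_def by (rule nn_integral_eq_integral[symmetric]) (auto intro: integrable_gd_vsub)

lemma vsub_vadd [simp]: "x \<in> space (Rd d) \<Longrightarrow> vsub d (vadd d x y) y = x"
  by (auto simp: vsub_def vadd_def space_Rd extensional_def)

lemma vsub_vadd' [simp]: "x \<in> space (Rd d) \<Longrightarrow> vsub d (vadd d y x) y = x"
  by (auto simp: vsub_def vadd_def space_Rd extensional_def)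

lemma vadd_commute: "vadd d x y = vadd d y x"
  by (auto simp: vadd_def)

text \<open>Exchanging the integrals and substituting x = y + z turns the pair (x, x - y), weighted
  by the Gaussian density, into (y + z, z) with y from \<open>f\<close> and independent noise z. The
  passage between the smoothed law and the noise rests on this.\<close>

lemma tonelli:
  assumes [measurable]: "(\<lambda>(x, z). G x z) \<in> borel_measurable (Rd d \<Otimes>\<^sub>M Rd d)"
  shows "(\<integral>\<^sup>+x. \<integral>\<^sup>+y. G x (vsub d x y) * ennreal (gd d r (vsub d x y)) \<partial>f \<partial>lborel_Rd d)
    = (\<integral>\<^sup>+y. \<integral>\<^sup>+z. G (vadd d y z) z \<partial>N \<partial>f)"
proof -
  have "(\<integral>\<^sup>+x. \<integral>\<^sup>+y. G x (vsub d x y) * ennreal (gd d r (vsub d x y)) \<partial>f \<partial>lborel_Rd d)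
    = (\<integral>\<^sup>+y. \<integral>\<^sup>+x. G x (vsub d x y) * ennreal (gd d r (vsub d x y)) \<partial>lborel_Rd d \<partial>f)"
    by (rule lf.Fubini'[symmetric]) measurable
  also have "\<dots> = (\<integral>\<^sup>+y. \<integral>\<^sup>+z. G (vadd d y z) z \<partial>N \<partial>f)"
  proof (rule nn_integral_cong)
    fix y assume "y \<in> space f"
    then have [simp, measurable]: "y \<in> space (Rd d)" by simp
    have "(\<integral>\<^sup>+x. G x (vsub d x y) * ennreal (gd d r (vsub d x y)) \<partial>lborel_Rd d)
      = (\<integral>\<^sup>+x. G (vadd d x y) (vsub d (vadd d x y) y) * ennreal (gd d r (vsub d (vadd d x y) y)) \<partial>lborel_Rd d)"
      by (rule nn_integral_lborel_Rd_vadd[symmetric]) measurable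
    also have "\<dots> = (\<integral>\<^sup>+x. ennreal (gd d r x) * G (vadd d y x) x \<partial>lborel_Rd d)"
      by (intro nn_integral_cong) (simp add: mult.commute vadd_commute[of _ y])
    also have "\<dots> = (\<integral>\<^sup>+z. G (vadd d y z) z \<partial>N)"
      by (rule nn_integral_gaussN[symmetric]) measurable
    finally show "(\<integral>\<^sup>+x. G x (vsub d x y) * ennreal (gd d r (vsub d x y)) \<partial>lborel_Rd d)
      = (\<integral>\<^sup>+z. G (vadd d y z) z \<partial>N)" .
  qed
  finally show ?thesis .
qed

lemma nn_integral_sm:
  assumes [measurable]: "g \<in> borel_measurable (Rd d)"
  shows "(\<integral>\<^sup>+x. g x \<partial>sm) = (\<integral>\<^sup>+x. ennreal (dens x) * g x \<partial>lborel_Rd d)"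
  unfolding sm_eq by (rule nn_integral_density) measurable

lemma integral_sm:
  fixes g :: "(nat \<Rightarrow> real) \<Rightarrow> real"
  assumes [measurable]: "g \<in> borel_measurable (Rd d)"
  shows "(\<integral>x. g x \<partial>sm) = (\<integral>x. dens x * g x \<partial>lborel_Rd d)"
  unfolding sm_eq by (subst integral_density) auto

lemma sm_law:
  assumes [measurable]: "g \<in> borel_measurable (Rd d)"
  shows "(\<integral>\<^sup>+x. g x \<partial>sm) = (\<integral>\<^sup>+y. \<integral>\<^sup>+z. g (vadd d y z) \<partial>N \<partial>f)"
proof -
  have "(\<integral>\<^sup>+x. g x \<partial>sm) = (\<integral>\<^sup>+x. \<integral>\<^sup>+y. g x * ennreal (gd d r (vsub d x y)) \<partial>f \<partial>lborel_Rd d)"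
    by (simp add: nn_integral_sm ennreal_dens mult.commute[of _ "g _"] nn_integral_cmult)
  also have "\<dots> = (\<integral>\<^sup>+y. \<integral>\<^sup>+z. g (vadd d y z) \<partial>N \<partial>f)"
    by (rule tonelli) measurable
  finally show ?thesis .
qed

sublocale sm: prob_space sm
proof
  have "emeasure sm (space sm) = (\<integral>\<^sup>+x. 1 \<partial>sm)" by simp
  also have "\<dots> = 1"
    by (subst sm_law) (auto simp: N.emeasure_space_1[simplified] f.emeasure_space_1[simplified])
  finally show "emeasure sm (space sm) = 1" .
qed

text \<open>Cauchy--Schwarz for the posterior of the noise given the smoothed sample.\<close>

lemma nn_integral_post_sq:
  assumes [measurable]: "h \<in> borel_measurable (Rd d)"
  shows "(\<integral>\<^sup>+x. ennreal ((post h x)\<^sup>2) \<partial>sm) \<le> (\<integral>\<^sup>+z. ennreal ((h z)\<^sup>2) \<partial>N)"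
proof -
  have pt: "ennreal (dens x) * ennreal ((post h x)\<^sup>2)
      \<le> (\<integral>\<^sup>+y. ennreal ((h (vsub d x y))\<^sup>2) * ennreal (gd d r (vsub d x y)) \<partial>f)" (is "_ \<le> ?R") for x
  proof -
    define I where "I = (\<integral>y. h (vsub d x y) * gd d r (vsub d x y) \<partial>f)"
    \<comment> \<open>The Gaussian weight is split into two square roots, so that Cauchy-Schwarz
      leaves \<open>dens x\<close> as second factor; it cancels against the normalization of
      \<open>post\<close>.\<close>
    define u v where "u y = ennreal (\<bar>h (vsub d x y)\<bar> * sqrt (gd d r (vsub d x y)))"
      and "v y = ennreal (sqrt (gd d r (vsub d x y)))" for y
    have [measurable]: "u \<in> borel_measurable f" "v \<in> borel_measurable f"
      unfolding u_def v_def by measurable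
    \<comment> \<open>A non-integrable integrand has Bochner integral 0, so the bound holds in that
      case too.\<close>
    have "ennreal \<bar>I\<bar> \<le> (\<integral>\<^sup>+y. ennreal \<bar>h (vsub d x y) * gd d r (vsub d x y)\<bar> \<partial>f)"
      unfolding I_def using integral_norm_bound_ennreal[of f "\<lambda>y. h (vsub d x y) * gd d r (vsub d x y)"]
        not_integrable_integral_eq[of f "\<lambda>y. h (vsub d x y) * gd d r (vsub d x y)"]
      by (cases "integrable f (\<lambda>y. h (vsub d x y) * gd d r (vsub d x y))") auto
    also have "\<dots> = (\<integral>\<^sup>+y. u y * v y \<partial>f)"
      by (intro nn_integral_cong) (simp add: u_def v_def abs_mult mult.assoc flip: ennreal_mult)
    finally have "(ennreal \<bar>I\<bar>)\<^sup>2 \<le> (\<integral>\<^sup>+y. u y * v y \<partial>f)\<^sup>2"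
      by (rule power_mono) simp
    also have "\<dots> \<le> (\<integral>\<^sup>+y. (u y)\<^sup>2 \<partial>f) * (\<integral>\<^sup>+y. (v y)\<^sup>2 \<partial>f)"
      by (rule Cauchy_Schwarz_nn_integral) measurable
    also have "(\<integral>\<^sup>+y. (v y)\<^sup>2 \<partial>f) = ennreal (dens x)"
      by (simp add: v_def ennreal_dens ennreal_power)
    also have "(\<integral>\<^sup>+y. (u y)\<^sup>2 \<partial>f) = ?R"
      by (intro nn_integral_cong) (simp add: u_def ennreal_power power_mult_distrib ennreal_mult)
    finally have *: "ennreal (I\<^sup>2) \<le> ?R * ennreal (dens x)"
      by (simp add: ennreal_power)
    have "ennreal (dens x) * ennreal ((post h x)\<^sup>2) = ennreal (I\<^sup>2) * ennreal (1 / dens x)"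
      by (simp add: post_def I_def power2_eq_square flip: ennreal_mult)
    also have "\<dots> \<le> ?R * ennreal (dens x) * ennreal (1 / dens x)"
      by (rule mult_right_mono[OF *]) simp
    also have "\<dots> = ?R"
      by (simp add: mult.assoc flip: ennreal_mult)
    finally show ?thesis .
  qed
  have "(\<integral>\<^sup>+x. ennreal ((post h x)\<^sup>2) \<partial>sm) = (\<integral>\<^sup>+x. ennreal (dens x) * ennreal ((post h x)\<^sup>2) \<partial>lborel_Rd d)"
    by (rule nn_integral_sm) measurable
  also have "\<dots> \<le> (\<integral>\<^sup>+x. \<integral>\<^sup>+y. ennreal ((h (vsub d x y))\<^sup>2) * ennreal (gd d r (vsub d x y)) \<partial>f \<partial>lborel_Rd d)"
    by (intro nn_integral_mono pt)
  also have "\<dots> = (\<integral>\<^sup>+y. \<integral>\<^sup>+z. ennreal ((h z)\<^sup>2) \<partial>N \<partial>f)"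
    by (rule tonelli) measurable
  also have "\<dots> = (\<integral>\<^sup>+z. ennreal ((h z)\<^sup>2) \<partial>N)"
    by (simp add: f.emeasure_space_1[simplified])
  finally show ?thesis .
qed

lemma integrable_post_sq:
  assumes [measurable]: "h \<in> borel_measurable (Rd d)" and h: "integrable N (\<lambda>z. (h z)\<^sup>2)"
  shows "integrable sm (\<lambda>x. (post h x)\<^sup>2)"
    and "(\<integral>x. (post h x)\<^sup>2 \<partial>sm) \<le> (\<integral>z. (h z)\<^sup>2 \<partial>N)"
proof -
  have eq: "(\<integral>\<^sup>+z. ennreal ((h z)\<^sup>2) \<partial>N) = ennreal (\<integral>z. (h z)\<^sup>2 \<partial>N)"
    by (rule nn_integral_eq_integral[OF h]) simp
  have le: "(\<integral>\<^sup>+x. ennreal ((post h x)\<^sup>2) \<partial>sm) \<le> ennreal (\<integral>z. (h z)\<^sup>2 \<partial>N)"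
    using nn_integral_post_sq[of h] eq by simp
  show int: "integrable sm (\<lambda>x. (post h x)\<^sup>2)"
    using le by (intro integrableI_bounded) (auto simp: order_le_less_trans)
  have "ennreal (\<integral>x. (post h x)\<^sup>2 \<partial>sm) \<le> ennreal (\<integral>z. (h z)\<^sup>2 \<partial>N)"
    using le nn_integral_eq_integral[OF int] by simp
  then show "(\<integral>x. (post h x)\<^sup>2 \<partial>sm) \<le> (\<integral>z. (h z)\<^sup>2 \<partial>N)"
    by (subst (asm) ennreal_le_iff) (auto intro: integral_nonneg_AE)
qed

text \<open>\<open>post\<close> is the L2 adjoint of composing a function of the sample with
  addition of the noise. Applied to the score it plays the part of integration by parts:
  expectations against the score become Gaussian integrals.\<close>

lemma post_adjoint:
  assumes [measurable]: "g \<in> borel_measurable (Rd d)" "h \<in> borel_measurable (Rd d)"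
    and g: "integrable sm (\<lambda>x. (g x)\<^sup>2)" and h: "integrable N (\<lambda>z. (h z)\<^sup>2)"
  shows "(\<integral>x. g x * post h x \<partial>sm) = (\<integral>y. \<integral>z. g (vadd d y z) * h z \<partial>N \<partial>f)"
proof -
  define F where "F x y = g x * (h (vsub d x y) * gd d r (vsub d x y))" for x y
  have [measurable]: "(\<lambda>(x, y). F x y) \<in> borel_measurable (lborel_Rd d \<Otimes>\<^sub>M f)"
    unfolding F_def by measurable
  have "(\<integral>\<^sup>+x. \<integral>\<^sup>+y. ennreal (norm (F x y)) \<partial>f \<partial>lborel_Rd d)
      = (\<integral>\<^sup>+x. \<integral>\<^sup>+y. ennreal (\<bar>g x\<bar> * \<bar>h (vsub d x y)\<bar>) * ennreal (gd d r (vsub d x y)) \<partial>f \<partial>lborel_Rd d)"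
    by (intro nn_integral_cong) (simp add: F_def abs_mult mult.assoc flip: ennreal_mult)
  also have "\<dots> = (\<integral>\<^sup>+y. \<integral>\<^sup>+z. ennreal (\<bar>g (vadd d y z)\<bar> * \<bar>h z\<bar>) \<partial>N \<partial>f)"
    by (rule tonelli) measurable
  also have "\<dots> \<le> (\<integral>\<^sup>+y. \<integral>\<^sup>+z. ennreal ((g (vadd d y z))\<^sup>2) + ennreal ((h z)\<^sup>2) \<partial>N \<partial>f)"
  proof (intro nn_integral_mono)
    fix y z
    have "2 * (\<bar>g (vadd d y z)\<bar> * \<bar>h z\<bar>) \<le> (g (vadd d y z))\<^sup>2 + (h z)\<^sup>2"
      using sum_squares_bound[of "\<bar>g (vadd d y z)\<bar>" "\<bar>h z\<bar>"] by (simp add: mult.assoc)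
    moreover have "0 \<le> \<bar>g (vadd d y z)\<bar> * \<bar>h z\<bar>" by simp
    ultimately have "\<bar>g (vadd d y z)\<bar> * \<bar>h z\<bar> \<le> (g (vadd d y z))\<^sup>2 + (h z)\<^sup>2" by linarith
    then show "ennreal (\<bar>g (vadd d y z)\<bar> * \<bar>h z\<bar>) \<le> ennreal ((g (vadd d y z))\<^sup>2) + ennreal ((h z)\<^sup>2)"
      by (simp flip: ennreal_plus)
  qed
  also have "\<dots> = (\<integral>\<^sup>+x. ennreal ((g x)\<^sup>2) \<partial>sm) + (\<integral>\<^sup>+z. ennreal ((h z)\<^sup>2) \<partial>N)"
    by (simp add: nn_integral_add sm_law f.emeasure_space_1[simplified])
  also have "\<dots> < \<infinity>"
    using g h by (simp add: integrable_iff_bounded)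
  finally have fin: "(\<integral>\<^sup>+x. \<integral>\<^sup>+y. ennreal (norm (F x y)) \<partial>f \<partial>lborel_Rd d) < \<infinity>" .
  have int: "integrable (lborel_Rd d \<Otimes>\<^sub>M f) (\<lambda>(x, y). F x y)"
  proof (rule integrableI_bounded)
    have "(\<integral>\<^sup>+p. ennreal (norm (case p of (x, y) \<Rightarrow> F x y)) \<partial>(lborel_Rd d \<Otimes>\<^sub>M f))
        = (\<integral>\<^sup>+x. \<integral>\<^sup>+y. ennreal (norm (F x y)) \<partial>f \<partial>lborel_Rd d)"
      by (subst f.nn_integral_fst[symmetric]) (auto simp: split_beta')
    with fin show "(\<integral>\<^sup>+p. ennreal (norm (case p of (x, y) \<Rightarrow> F x y)) \<partial>(lborel_Rd d \<Otimes>\<^sub>M f)) < \<infinity>"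
      by simp
  qed measurable
  have "(\<integral>x. g x * post h x \<partial>sm) = (\<integral>x. \<integral>y. F x y \<partial>f \<partial>lborel_Rd d)"
    by (subst integral_sm) (auto intro!: Bochner_Integration.integral_cong simp: F_def[abs_def] post_def)
  also have "\<dots> = (\<integral>y. \<integral>x. F x y \<partial>lborel_Rd d \<partial>f)"
    by (rule lf.Fubini_integral[OF int, symmetric])
  also have "\<dots> = (\<integral>y. \<integral>z. g (vadd d y z) * h z \<partial>N \<partial>f)"
  proof (rule Bochner_Integration.integral_cong[OF refl])
    fix y assume "y \<in> space f"
    then have [simp, measurable]: "y \<in> space (Rd d)" by simp
    have "(\<integral>x. F x y \<partial>lborel_Rd d) = (\<integral>x. F x y \<partial>distr (lborel_Rd d) (lborel_Rd d) (\<lambda>x. vadd d x y))"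
      by (simp add: lborel_Rd_vadd)
    also have "\<dots> = (\<integral>x. F (vadd d x y) y \<partial>lborel_Rd d)"
      unfolding F_def by (rule integral_distr) measurable
    also have "\<dots> = (\<integral>x. gd d r x * (g (vadd d y x) * h x) \<partial>lborel_Rd d)"
      by (intro Bochner_Integration.integral_cong refl) (simp add: F_def vadd_commute[of _ y])
    also have "\<dots> = (\<integral>z. g (vadd d y z) * h z \<partial>N)"
      by (rule integral_gaussN[symmetric]) measurable
    finally show "(\<integral>x. F x y \<partial>lborel_Rd d) = (\<integral>z. g (vadd d y z) * h z \<partial>N)" .
  qed
  finally show ?thesis .
qed

section \<open>The density ratio and the score as posterior means\<close>

lemma post_exp:
  "post (\<lambda>z. exp (- (ip d c z / r\<^sup>2) - ip d c c / (2 * r\<^sup>2))) x = dens (vadd d x c) / dens x"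
  by (simp add: post_def dens_def gd_vsub_vadd)

text \<open>Differentiation under the integral sign: difference quotients along a coordinate are
  bounded by a Lipschitz constant that is uniform in y, so dominated convergence applies along every
  sequence.\<close>

lemma dens_has_derivative:
  assumes i: "i < d"
  shows "((\<lambda>t. dens (x(i := t))) has_real_derivative
    - (\<integral>y. vsub d x y i * gd d r (vsub d x y) \<partial>f) / r\<^sup>2) (at (x i))"
proof -
  define e :: "nat \<Rightarrow> real" where "e = (\<lambda>j. if j = i then 1 else 0)"
  define G where "G y t = gd d r (vsub d (x(i := t)) y)" for y t
  \<comment> \<open>Bound for |z_i| times the density over r^2, namely r times the density at 0 over
    r^2.\<close>
  define B where "B = gd d r (\<lambda>_. 0) / r"
  have ipe: "ip d e z = z i" for z
    using i by (simp add: ip_def e_def if_distrib[of "\<lambda>x. x * _"] cong: if_cong)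
  have ipe': "ip d z e = z i" for z
    by (simp add: ip_commute ipe)
  have ne: "vnorm d e = 1"
    by (simp add: vnorm_eq_sqrt ipe) (simp add: e_def)
  have G_shift: "G y t = gd d r (vsub d (x(i := s)) y)
      * exp (- ((t - s) * vsub d (x(i := s)) y i / r\<^sup>2) - (t - s)\<^sup>2 / (2 * r\<^sup>2))" for y s t
  proof -
    have "G y t = gd d r (\<lambda>j. vsub d (x(i := s)) y j + (t - s) * e j)"
      unfolding G_def by (rule gd_cong) (simp add: vsub_def e_def)
    then show ?thesis
      by (simp add: gd_shift ip_linear ipe ipe' power2_eq_square) (simp add: e_def)
  qed
  have G_deriv: "(G y has_real_derivative - (vsub d (x(i := s)) y i / r\<^sup>2) * G y s) (at s)" for y s
  proof -
    have "((\<lambda>t. gd d r (vsub d (x(i := s)) y)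
      * exp (- ((t - s) * vsub d (x(i := s)) y i / r\<^sup>2) - (t - s)\<^sup>2 / (2 * r\<^sup>2)))
      has_real_derivative - (vsub d (x(i := s)) y i / r\<^sup>2) * G y s) (at s)"
      by (use r_pos in \<open>auto intro!: derivative_eq_intros simp: G_def field_simps power2_eq_square simp del: r_pos\<close>)
    then show ?thesis
      by (rule back_subst[where P="\<lambda>F. (F has_real_derivative _) (at s)"])
        (rule ext, rule G_shift[symmetric])
  qed
  have G_bound: "\<bar>- (vsub d (x(i := s)) y i / r\<^sup>2) * G y s\<bar> \<le> B" for y s
  proof -
    have "\<bar>vsub d (x(i := s)) y i\<bar> * G y s / r\<^sup>2 \<le> r * gd d r (\<lambda>_. 0) / r\<^sup>2"
      using ip_gd_le[OF r_pos, of d e "vsub d (x(i := s)) y"]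
      by (intro divide_right_mono) (auto simp: G_def ipe ne)
    then show ?thesis
      by (simp add: G_def B_def abs_mult power2_eq_square less_imp_neq[OF r_pos, symmetric])
  qed
  have lip: "\<bar>G y t - G y s\<bar> \<le> B * \<bar>t - s\<bar>" for y s t
    using field_differentiable_bound[of UNIV "G y" "\<lambda>s. - (vsub d (x(i := s)) y i / r\<^sup>2) * G y s" B t s]
      G_deriv G_bound by auto
  have [measurable]: "(\<lambda>y. G y t) \<in> borel_measurable f" for t
    unfolding G_def by measurable
  have intG: "integrable f (\<lambda>y. G y t)" for t
    unfolding G_def by (rule integrable_gd_vsub)
  have "((\<lambda>t. (dens (x(i := t)) - dens (x(i := x i))) / (t - x i)) \<longlongrightarrow>
      (\<integral>y. - (vsub d x y i / r\<^sup>2) * G y (x i) \<partial>f)) (at (x i))"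
    unfolding tendsto_at_iff_sequentially
  proof (intro allI impI)
    fix X :: "nat \<Rightarrow> real"
    assume X: "\<forall>n. X n \<in> UNIV - {x i}" and lim: "X \<longlonglongrightarrow> x i"
    have "(\<lambda>n. \<integral>y. (G y (X n) - G y (x i)) / (X n - x i) \<partial>f) \<longlonglongrightarrow>
      (\<integral>y. - (vsub d x y i / r\<^sup>2) * G y (x i) \<partial>f)"
    proof (rule integral_dominated_convergence[where w="\<lambda>_. B"])
      show "AE y in f. (\<lambda>n. (G y (X n) - G y (x i)) / (X n - x i)) \<longlonglongrightarrow> - (vsub d x y i / r\<^sup>2) * G y (x i)"
      proof (rule AE_I2)
        fix y
        have "((\<lambda>t. (G y t - G y (x i)) / (t - x i)) \<longlongrightarrow> - (vsub d x y i / r\<^sup>2) * G y (x i)) (at (x i))"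
          using G_deriv[of y "x i"] by (simp add: has_field_derivative_iff)
        then show "(\<lambda>n. (G y (X n) - G y (x i)) / (X n - x i)) \<longlonglongrightarrow> - (vsub d x y i / r\<^sup>2) * G y (x i)"
          using X lim unfolding tendsto_at_iff_sequentially by (auto simp: comp_def)
      qed
      show "AE y in f. norm ((G y (X n) - G y (x i)) / (X n - x i)) \<le> B" for n
        using lip[of _ "X n" "x i"] X by (auto simp: abs_divide pos_divide_le_eq)
      have [measurable]: "(\<lambda>y. vsub d x y i) \<in> borel_measurable f"
        using i by measurable
      show "(\<lambda>y. - (vsub d x y i / r\<^sup>2) * G y (x i)) \<in> borel_measurable f" by measurable
    qed simp_all
    also have "(\<lambda>n. \<integral>y. (G y (X n) - G y (x i)) / (X n - x i) \<partial>f)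
      = (\<lambda>n. (dens (x(i := X n)) - dens (x(i := x i))) / (X n - x i))"
      using intG integrable_gd_vsub[of x] by (simp add: dens_def G_def)
    finally show "((\<lambda>t. (dens (x(i := t)) - dens (x(i := x i))) / (t - x i)) \<circ> X) \<longlonglongrightarrow>
        (\<integral>y. - (vsub d x y i / r\<^sup>2) * G y (x i) \<partial>f)"
      by (simp add: comp_def)
  qed
  also have "(\<integral>y. - (vsub d x y i / r\<^sup>2) * G y (x i) \<partial>f)
      = - (\<integral>y. vsub d x y i * gd d r (vsub d x y) \<partial>f) / r\<^sup>2"
    by (simp add: G_def)
  finally show ?thesis
    unfolding has_field_derivative_iff .
qed

abbreviation "sc \<equiv> score d f (r\<^sup>2 \<cdot>\<^sub>m 1\<^sub>m d)"

lemma score_eq: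
  assumes i: "i < d"
  shows "sc x i = - (\<integral>y. vsub d x y i * gd d r (vsub d x y) \<partial>f) / (r\<^sup>2 * dens x)"
proof -
  have "((\<lambda>t. ln (dens (x(i := t)))) has_real_derivative
    - (\<integral>y. vsub d x y i * gd d r (vsub d x y) \<partial>f) / (r\<^sup>2 * dens x)) (at (x i))"
    by (rule derivative_eq_intros dens_has_derivative[OF i] | simp add: field_simps)+
  then show ?thesis
    using i by (simp add: score_def smoothed_density_eq DERIV_imp_deriv)
qed

text \<open>Tweedie's formula: the score is minus the posterior mean of the noise over r^2. Later
  arguments use the score in this form rather than as a derivative.\<close>

lemma ip_score: "ip d w (sc x) = post (\<lambda>z. - (ip d w z / r\<^sup>2)) x"
proof -
  have int: "integrable f (\<lambda>y. vsub d x y i * gd d r (vsub d x y))" if "i < d" for i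
  proof -
    have "ip d (\<lambda>j. if j = i then 1 else 0) z = z i" for z
      using that by (simp add: ip_def if_distrib[of "\<lambda>x. x * _"] cong: if_cong)
    with integrable_ip_gd_vsub[of "\<lambda>j. if j = i then 1 else 0" x] show ?thesis by simp
  qed
  have "(\<integral>y. ip d w (vsub d x y) * gd d r (vsub d x y) \<partial>f)
      = (\<integral>y. (\<Sum>i<d. w i * (vsub d x y i * gd d r (vsub d x y))) \<partial>f)"
    by (simp add: ip_def sum_distrib_right mult.assoc)
  also have "\<dots> = (\<Sum>i<d. w i * (\<integral>y. vsub d x y i * gd d r (vsub d x y) \<partial>f))"
    using int by (subst Bochner_Integration.integral_sum) auto
  finally have "post (\<lambda>z. - (ip d w z / r\<^sup>2)) x
      = (\<Sum>i<d. w i * (- (\<integral>y. vsub d x y i * gd d r (vsub d x y) \<partial>f) / (r\<^sup>2 * dens x)))"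
    by (simp add: post_def sum_divide_distrib sum_negf)
  also have "\<dots> = ip d w (sc x)"
    by (simp add: ip_def score_eq)
  finally show ?thesis by simp
qed

lemma score_measurable [measurable]: "sc \<in> Rd d \<rightarrow>\<^sub>M Rd d"
proof (rule measurable_RdI)
  fix i assume i: "i < d"
  have "sc x i = ip d (\<lambda>j. if j = i then 1 else 0) (sc x)" for x
    using i by (simp add: ip_def if_distrib[of "\<lambda>x. x * _"] cong: if_cong)
  then show "(\<lambda>x. sc x i) \<in> borel_measurable (Rd d)"
    unfolding ip_score by simp
qed (simp add: score_def)

end

section \<open>Elementary inequalities and exponential Gaussian moments\<close>

lemma Cauchy_Schwarz_integral:
  fixes g h :: "'a \<Rightarrow> real"
  assumes [measurable]: "g \<in> borel_measurable M" "h \<in> borel_measurable M"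
    and g: "integrable M (\<lambda>x. (g x)\<^sup>2)" and h: "integrable M (\<lambda>x. (h x)\<^sup>2)"
  shows "integrable M (\<lambda>x. g x * h x)"
    and "\<bar>\<integral>x. g x * h x \<partial>M\<bar> \<le> sqrt (\<integral>x. (g x)\<^sup>2 \<partial>M) * sqrt (\<integral>x. (h x)\<^sup>2 \<partial>M)"
proof -
  show int: "integrable M (\<lambda>x. g x * h x)"
  proof (rule Bochner_Integration.integrable_bound[of M "\<lambda>x. (g x)\<^sup>2 + (h x)\<^sup>2"])
    show "AE x in M. norm (g x * h x) \<le> norm ((g x)\<^sup>2 + (h x)\<^sup>2)"
    proof (rule AE_I2)
      fix x
      have "2 * (\<bar>g x\<bar> * \<bar>h x\<bar>) \<le> (g x)\<^sup>2 + (h x)\<^sup>2"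
        using sum_squares_bound[of "\<bar>g x\<bar>" "\<bar>h x\<bar>"] by (simp add: mult.assoc)
      moreover have "0 \<le> \<bar>g x\<bar> * \<bar>h x\<bar>" by simp
      ultimately have "\<bar>g x\<bar> * \<bar>h x\<bar> \<le> (g x)\<^sup>2 + (h x)\<^sup>2" by linarith
      then show "norm (g x * h x) \<le> norm ((g x)\<^sup>2 + (h x)\<^sup>2)"
        by (simp add: abs_mult)
    qed
  qed (use g h in auto)
  have G: "0 \<le> (\<integral>x. (g x)\<^sup>2 \<partial>M)" and H: "0 \<le> (\<integral>x. (h x)\<^sup>2 \<partial>M)"
    by (auto intro: integral_nonneg_AE)
  have "ennreal \<bar>\<integral>x. g x * h x \<partial>M\<bar> \<le> (\<integral>\<^sup>+x. ennreal \<bar>g x\<bar> * ennreal \<bar>h x\<bar> \<partial>M)"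
    using integral_norm_bound_ennreal[OF int] by (simp add: abs_mult ennreal_mult)
  then have "(ennreal \<bar>\<integral>x. g x * h x \<partial>M\<bar>)\<^sup>2 \<le> (\<integral>\<^sup>+x. ennreal \<bar>g x\<bar> * ennreal \<bar>h x\<bar> \<partial>M)\<^sup>2"
    by (rule power_mono) simp
  also have "\<dots> \<le> (\<integral>\<^sup>+x. (ennreal \<bar>g x\<bar>)\<^sup>2 \<partial>M) * (\<integral>\<^sup>+x. (ennreal \<bar>h x\<bar>)\<^sup>2 \<partial>M)"
    by (rule Cauchy_Schwarz_nn_integral) measurable
  also have "\<dots> = ennreal ((\<integral>x. (g x)\<^sup>2 \<partial>M) * (\<integral>x. (h x)\<^sup>2 \<partial>M))"
    using nn_integral_eq_integral[OF g] nn_integral_eq_integral[OF h] G H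
    by (simp add: ennreal_power ennreal_mult)
  finally have "(\<integral>x. g x * h x \<partial>M)\<^sup>2 \<le> (\<integral>x. (g x)\<^sup>2 \<partial>M) * (\<integral>x. (h x)\<^sup>2 \<partial>M)"
    using G H by (simp add: ennreal_power)
  then show "\<bar>\<integral>x. g x * h x \<partial>M\<bar> \<le> sqrt (\<integral>x. (g x)\<^sup>2 \<partial>M) * sqrt (\<integral>x. (h x)\<^sup>2 \<partial>M)"
    by (metis real_sqrt_abs real_sqrt_le_mono real_sqrt_mult)
qed

text \<open>Lagrange remainder with an intermediate point bounded by |x|. Keeping the factor x^2 in
  the remainder is what makes the error of the moment generating function proportional to the
  variance.\<close>

lemma exp_le_second_order: "exp (x::real) \<le> 1 + x + x\<^sup>2 * exp \<bar>x\<bar> / 2"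
proof -
  obtain t where t: "\<bar>t\<bar> \<le> \<bar>x\<bar>" "exp x = (\<Sum>m<2. x ^ m / fact m) + exp t / fact 2 * x ^ 2"
    using Maclaurin_exp_le[of x 2] by blast
  have "exp t * x\<^sup>2 \<le> exp \<bar>x\<bar> * x\<^sup>2"
    using t(1) by (intro mult_right_mono) auto
  with t(2) show ?thesis
    by (simp add: numeral_2_eq_2 mult.commute)
qed

lemma exp_abs_minus_one_le: "exp \<bar>x\<bar> - 1 \<le> \<bar>x\<bar> * exp \<bar>x::real\<bar>"
proof -
  have "1 - \<bar>x\<bar> \<le> exp (- \<bar>x\<bar>)"
    using exp_ge_add_one_self[of "- \<bar>x\<bar>"] by simp
  then have "(1 - \<bar>x\<bar>) * exp \<bar>x\<bar> \<le> exp (- \<bar>x\<bar>) * exp \<bar>x\<bar>"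
    by (rule mult_right_mono) simp
  also have "\<dots> = 1" by (simp flip: exp_add)
  finally show ?thesis by (simp add: algebra_simps)
qed

text \<open>\<open>E\<close> is the density of N(-c, r^2 I) relative to N(0, r^2 I). Its second
  moment is one plus the chi-square divergence, and the last identity is the mean of -c.z/r^2 under
  the shifted law.\<close>

lemma gaussN_exp_moments:
  fixes d :: nat and c :: "nat \<Rightarrow> real"
  assumes r: "0 < r"
  defines "E \<equiv> \<lambda>z. exp (- (ip d c z / r\<^sup>2) - ip d c c / (2 * r\<^sup>2))"
  shows "integrable (gaussN d r) E" and "(\<integral>z. E z \<partial>gaussN d r) = 1"
    and "integrable (gaussN d r) (\<lambda>z. (E z)\<^sup>2)"
    and "(\<integral>z. (E z)\<^sup>2 \<partial>gaussN d r) = exp (ip d c c / r\<^sup>2)"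
    and "(\<integral>z. E z * - (ip d c z / r\<^sup>2) \<partial>gaussN d r) = ip d c c / r\<^sup>2"
proof -
  interpret prob_space "gaussN d r" by (rule prob_space_gaussN[OF r])
  have [measurable]: "E \<in> borel_measurable (Rd d)"
    unfolding E_def by measurable
  have E0: "0 \<le> E z" for z by (simp add: E_def)
  have nnE: "(\<integral>\<^sup>+z. ennreal (E z) \<partial>gaussN d r) = 1"
    unfolding E_def by (rule gaussN_mgf[OF r])
  show "integrable (gaussN d r) E"
    by (rule integrableI_nonneg) (auto simp: nnE E0)
  then have "ennreal (\<integral>z. E z \<partial>gaussN d r) = 1"
    using nnE by (subst nn_integral_eq_integral[symmetric]) (auto simp: E0)
  then show "(\<integral>z. E z \<partial>gaussN d r) = 1"
    by (metis ennreal_1 ennreal_eq_1)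
  \<comment> \<open>The squared likelihood ratio for c is a constant times the likelihood ratio for
    2c, which has mean one.\<close>
  have sq: "(E z)\<^sup>2 = exp (ip d c c / r\<^sup>2) *
      exp (- (ip d (\<lambda>i. 2 * c i) z / r\<^sup>2) - ip d (\<lambda>i. 2 * c i) (\<lambda>i. 2 * c i) / (2 * r\<^sup>2))" for z
    unfolding ip_scale_left ip_scale_right
    by (simp add: E_def field_simps flip: exp_add exp_double)
  have nnE2: "(\<integral>\<^sup>+z. ennreal ((E z)\<^sup>2) \<partial>gaussN d r) = ennreal (exp (ip d c c / r\<^sup>2))"
    unfolding sq using gaussN_mgf[OF r, of d "\<lambda>i. 2 * c i"]
    by (simp add: ennreal_mult nn_integral_cmult)
  show int2: "integrable (gaussN d r) (\<lambda>z. (E z)\<^sup>2)"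
    by (rule integrableI_nonneg) (auto simp: nnE2)
  have "ennreal (\<integral>z. (E z)\<^sup>2 \<partial>gaussN d r) = ennreal (exp (ip d c c / r\<^sup>2))"
    using nnE2 nn_integral_eq_integral[OF int2] by simp
  then show "(\<integral>z. (E z)\<^sup>2 \<partial>gaussN d r) = exp (ip d c c / r\<^sup>2)"
    by (subst (asm) ennreal_inj) (auto intro: integral_nonneg_AE)
  have gdE: "gd d r (vadd d z c) = gd d r z * E z" for z
    using gd_cong[of d "vadd d z c" "\<lambda>i. z i + c i" r] by (simp add: vadd_def gd_shift E_def)
  have "(\<integral>z. E z * - (ip d c z / r\<^sup>2) \<partial>gaussN d r)
      = (\<integral>z. gd d r (vadd d z c) * - ((ip d c (vadd d z c) - ip d c c) / r\<^sup>2) \<partial>lborel_Rd d)"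
  proof (subst integral_gaussN)
    have "ip d c (vadd d z c) - ip d c c = ip d c z" for z
      by (simp add: vadd_def ip_def algebra_simps flip: sum_subtractf)
    then show "(\<integral>z. gd d r z * (E z * - (ip d c z / r\<^sup>2)) \<partial>lborel_Rd d)
      = (\<integral>z. gd d r (vadd d z c) * - ((ip d c (vadd d z c) - ip d c c) / r\<^sup>2) \<partial>lborel_Rd d)"
      by (simp add: gdE mult.assoc)
  qed measurable
  also have "\<dots> = (\<integral>z. gd d r z * - ((ip d c z - ip d c c) / r\<^sup>2) \<partial>distr (lborel_Rd d) (lborel_Rd d) (\<lambda>x. vadd d x c))"
    by (rule integral_distr[symmetric]) measurable
  also have "\<dots> = (\<integral>z. - ((ip d c z - ip d c c) / r\<^sup>2) \<partial>gaussN d r)"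
    by (simp only: lborel_Rd_vadd) (rule integral_gaussN[symmetric], measurable)
  also have "\<dots> = ip d c c / r\<^sup>2"
    by (simp add: gaussN_linear_moment[OF r] prob_space[simplified] diff_divide_distrib)
  finally show "(\<integral>z. E z * - (ip d c z / r\<^sup>2) \<partial>gaussN d r) = ip d c c / r\<^sup>2" .
qed

section \<open>The information form, the covariance inequality, and tails of the score\<close>

context smoothing
begin

lemma r_nonzero [simp]: "r \<noteq> 0"
  by (rule less_imp_neq[OF r_pos, symmetric])

text \<open>The quadratic form of the Fisher matrix, taken directly as a second moment so that it is
  available before any matrix is formed; \<open>info_form\<close> makes the link.\<close>

definition info :: "(nat \<Rightarrow> real) \<Rightarrow> real" where
  "info w = (\<integral>x. (ip d w (sc x))\<^sup>2 \<partial>sm)"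

definition ratio :: "(nat \<Rightarrow> real) \<Rightarrow> (nat \<Rightarrow> real) \<Rightarrow> real" where
  "ratio c x = dens (vadd d x c) / dens x"

text \<open>The mean of w.s(x - c) for x from the smoothed law, that is, of a summand of the local
  step whose centre is off by c. The displacement has been moved into the weight
  \<open>ratio\<close>.\<close>

definition drift :: "(nat \<Rightarrow> real) \<Rightarrow> (nat \<Rightarrow> real) \<Rightarrow> real" where
  "drift c w = (\<integral>x. ip d w (sc x) * ratio c x \<partial>sm)"

lemma ratio_measurable [measurable]: "ratio c \<in> borel_measurable (Rd d)"
  unfolding ratio_def by measurable

lemma ratio_nonneg [simp]: "0 \<le> ratio c x"
  by (simp add: ratio_def)

lemma info_nonneg [simp]: "0 \<le> info w"
  unfolding info_def by (rule integral_nonneg_AE) simp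

lemma ratio_eq_post:
  "ratio c x = post (\<lambda>z. exp (- (ip d c z / r\<^sup>2) - ip d c c / (2 * r\<^sup>2))) x"
  by (simp add: ratio_def post_exp)

lemma integrable_score_sq: "integrable sm (\<lambda>x. (ip d w (sc x))\<^sup>2)"
  and info_le: "info w \<le> ip d w w / r\<^sup>2"
proof -
  have int: "integrable N (\<lambda>z. (- (ip d w z / r\<^sup>2))\<^sup>2)"
    using gaussN_bilinear_moment(1)[OF r_pos, of d w w]
    by (simp add: power_divide power2_eq_square)
  show "integrable sm (\<lambda>x. (ip d w (sc x))\<^sup>2)"
    unfolding ip_score by (rule integrable_post_sq(1)[OF _ int]) measurable
  have "info w \<le> (\<integral>z. (- (ip d w z / r\<^sup>2))\<^sup>2 \<partial>N)"
    unfolding info_def ip_score by (rule integrable_post_sq(2)[OF _ int]) measurable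
  also have "\<dots> = (\<integral>z. ip d w z * ip d w z \<partial>N) / (r\<^sup>2 * r\<^sup>2)"
    by (simp add: power_divide power2_eq_square)
  also have "\<dots> = ip d w w / r\<^sup>2"
    by (simp add: gaussN_bilinear_moment power2_eq_square)
  finally show "info w \<le> ip d w w / r\<^sup>2" .
qed

lemma integrable_score_prod: "integrable sm (\<lambda>x. ip d v (sc x) * ip d w (sc x))"
  by (rule Cauchy_Schwarz_integral(1)) (auto intro: integrable_score_sq)

lemma integrable_score: "integrable sm (\<lambda>x. ip d w (sc x))"
  by (rule sm.square_integrable_imp_integrable[OF _ integrable_score_sq]) measurable

lemma score_mean: "(\<integral>x. ip d w (sc x) \<partial>sm) = 0"
proof -
  have int: "integrable N (\<lambda>z. (- (ip d w z / r\<^sup>2))\<^sup>2)"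
    using gaussN_bilinear_moment(1)[OF r_pos, of d w w]
    by (simp add: power_divide power2_eq_square)
  have "(\<integral>x. 1 * ip d w (sc x) \<partial>sm) = (\<integral>y. \<integral>z. 1 * - (ip d w z / r\<^sup>2) \<partial>N \<partial>f)"
    unfolding ip_score by (rule post_adjoint[OF _ _ _ int]) auto
  then show ?thesis
    by (simp add: gaussN_linear_moment)
qed

lemma integrable_centered_sq: "integrable f (\<lambda>y. (ip d v (vsub d y (mean_vec d f)))\<^sup>2)"
proof (rule Bochner_Integration.integrable_bound)
  have sq: "integrable f (\<lambda>y. (y i)\<^sup>2)" if "i < d" for i
    using fin_cov that by (simp add: finite_cov_distribution_def)
  then have "integrable f (\<lambda>y. y i)" if "i < d" for i
    using that by (intro f.square_integrable_imp_integrable[of "\<lambda>y. y i"]) auto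
  with sq show "integrable f (\<lambda>y. ip d v v * (\<Sum>i<d. (y i)\<^sup>2 - 2 * mean_vec d f i * y i + (mean_vec d f i)\<^sup>2))"
    by (intro integrable_mult_right integrable_sum integrable_add integrable_diff) auto
  have "(ip d v (vsub d y (mean_vec d f)))\<^sup>2
      \<le> ip d v v * (\<Sum>i<d. (y i)\<^sup>2 - 2 * mean_vec d f i * y i + (mean_vec d f i)\<^sup>2)" for y
  proof -
    have "ip d (vsub d y (mean_vec d f)) (vsub d y (mean_vec d f))
        = (\<Sum>i<d. (y i)\<^sup>2 - 2 * mean_vec d f i * y i + (mean_vec d f i)\<^sup>2)"
      by (auto simp: ip_def vsub_def power2_eq_square algebra_simps intro!: sum.cong)
    with ip_sq_le[of d v "vsub d y (mean_vec d f)"] show ?thesis by simp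
  qed
  then show "AE y in f. norm ((ip d v (vsub d y (mean_vec d f)))\<^sup>2)
      \<le> norm (ip d v v * (\<Sum>i<d. (y i)\<^sup>2 - 2 * mean_vec d f i * y i + (mean_vec d f i)\<^sup>2))"
    by (auto intro: order_trans[OF _ abs_ge_self])
qed measurable

text \<open>The covariance inequality applied to the test function \<open>v \<cdot> (x - m)\<close>, as in the
  Cramer--Rao bound.\<close>

lemma norm_sq_le_info:
  assumes S: "\<And>v. (\<integral>y. (ip d v (vsub d y (mean_vec d f)))\<^sup>2 \<partial>f) \<le> S * ip d v v" and "r\<^sup>2 \<le> S"
  shows "ip d w w \<le> 4 * S * info w"
proof -
  define m where "m = mean_vec d f"
  define g where "g x = ip d w (vsub d x m)" for x
  have [measurable]: "g \<in> borel_measurable (Rd d)"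
    unfolding g_def by measurable
  have int: "integrable N (\<lambda>z. (- (ip d w z / r\<^sup>2))\<^sup>2)" and int': "integrable N (\<lambda>z. (ip d w z)\<^sup>2)"
    using gaussN_bilinear_moment(1)[OF r_pos, of d w w]
    by (simp_all add: power_divide power2_eq_square)
  have fm: "integrable f (\<lambda>y. (g y)\<^sup>2)"
    unfolding g_def m_def by (rule integrable_centered_sq)
  have g_add: "g (vadd d y z) = g y + ip d w z" for y z
    by (simp add: g_def ip_def vsub_def vadd_def algebra_simps flip: sum.distrib)
  have f2: "0 \<le> (\<integral>y. (g y)\<^sup>2 \<partial>f)" by (rule integral_nonneg_AE) simp
  have "(\<integral>\<^sup>+x. ennreal ((g x)\<^sup>2) \<partial>sm) = (\<integral>\<^sup>+y. \<integral>\<^sup>+z. ennreal ((g y + ip d w z)\<^sup>2) \<partial>N \<partial>f)"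
    by (subst sm_law) (auto simp: g_add)
  \<comment> \<open>This crude splitting replaces the exact variance of a sum of independent terms
    and doubles the constant, whence the 4 in the conclusion.\<close>
  also have "\<dots> \<le> (\<integral>\<^sup>+y. \<integral>\<^sup>+z. ennreal (2 * (g y)\<^sup>2) + ennreal (2 * (ip d w z)\<^sup>2) \<partial>N \<partial>f)"
  proof (intro nn_integral_mono)
    fix y z
    have "(g y + ip d w z)\<^sup>2 \<le> 2 * (g y)\<^sup>2 + 2 * (ip d w z)\<^sup>2"
      using sum_squares_bound[of "g y" "ip d w z"] by (simp add: power2_sum)
    then show "ennreal ((g y + ip d w z)\<^sup>2) \<le> ennreal (2 * (g y)\<^sup>2) + ennreal (2 * (ip d w z)\<^sup>2)"
      by (simp flip: ennreal_plus)
  qed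
  also have "\<dots> = 2 * (\<integral>\<^sup>+y. ennreal ((g y)\<^sup>2) \<partial>f) + 2 * (\<integral>\<^sup>+z. ennreal ((ip d w z)\<^sup>2) \<partial>N)"
    by (simp add: nn_integral_add nn_integral_cmult ennreal_mult N.emeasure_space_1[simplified]
      f.emeasure_space_1[simplified])
  also have "\<dots> = ennreal (2 * (\<integral>y. (g y)\<^sup>2 \<partial>f) + 2 * (r\<^sup>2 * ip d w w))"
    using nn_integral_eq_integral[OF fm] nn_integral_eq_integral[OF int'] f2
      gaussN_bilinear_moment(2)[OF r_pos, of d w w]
    by (simp add: ennreal_mult power2_eq_square ennreal_plus)
  also have "\<dots> \<le> ennreal (4 * S * ip d w w)"
  proof (rule ennreal_leI)
    have "r\<^sup>2 * ip d w w \<le> S * ip d w w" 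
      using assms(2) by (rule mult_right_mono) simp
    then show "2 * (\<integral>y. (g y)\<^sup>2 \<partial>f) + 2 * (r\<^sup>2 * ip d w w) \<le> 4 * S * ip d w w"
      using S[of w] unfolding g_def m_def by linarith
  qed
  finally have le: "(\<integral>\<^sup>+x. ennreal ((g x)\<^sup>2) \<partial>sm) \<le> ennreal (4 * S * ip d w w)" .
  have gint: "integrable sm (\<lambda>x. (g x)\<^sup>2)"
    using le by (intro integrableI_bounded) (auto simp: order_le_less_trans)
  have S0: "0 \<le> S" using assms(2) zero_le_power2[of r] by linarith
  have gle: "(\<integral>x. (g x)\<^sup>2 \<partial>sm) \<le> 4 * S * ip d w w"
    using le nn_integral_eq_integral[OF gint] S0 by simp
  have "(\<integral>x. g x * ip d w (sc x) \<partial>sm) = (\<integral>y. \<integral>z. g (vadd d y z) * - (ip d w z / r\<^sup>2) \<partial>N \<partial>f)"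
    unfolding ip_score by (rule post_adjoint[OF _ _ gint int]) measurable
  \<comment> \<open>The score is the posterior mean of -z/r^2, so by adjointness only the term
    quadratic in the noise survives, and it equals -|w|^2.\<close>
  also have "\<dots> = (\<integral>y. - ip d w w \<partial>f)"
  proof (rule Bochner_Integration.integral_cong[OF refl])
    fix y
    have "(\<integral>z. g (vadd d y z) * - (ip d w z / r\<^sup>2) \<partial>N)
        = (\<integral>z. - (g y / r\<^sup>2) * ip d w z + - (1 / r\<^sup>2) * (ip d w z * ip d w z) \<partial>N)"
      by (intro Bochner_Integration.integral_cong refl) (simp add: g_add algebra_simps add_divide_distrib)
    also have "\<dots> = - ip d w w"
      using r_pos by (subst Bochner_Integration.integral_add)
        (auto simp: gaussN_linear_moment gaussN_bilinear_moment simp del: r_pos)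
    finally show "(\<integral>z. g (vadd d y z) * - (ip d w z / r\<^sup>2) \<partial>N) = - ip d w w" .
  qed
  finally have "(\<integral>x. g x * ip d w (sc x) \<partial>sm) = - ip d w w"
    by (simp add: f.prob_space[simplified])
  then have "ip d w w = \<bar>\<integral>x. g x * ip d w (sc x) \<partial>sm\<bar>" by simp
  also have "\<dots> \<le> sqrt (\<integral>x. (g x)\<^sup>2 \<partial>sm) * sqrt (info w)"
    unfolding info_def by (rule Cauchy_Schwarz_integral) (auto intro: gint integrable_score_sq)
  also have "\<dots> \<le> sqrt (4 * S * ip d w w) * sqrt (info w)"
    using gle by (intro mult_right_mono) auto
  also have "\<dots> = sqrt (ip d w w) * sqrt (4 * S * info w)"
    by (simp flip: real_sqrt_mult add: mult_ac)
  finally have *: "sqrt (ip d w w) * sqrt (ip d w w) \<le> sqrt (ip d w w) * sqrt (4 * S * info w)"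
    by simp
  show ?thesis
  proof (cases "ip d w w = 0")
    case False
    with ip_self_nonneg[of d w] have "0 < ip d w w" by linarith
    then have "0 < sqrt (ip d w w)" by simp
    with * have "sqrt (ip d w w) \<le> sqrt (4 * S * info w)"
      using mult_le_cancel_left_pos by blast
    then show ?thesis by simp
  qed (use S0 in simp)
qed

text \<open>Jensen's inequality for the posterior mean.\<close>

lemma dens_vadd_ge: "dens x * exp (ip d c (sc x) - ip d c c / (2 * r\<^sup>2)) \<le> dens (vadd d x c)"
proof -
  define b where "b = ip d c (sc x) - ip d c c / (2 * r\<^sup>2)"
  define a where "a z = - (ip d c z / r\<^sup>2) - ip d c c / (2 * r\<^sup>2)" for z
  define I where "I = (\<integral>y. ip d c (vsub d x y) * gd d r (vsub d x y) \<partial>f)"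
  have sc: "ip d c (sc x) = - (I / (r\<^sup>2 * dens x))"
    by (simp add: ip_score post_def I_def)
  have gd_a: "gd d r (vsub d (vadd d x c) y) = exp (a (vsub d x y)) * gd d r (vsub d x y)" for y
    by (simp add: gd_vsub_vadd a_def)
  have int1: "integrable f (\<lambda>y. exp b * ((1 - ip d c c / (2 * r\<^sup>2) - b) * gd d r (vsub d x y)
      - 1 / r\<^sup>2 * (ip d c (vsub d x y) * gd d r (vsub d x y))))"
    by (intro integrable_mult_right Bochner_Integration.integrable_diff integrable_gd_vsub integrable_ip_gd_vsub)
  \<comment> \<open>b is the posterior mean of the exponent a, so the tangent of exp at b integrates
    exactly to \<open>dens x * exp b\<close>.\<close>
  have "dens x * exp b = exp b * ((1 - ip d c c / (2 * r\<^sup>2) - b) * dens x - 1 / r\<^sup>2 * I)"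
    by (simp add: b_def sc field_simps)
  also have "\<dots> = (\<integral>y. exp b * ((1 - ip d c c / (2 * r\<^sup>2) - b) * gd d r (vsub d x y)
      - 1 / r\<^sup>2 * (ip d c (vsub d x y) * gd d r (vsub d x y))) \<partial>f)"
    unfolding dens_def I_def integral_mult_right_zero
    by (subst Bochner_Integration.integral_diff)
      (auto intro: integrable_gd_vsub integrable_ip_gd_vsub)
  also have "\<dots> \<le> (\<integral>y. gd d r (vsub d (vadd d x c) y) \<partial>f)"
  proof (rule integral_mono[OF int1 integrable_gd_vsub])
    fix y
    have "exp b * (1 + (a (vsub d x y) - b)) \<le> exp b * exp (a (vsub d x y) - b)"
      by (intro mult_left_mono exp_ge_add_one_self) simp
    also have "\<dots> = exp (a (vsub d x y))" by (simp flip: exp_add)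
    finally have "exp b * (1 + (a (vsub d x y) - b)) * gd d r (vsub d x y)
        \<le> exp (a (vsub d x y)) * gd d r (vsub d x y)"
      by (rule mult_right_mono) simp
    then show "exp b * ((1 - ip d c c / (2 * r\<^sup>2) - b) * gd d r (vsub d x y)
      - 1 / r\<^sup>2 * (ip d c (vsub d x y) * gd d r (vsub d x y))) \<le> gd d r (vsub d (vadd d x c) y)"
      by (simp add: gd_a a_def algebra_simps)
  qed
  finally show ?thesis
    by (simp add: b_def dens_def)
qed

text \<open>The convexity bound is used from x to x + c and back; multiplying the two cancels the
  densities. It is monotonicity along c of the gradient of log-density plus |x|^2/(2 r^2).\<close>

lemma score_shift_ge: "ip d c (sc x) - ip d c c / r\<^sup>2 \<le> ip d c (sc (vadd d x c))"
proof -
  let ?y = "vadd d x c" and ?q = "ip d c c / (2 * r\<^sup>2)"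
  have "dens (vadd d ?y (\<lambda>i. - c i)) = dens x"
    by (rule dens_cong) (simp add: vadd_def)
  then have "dens ?y * exp (- ip d c (sc ?y) - ?q) \<le> dens x"
    using dens_vadd_ge[of ?y "\<lambda>i. - c i"] by (simp add: ip_linear)
  moreover have "dens x * exp (ip d c (sc x) - ?q) \<le> dens ?y" 
    by (rule dens_vadd_ge)
  ultimately have "dens ?y * exp (- ip d c (sc ?y) - ?q) * exp (ip d c (sc x) - ?q) \<le> dens ?y"
    by (meson exp_ge_zero mult_right_mono order_trans)
  then have "exp ((- ip d c (sc ?y) - ?q) + (ip d c (sc x) - ?q)) \<le> 1"
    by (simp add: mult.assoc flip: exp_add)
  then have "(- ip d c (sc ?y) - ?q) + (ip d c (sc x) - ?q) \<le> 0" by simp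
  moreover have "ip d c c / r\<^sup>2 = 2 * ?q" by simp
  ultimately show ?thesis by linarith
qed

text \<open>Where the score in a direction of length \<open>r\<close> exceeds 2, it stays comparable after a step
  in that direction, while the density grows exponentially.\<close>

lemma score_tail_step:
  assumes c: "ip d c c = r\<^sup>2" and big: "2 < ip d c (sc x)"
  shows "(ip d c (sc x)) ^ 4 * exp (ip d c (sc x) / 2) * dens x
    \<le> 64 * ((ip d c (sc (vadd d x c)))\<^sup>2 * dens (vadd d x c))"
proof -
  define s where "s = ip d c (sc x)"
  define s' where "s' = ip d c (sc (vadd d x c))"
  have s2: "2 < s" using big by (simp add: s_def)
  \<comment> \<open>A step of length exactly r costs at most 1 in the score, and s > 2 guarantees
    that half of it remains.\<close>
  have "s - 1 \<le> s'"
    using score_shift_ge[of c x] c by (simp add: s_def s'_def)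
  then have "s / 2 \<le> s'" using s2 by simp
  then have "(s / 2)\<^sup>2 \<le> s'\<^sup>2" using s2 by (intro power_mono) auto
  then have ss: "s\<^sup>2 \<le> 4 * s'\<^sup>2" by (simp add: power_divide)
  have e8: "s\<^sup>2 \<le> 8 * exp (s / 2)"
    using exp_lower_Taylor_quadratic[of "s / 2"] s2 by (simp add: power_divide)
  have half: "exp (1 / 2 :: real) \<le> 2"
    using exp_bound[of "1 / 2 :: real"] by (simp add: power2_eq_square)
  have "dens x * exp (s - 1 / 2) \<le> dens (vadd d x c)"
    using dens_vadd_ge[of x c] c by (simp add: s_def)
  then have "dens x * exp (s - 1 / 2) * exp (1 / 2 - s) \<le> dens (vadd d x c) * exp (1 / 2 - s)"
    by (rule mult_right_mono) simp
  then have D: "dens x \<le> dens (vadd d x c) * exp (1 / 2 - s)"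
    by (simp add: mult.assoc flip: exp_add)
  \<comment> \<open>The final 64 is 4 times 8 times 2: from s^2 <= 4 s'^2, from s^2 exp(-s/2) <= 8,
    and from exp(1/2) <= 2.\<close>
  have "s ^ 4 * exp (s / 2) * dens x \<le> s ^ 4 * exp (s / 2) * (dens (vadd d x c) * exp (1 / 2 - s))"
    using D by (intro mult_left_mono) auto
  also have "\<dots> = s\<^sup>2 * dens (vadd d x c) * (s\<^sup>2 * exp (- s / 2)) * exp (1 / 2)"
  proof -
    have "exp (s / 2) * exp (1 / 2 - s) = exp (- s / 2) * exp (1 / 2)"
      by (simp flip: exp_add)
    then show ?thesis by (simp add: power4_eq_xxxx power2_eq_square mult_ac)
  qed
  also have "\<dots> \<le> s\<^sup>2 * dens (vadd d x c) * 8 * 2"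
  proof (intro mult_mono)
    have "s\<^sup>2 * exp (- s / 2) \<le> 8 * exp (s / 2) * exp (- s / 2)"
      using e8 by (rule mult_right_mono) simp
    then show "s\<^sup>2 * exp (- s / 2) \<le> 8" by (simp add: mult.assoc flip: exp_add)
  qed (use half in auto)
  also have "\<dots> \<le> 64 * (s'\<^sup>2 * dens (vadd d x c))"
    using mult_right_mono[OF ss dens_nonneg[of "vadd d x c"]] by simp
  finally show ?thesis by (simp add: s_def s'_def)
qed

text \<open>Where |s| <= 2, the fourth power is at most four times the square. Elsewhere the value
  at x is charged to x + c or x - c, and translation invariance returns each shifted integral to
  \<open>info c\<close>, so 140 = 12 + 64 + 64. The bound is linear in \<open>info c\<close> however
  small that is; this later makes remainders relative to the variance.\<close>

lemma score_fourth_exp_moment: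
  assumes c: "ip d c c = r\<^sup>2"
  shows "(\<integral>\<^sup>+x. ennreal ((ip d c (sc x)) ^ 4 * exp (\<bar>ip d c (sc x)\<bar> / 2)) \<partial>sm) \<le> ennreal (140 * info c)"
proof -
  define s where "s x = ip d c (sc x)" for x
  have [measurable]: "s \<in> borel_measurable (Rd d)" unfolding s_def by measurable
  define c' where "c' = (\<lambda>i. - c i)"
  have c': "ip d c' c' = r\<^sup>2" and ip_c': "ip d c' z = - ip d c z" for z
    using c by (simp_all add: c'_def ip_linear)
  define G where "G x = (s x)\<^sup>2 * dens x" for x
  have [measurable]: "G \<in> borel_measurable (Rd d)" unfolding G_def by measurable
  have G0: "0 \<le> G x" for x by (simp add: G_def)
  have pt: "dens x * (s x ^ 4 * exp (\<bar>s x\<bar> / 2)) \<le> 12 * G x + 64 * (G (vadd d x c) + G (vadd d x c'))" for x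
  proof -
    consider "\<bar>s x\<bar> \<le> 2" | "2 < s x" | "2 < - s x" by linarith
    then show ?thesis
    proof cases
      case 1
      then have "(s x)\<^sup>2 \<le> 4" using power_mono[of "\<bar>s x\<bar>" 2 2] by simp
      then have "(s x)\<^sup>2 * (s x)\<^sup>2 \<le> (s x)\<^sup>2 * 4"
        by (rule mult_left_mono) simp
      then have "s x ^ 4 \<le> (s x)\<^sup>2 * 4"
        by (simp add: power4_eq_xxxx power2_eq_square mult.assoc)
      moreover have "exp (\<bar>s x\<bar> / 2) \<le> 3"
        using 1 exp_le order_trans[of "exp (\<bar>s x\<bar> / 2)" "exp 1" 3] by simp
      ultimately have "s x ^ 4 * exp (\<bar>s x\<bar> / 2) \<le> (s x)\<^sup>2 * 4 * 3"
        by (intro mult_mono) auto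
      then have "dens x * (s x ^ 4 * exp (\<bar>s x\<bar> / 2)) \<le> dens x * ((s x)\<^sup>2 * 4 * 3)"
        by (rule mult_left_mono) simp
      also have "\<dots> \<le> 12 * G x + 64 * (G (vadd d x c) + G (vadd d x c'))"
        by (simp add: G_def)
      finally show ?thesis .
    next
      case 2
      then have "dens x * (s x ^ 4 * exp (\<bar>s x\<bar> / 2)) \<le> 64 * G (vadd d x c)"
        using score_tail_step[OF c, of x] by (simp add: s_def G_def mult_ac)
      also have "\<dots> \<le> 12 * G x + 64 * (G (vadd d x c) + G (vadd d x c'))"
        using G0[of x] G0[of "vadd d x c'"] by simp
      finally show ?thesis .
    next
      case 3
      then have "dens x * (s x ^ 4 * exp (\<bar>s x\<bar> / 2)) \<le> 64 * G (vadd d x c')"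
        using score_tail_step[OF c', of x] by (simp add: s_def G_def ip_c' mult_ac)
      also have "\<dots> \<le> 12 * G x + 64 * (G (vadd d x c) + G (vadd d x c'))"
        using G0[of x] G0[of "vadd d x c"] by simp
      finally show ?thesis .
    qed
  qed
  have G: "(\<integral>\<^sup>+x. ennreal (G x) \<partial>lborel_Rd d) = ennreal (info c)"
  proof -
    have "(\<integral>\<^sup>+x. ennreal (G x) \<partial>lborel_Rd d) = (\<integral>\<^sup>+x. ennreal ((s x)\<^sup>2) \<partial>sm)"
      by (simp add: nn_integral_sm G_def mult.commute flip: ennreal_mult)
    also have "\<dots> = ennreal (info c)"
      using nn_integral_eq_integral[OF integrable_score_sq[of c]] by (simp add: s_def info_def)
    finally show ?thesis .
  qed
  have "(\<integral>\<^sup>+x. ennreal (s x ^ 4 * exp (\<bar>s x\<bar> / 2)) \<partial>sm)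
      = (\<integral>\<^sup>+x. ennreal (dens x * (s x ^ 4 * exp (\<bar>s x\<bar> / 2))) \<partial>lborel_Rd d)"
    by (simp add: nn_integral_sm flip: ennreal_mult)
  also have "\<dots> \<le> (\<integral>\<^sup>+x. 12 * ennreal (G x) + 64 * (ennreal (G (vadd d x c)) + ennreal (G (vadd d x c'))) \<partial>lborel_Rd d)"
  proof (intro nn_integral_mono)
    fix x
    have "ennreal (dens x * (s x ^ 4 * exp (\<bar>s x\<bar> / 2)))
        \<le> ennreal (12 * G x + 64 * (G (vadd d x c) + G (vadd d x c')))"
      by (rule ennreal_leI[OF pt])
    also have "\<dots> = 12 * ennreal (G x) + 64 * (ennreal (G (vadd d x c)) + ennreal (G (vadd d x c')))"
      by (simp add: G0 ennreal_plus ennreal_mult)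
    finally show "ennreal (dens x * (s x ^ 4 * exp (\<bar>s x\<bar> / 2)))
      \<le> 12 * ennreal (G x) + 64 * (ennreal (G (vadd d x c)) + ennreal (G (vadd d x c')))" .
  qed
  also have "\<dots> = 12 * (\<integral>\<^sup>+x. ennreal (G x) \<partial>lborel_Rd d)
      + 64 * ((\<integral>\<^sup>+x. ennreal (G (vadd d x c)) \<partial>lborel_Rd d) + (\<integral>\<^sup>+x. ennreal (G (vadd d x c')) \<partial>lborel_Rd d))"
    by (simp add: nn_integral_add nn_integral_cmult)
  also have "(\<integral>\<^sup>+x. ennreal (G (vadd d x c)) \<partial>lborel_Rd d) = ennreal (info c)"
    by (subst nn_integral_lborel_Rd_vadd[of "\<lambda>x. ennreal (G x)"]) (auto simp: G)
  also have "(\<integral>\<^sup>+x. ennreal (G (vadd d x c')) \<partial>lborel_Rd d) = ennreal (info c)"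
    by (subst nn_integral_lborel_Rd_vadd[of "\<lambda>x. ennreal (G x)"]) (auto simp: G)
  also have "12 * (\<integral>\<^sup>+x. ennreal (G x) \<partial>lborel_Rd d) + 64 * (ennreal (info c) + ennreal (info c))
      = ennreal (12 * info c + 64 * (info c + info c))"
    by (simp only: G ennreal_plus[symmetric] ennreal_numeral[symmetric] ennreal_mult[symmetric]
      info_nonneg zero_le_numeral add_nonneg_nonneg mult_nonneg_nonneg)
  also have "12 * info c + 64 * (info c + info c) = 140 * info c" by simp
  finally show ?thesis by (simp add: s_def)
qed

text \<open>Rescale w to length r. The threshold 1/4 keeps the squared exponential exp(2t|s|) below
  the available exp(|s|/2); of the four powers of t, two are absorbed into
  \<open>info w\<close>.\<close>

lemma score_exp_moment:
  assumes w: "vnorm d w = t * r" and t: "0 \<le> t" "t \<le> 1 / 4"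
  shows "integrable sm (\<lambda>x. ((ip d w (sc x))\<^sup>2 * exp \<bar>ip d w (sc x)\<bar>)\<^sup>2)"
    and "(\<integral>x. ((ip d w (sc x))\<^sup>2 * exp \<bar>ip d w (sc x)\<bar>)\<^sup>2 \<partial>sm) \<le> 140 * t\<^sup>2 * info w"
proof -
  let ?F = "\<lambda>x. ((ip d w (sc x))\<^sup>2 * exp \<bar>ip d w (sc x)\<bar>)\<^sup>2"
  have le: "(\<integral>\<^sup>+x. ennreal (?F x) \<partial>sm) \<le> ennreal (140 * t\<^sup>2 * info w)"
  proof (cases "t = 0")
    case True
    then have "\<forall>i<d. w i = 0" using w vnorm_zero_iff[of d w] by simp
    then have "ip d w z = 0" for z by (simp add: ip_def)
    then show ?thesis by simp
  next
    case False
    with t have t0: "0 < t" by simp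
    define c where "c = (\<lambda>i. (1 / t) * w i)"
    have wc: "ip d w z = t * ip d c z" for z
      unfolding c_def ip_scale_left using t0 by simp
    have "vnorm d c = r" 
      using t0 w by (simp only: c_def vnorm_scale) simp
    then have cc: "ip d c c = r\<^sup>2" by (simp flip: vnorm_sq)
    have infoc: "info w = t\<^sup>2 * info c"
      by (simp add: info_def wc power_mult_distrib)
    have "(\<integral>\<^sup>+x. ennreal (?F x) \<partial>sm)
        \<le> (\<integral>\<^sup>+x. ennreal (t ^ 4) * ennreal ((ip d c (sc x)) ^ 4 * exp (\<bar>ip d c (sc x)\<bar> / 2)) \<partial>sm)"
    proof (intro nn_integral_mono)
      fix x
      let ?s = "ip d c (sc x)"
      have "2 * (t * \<bar>?s\<bar>) \<le> \<bar>?s\<bar> / 2"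
        using mult_right_mono[of t "1/4" "\<bar>?s\<bar>"] t by simp
      then have "exp (2 * (t * \<bar>?s\<bar>)) \<le> exp (\<bar>?s\<bar> / 2)" by simp
      then have "(t * ?s) ^ 4 * exp (2 * (t * \<bar>?s\<bar>)) \<le> (t * ?s) ^ 4 * exp (\<bar>?s\<bar> / 2)"
        by (rule mult_left_mono) simp
      moreover have "?F x = (t * ?s) ^ 4 * exp (2 * (t * \<bar>?s\<bar>))"
        using t0 by (simp add: wc power_mult_distrib abs_mult exp_double flip: power_mult)
      ultimately have "?F x \<le> t ^ 4 * (?s ^ 4 * exp (\<bar>?s\<bar> / 2))"
        by (simp add: power_mult_distrib mult.assoc)
      then have "ennreal (?F x) \<le> ennreal (t ^ 4 * (?s ^ 4 * exp (\<bar>?s\<bar> / 2)))"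
        by (rule ennreal_leI)
      then show "ennreal (?F x) \<le> ennreal (t ^ 4) * ennreal (?s ^ 4 * exp (\<bar>?s\<bar> / 2))"
        by (simp add: ennreal_mult)
    qed
    also have "\<dots> = ennreal (t ^ 4) * (\<integral>\<^sup>+x. ennreal ((ip d c (sc x)) ^ 4 * exp (\<bar>ip d c (sc x)\<bar> / 2)) \<partial>sm)"
      by (rule nn_integral_cmult) measurable
    also have "\<dots> \<le> ennreal (t ^ 4) * ennreal (140 * info c)"
      by (intro mult_left_mono score_fourth_exp_moment cc) simp
    also have "\<dots> = ennreal (140 * t\<^sup>2 * info w)"
      by (subst ennreal_mult[symmetric]) (use t in \<open>auto simp: infoc power4_eq_xxxx power2_eq_square mult_ac\<close>)
    finally show ?thesis .
  qed
  show int: "integrable sm ?F"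
    using le by (intro integrableI_bounded) (auto simp: order_le_less_trans)
  show "(\<integral>x. ?F x \<partial>sm) \<le> 140 * t\<^sup>2 * info w"
    using le nn_integral_eq_integral[OF int] by simp
qed

section \<open>The density ratio, the drift, and the moment generating function of the score\<close>

lemma post_diff:
  assumes "integrable f (\<lambda>y. g (vsub d x y) * gd d r (vsub d x y))"
    and "integrable f (\<lambda>y. h (vsub d x y) * gd d r (vsub d x y))"
  shows "post (\<lambda>z. g z - h z) x = post g x - post h x"
  using assms by (simp add: post_def left_diff_distrib diff_divide_distrib)

lemma post_one: "post (\<lambda>_. 1) x = 1"
  by (simp add: post_def flip: dens_def)

lemma integrable_post_exp:
  "integrable f (\<lambda>y. exp (- (ip d c (vsub d x y) / r\<^sup>2) - ip d c c / (2 * r\<^sup>2)) * gd d r (vsub d x y))"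
  using integrable_gd_vsub[of "vadd d x c"] by (simp add: gd_vsub_vadd)

text \<open>L2 contraction of \<open>post\<close> applied to \<open>E - 1\<close>; the bound is the
  chi-square divergence of two Gaussians at distance |c|.\<close>

lemma ratio_moment:
  shows "integrable sm (\<lambda>x. (ratio c x - 1)\<^sup>2)"
    and "(\<integral>x. (ratio c x - 1)\<^sup>2 \<partial>sm) \<le> exp (ip d c c / r\<^sup>2) - 1"
proof -
  define E where "E z = exp (- (ip d c z / r\<^sup>2) - ip d c c / (2 * r\<^sup>2))" for z
  note mom = gaussN_exp_moments[OF r_pos, of d c, folded E_def]
  have [measurable]: "E \<in> borel_measurable (Rd d)" unfolding E_def by measurable
  have eq: "ratio c x - 1 = post (\<lambda>z. E z - 1) x" for x
    by (subst post_diff) (auto simp: E_def[abs_def] ratio_eq_post post_one integrable_post_exp integrable_gd_vsub)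
  have int: "integrable N (\<lambda>z. (E z - 1)\<^sup>2)"
    using mom by (simp add: power2_diff)
  show "integrable sm (\<lambda>x. (ratio c x - 1)\<^sup>2)"
    unfolding eq by (rule integrable_post_sq[OF _ int]) measurable
  have "(\<integral>x. (ratio c x - 1)\<^sup>2 \<partial>sm) \<le> (\<integral>z. (E z - 1)\<^sup>2 \<partial>N)"
    unfolding eq by (rule integrable_post_sq[OF _ int]) measurable
  also have "\<dots> = exp (ip d c c / r\<^sup>2) - 1"
    using mom by (simp add: power2_diff N.prob_space[simplified])
  finally show "(\<integral>x. (ratio c x - 1)\<^sup>2 \<partial>sm) \<le> exp (ip d c c / r\<^sup>2) - 1" .
qed

text \<open>Subtracting the score takes away the part of \<open>E - 1\<close> that is linear in the
  noise, so that the L2 norm of the rest is of second order in |c|/r.\<close>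

lemma ratio_linearization:
  shows "integrable sm (\<lambda>x. (ratio c x - 1 - ip d c (sc x))\<^sup>2)"
    and "(\<integral>x. (ratio c x - 1 - ip d c (sc x))\<^sup>2 \<partial>sm) \<le> exp (ip d c c / r\<^sup>2) - 1 - ip d c c / r\<^sup>2"
proof -
  define E where "E z = exp (- (ip d c z / r\<^sup>2) - ip d c c / (2 * r\<^sup>2))" for z
  define g where "g z = - (ip d c z / r\<^sup>2)" for z
  note mom = gaussN_exp_moments[OF r_pos, of d c, folded E_def g_def]
  have [measurable]: "E \<in> borel_measurable (Rd d)" "g \<in> borel_measurable (Rd d)" 
    unfolding E_def g_def by measurable
  have g1: "integrable N g" "(\<integral>z. g z \<partial>N) = 0"
    unfolding g_def by (simp_all add: gaussN_linear_moment)
  have gg: "(g z)\<^sup>2 = ip d c z * ip d c z / (r\<^sup>2 * r\<^sup>2)" for z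
    by (simp add: g_def power2_eq_square)
  have g2: "integrable N (\<lambda>z. (g z)\<^sup>2)" "(\<integral>z. (g z)\<^sup>2 \<partial>N) = ip d c c / r\<^sup>2"
    unfolding gg by (simp_all add: gaussN_bilinear_moment power2_eq_square)
  have Eg: "integrable N (\<lambda>z. E z * g z)"
    by (rule Cauchy_Schwarz_integral) (use mom g2 in auto)
  have eq: "ratio c x - 1 - ip d c (sc x) = post (\<lambda>z. E z - 1 - g z) x" for x
  proof -
    have i1: "integrable f (\<lambda>y. E (vsub d x y) * gd d r (vsub d x y))"
      unfolding E_def by (rule integrable_post_exp)
    have i2: "integrable f (\<lambda>y. 1 * gd d r (vsub d x y))"
      using integrable_gd_vsub by simp
    have i3: "integrable f (\<lambda>y. g (vsub d x y) * gd d r (vsub d x y))"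
      unfolding g_def using integrable_ip_gd_vsub[of c x] by simp
    have "post (\<lambda>z. E z - 1 - g z) x = post (\<lambda>z. E z - 1) x - post g x"
      by (rule post_diff[OF _ i3])
        (use Bochner_Integration.integrable_diff[OF i1 i2] in \<open>simp add: left_diff_distrib\<close>)
    also have "post (\<lambda>z. E z - 1) x = post E x - post (\<lambda>_. 1) x"
      by (rule post_diff[OF i1 i2])
    finally show ?thesis
      unfolding ratio_eq_post ip_score E_def g_def post_one by simp
  qed
  have ex: "(E z - 1 - g z)\<^sup>2 = (E z)\<^sup>2 + 1 + (g z)\<^sup>2 - 2 * E z - 2 * (E z * g z) + 2 * g z" for z
    by (simp add: power2_eq_square algebra_simps)
  have int: "integrable N (\<lambda>z. (E z - 1 - g z)\<^sup>2)"
    unfolding ex using mom g1 g2 Eg by simp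
  show "integrable sm (\<lambda>x. (ratio c x - 1 - ip d c (sc x))\<^sup>2)"
    unfolding eq by (rule integrable_post_sq[OF _ int]) measurable
  have "(\<integral>x. (ratio c x - 1 - ip d c (sc x))\<^sup>2 \<partial>sm) \<le> (\<integral>z. (E z - 1 - g z)\<^sup>2 \<partial>N)"
    unfolding eq by (rule integrable_post_sq[OF _ int]) measurable
  also have "\<dots> = exp (ip d c c / r\<^sup>2) - 1 - ip d c c / r\<^sup>2"
    unfolding ex using mom g1 g2 Eg by (simp add: N.prob_space[simplified])
  finally show "(\<integral>x. (ratio c x - 1 - ip d c (sc x))\<^sup>2 \<partial>sm)
      \<le> exp (ip d c c / r\<^sup>2) - 1 - ip d c c / r\<^sup>2" .
qed

text \<open>First-order expansion of the drift in the displacement. The constant term vanishes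
  because the score has mean zero; Cauchy-Schwarz measures w by its information rather than by its
  length, which \<open>bias_bound\<close> exploits.\<close>

lemma drift_linearization:
  "\<bar>drift c w - (\<integral>x. ip d w (sc x) * ip d c (sc x) \<partial>sm)\<bar>
    \<le> sqrt (info w) * sqrt (exp (ip d c c / r\<^sup>2) - 1 - ip d c c / r\<^sup>2)"
proof -
  have int: "integrable sm (\<lambda>x. ip d w (sc x) * (ratio c x - 1 - ip d c (sc x)))"
    by (rule Cauchy_Schwarz_integral) (auto intro: integrable_score_sq ratio_linearization)
  have "drift c w = (\<integral>x. ip d w (sc x) * (ratio c x - 1 - ip d c (sc x))
      + (ip d w (sc x) + ip d w (sc x) * ip d c (sc x)) \<partial>sm)"
    unfolding drift_def by (intro Bochner_Integration.integral_cong refl) (simp add: algebra_simps)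
  also have "\<dots> = (\<integral>x. ip d w (sc x) * (ratio c x - 1 - ip d c (sc x)) \<partial>sm)
      + (\<integral>x. ip d w (sc x) * ip d c (sc x) \<partial>sm)"
    using int integrable_score integrable_score_prod by (simp add: score_mean)
  finally have "\<bar>drift c w - (\<integral>x. ip d w (sc x) * ip d c (sc x) \<partial>sm)\<bar>
      = \<bar>\<integral>x. ip d w (sc x) * (ratio c x - 1 - ip d c (sc x)) \<partial>sm\<bar>" by simp
  also have "\<dots> \<le> sqrt (info w) * sqrt (\<integral>x. (ratio c x - 1 - ip d c (sc x))\<^sup>2 \<partial>sm)"
    unfolding info_def
    by (rule Cauchy_Schwarz_integral) (auto intro: integrable_score_sq ratio_linearization)
  also have "\<dots> \<le> sqrt (info w) * sqrt (exp (ip d c c / r\<^sup>2) - 1 - ip d c c / r\<^sup>2)"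
    by (intro mult_left_mono real_sqrt_le_mono ratio_linearization) simp
  finally show ?thesis .
qed

lemma nn_integral_sm_vsub:
  assumes [measurable]: "g \<in> borel_measurable (Rd d)"
  shows "(\<integral>\<^sup>+x. g (vsub d x c) \<partial>sm) = (\<integral>\<^sup>+x. g x * ennreal (ratio c x) \<partial>sm)"
proof -
  have "(\<integral>\<^sup>+x. g (vsub d x c) \<partial>sm) = (\<integral>\<^sup>+x. ennreal (dens x) * g (vsub d x c) \<partial>lborel_Rd d)"
    by (rule nn_integral_sm) measurable
  also have "\<dots> = (\<integral>\<^sup>+x. ennreal (dens (vadd d x c)) * g (vsub d (vadd d x c) c) \<partial>lborel_Rd d)"
    by (rule nn_integral_lborel_Rd_vadd[symmetric]) measurable
  also have "\<dots> = (\<integral>\<^sup>+x. ennreal (dens x) * (g x * ennreal (ratio c x)) \<partial>lborel_Rd d)"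
  proof (rule nn_integral_cong)
    fix x assume "x \<in> space (lborel_Rd d)"
    then have "vsub d (vadd d x c) c = x" by simp
    moreover have "ennreal (dens (vadd d x c)) = ennreal (dens x) * ennreal (ratio c x)"
      by (simp add: ratio_def flip: ennreal_mult)
    ultimately show "ennreal (dens (vadd d x c)) * g (vsub d (vadd d x c) c)
        = ennreal (dens x) * (g x * ennreal (ratio c x))"
      by (simp add: mult_ac)
  qed
  also have "\<dots> = (\<integral>\<^sup>+x. g x * ennreal (ratio c x) \<partial>sm)"
    by (rule nn_integral_sm[symmetric]) measurable
  finally show ?thesis .
qed

lemma integrable_ratio: "integrable sm (ratio c)" and integral_ratio: "(\<integral>x. ratio c x \<partial>sm) = 1"
proof -
  have nn: "(\<integral>\<^sup>+x. ennreal (ratio c x) \<partial>sm) = 1"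
    using nn_integral_sm_vsub[of "\<lambda>_. 1" c] by (simp add: sm.emeasure_space_1[simplified])
  show "integrable sm (ratio c)"
    by (rule integrableI_nonneg) (auto simp: nn)
  then have "ennreal (\<integral>x. ratio c x \<partial>sm) = 1"
    using nn by (subst nn_integral_eq_integral[symmetric]) auto
  then show "(\<integral>x. ratio c x \<partial>sm) = 1"
    by (metis ennreal_1 ennreal_eq_1)
qed

lemma integrable_score_ratio:
  assumes [measurable]: "g \<in> borel_measurable (Rd d)"
    and g: "integrable sm (\<lambda>x. (g x)\<^sup>2)"
  shows "integrable sm (\<lambda>x. g x * ratio c x)"
proof -
  have "integrable sm (\<lambda>x. g x * (ratio c x - 1))"
    by (rule Cauchy_Schwarz_integral) (auto intro: g ratio_moment)
  moreover have "integrable sm g"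
    by (rule sm.square_integrable_imp_integrable[OF _ g]) measurable
  ultimately have "integrable sm (\<lambda>x. g x * (ratio c x - 1) + g x)" by simp
  then show ?thesis by (simp add: algebra_simps)
qed

text \<open>Second-order expansion of exp, integrated against the weight \<open>ratio c\<close>. The
  remainder Y = X^2 exp|X| contributes its main part \<open>info w\<close>, a relative error of
  order t, and an error from replacing the weight by 1. The last one is of order t
  sqrt(\<open>info w\<close>); V serves to trade t for sqrt(\<open>info w\<close>).\<close>

lemma score_mgf:
  assumes w: "vnorm d w = t * r" and t: "0 \<le> t" "t \<le> 1 / 4" and V: "ip d w w \<le> V * info w"
  shows "(\<integral>\<^sup>+x. ennreal (exp (ip d w (sc x))) * ennreal (ratio c x) \<partial>sm)
    \<le> ennreal (exp (drift c w + info w / 2 *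
        (1 + 12 * (sqrt (exp (ip d c c / r\<^sup>2) - 1) * (sqrt V / r) + t))))"
proof -
  define X where "X x = ip d w (sc x)" for x
  define Y where "Y x = (X x)\<^sup>2 * exp \<bar>X x\<bar>" for x
  define T where "T = sqrt (exp (ip d c c / r\<^sup>2) - 1)"
  have [measurable]: "X \<in> borel_measurable (Rd d)" "Y \<in> borel_measurable (Rd d)"
    unfolding X_def Y_def by measurable
  have X2: "integrable sm (\<lambda>x. (X x)\<^sup>2)" "(\<integral>x. (X x)\<^sup>2 \<partial>sm) = info w"
    by (auto simp: X_def info_def integrable_score_sq)
  have Y2: "integrable sm (\<lambda>x. (Y x)\<^sup>2)" "(\<integral>x. (Y x)\<^sup>2 \<partial>sm) \<le> 140 * t\<^sup>2 * info w"
    using score_exp_moment[OF w t] by (auto simp: Y_def X_def)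
  \<comment> \<open>140 is rounded up to 144, the square of the factor 12 in the statement.\<close>
  have "sqrt (140 * t\<^sup>2 * info w) \<le> sqrt (144 * t\<^sup>2 * info w)"
    by (intro real_sqrt_le_mono mult_right_mono) auto
  also have "\<dots> = 12 * t * sqrt (info w)"
    using t real_sqrt_abs[of 12] by (simp add: real_sqrt_mult)
  finally have sY: "sqrt (\<integral>x. (Y x)\<^sup>2 \<partial>sm) \<le> 12 * t * sqrt (info w)"
    using real_sqrt_le_mono[OF Y2(2)] by linarith
  have iY: "integrable sm Y"
    by (rule sm.square_integrable_imp_integrable[OF _ Y2(1)]) measurable
  have iYr: "integrable sm (\<lambda>x. Y x * ratio c x)" and iXr: "integrable sm (\<lambda>x. X x * ratio c x)"
    by (auto intro: integrable_score_ratio X2 Y2)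
  have iYr1: "integrable sm (\<lambda>x. Y x * (ratio c x - 1))"
    by (rule Cauchy_Schwarz_integral) (auto intro: Y2 ratio_moment)
  have iXY: "integrable sm (\<lambda>x. \<bar>X x\<bar> * Y x)"
    by (rule Cauchy_Schwarz_integral) (auto intro: Y2 X2)
  have I1: "(\<integral>x. Y x * (ratio c x - 1) \<partial>sm) \<le> 12 * t * sqrt (info w) * T"
  proof -
    have "(\<integral>x. Y x * (ratio c x - 1) \<partial>sm) \<le> \<bar>\<integral>x. Y x * (ratio c x - 1) \<partial>sm\<bar>" by simp
    also have "\<dots> \<le> sqrt (\<integral>x. (Y x)\<^sup>2 \<partial>sm) * sqrt (\<integral>x. (ratio c x - 1)\<^sup>2 \<partial>sm)"
      by (rule Cauchy_Schwarz_integral) (auto intro: Y2 ratio_moment)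
    also have "\<dots> \<le> 12 * t * sqrt (info w) * T"
      unfolding T_def using t
      by (intro mult_mono sY real_sqrt_le_mono ratio_moment) (auto intro: integral_nonneg_AE)
    finally show ?thesis .
  qed
  have I2: "(\<integral>x. \<bar>X x\<bar> * Y x \<partial>sm) \<le> 12 * t * info w"
  proof -
    have "(\<integral>x. \<bar>X x\<bar> * Y x \<partial>sm) \<le> \<bar>\<integral>x. \<bar>X x\<bar> * Y x \<partial>sm\<bar>" by simp
    also have "\<dots> \<le> sqrt (\<integral>x. \<bar>X x\<bar>\<^sup>2 \<partial>sm) * sqrt (\<integral>x. (Y x)\<^sup>2 \<partial>sm)"
      by (rule Cauchy_Schwarz_integral) (auto intro: Y2 X2)
    also have "\<dots> \<le> sqrt (info w) * (12 * t * sqrt (info w))"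
      using X2 by (intro mult_mono sY) (auto intro: integral_nonneg_AE)
    also have "\<dots> = 12 * t * info w" by simp
    finally show ?thesis .
  qed
  have Yle: "Y x \<le> (X x)\<^sup>2 + \<bar>X x\<bar> * Y x" for x
  proof -
    have "(X x)\<^sup>2 * (exp \<bar>X x\<bar> - 1) \<le> (X x)\<^sup>2 * (\<bar>X x\<bar> * exp \<bar>X x\<bar>)"
      by (intro mult_left_mono exp_abs_minus_one_le) simp
    then show ?thesis by (simp add: Y_def algebra_simps)
  qed
  have "(\<integral>x. Y x \<partial>sm) \<le> (\<integral>x. (X x)\<^sup>2 + \<bar>X x\<bar> * Y x \<partial>sm)"
    by (rule integral_mono[OF iY]) (use X2 iXY Yle in auto)
  also have "\<dots> \<le> info w + 12 * t * info w"
    using I2 X2 iXY by simp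
  finally have I3: "(\<integral>x. Y x \<partial>sm) \<le> info w + 12 * t * info w" .
  have "(\<integral>x. Y x * ratio c x \<partial>sm) = (\<integral>x. Y x * (ratio c x - 1) + Y x \<partial>sm)"
    by (intro Bochner_Integration.integral_cong refl) (simp add: algebra_simps)
  also have "\<dots> = (\<integral>x. Y x * (ratio c x - 1) \<partial>sm) + (\<integral>x. Y x \<partial>sm)"
    using iYr1 iY by simp
  also have "\<dots> \<le> 12 * t * sqrt (info w) * T + (info w + 12 * t * info w)"
    using I1 I3 by simp
  also have "\<dots> \<le> info w * (1 + 12 * (T * (sqrt V / r) + t))"
  proof -
    have "t * r \<le> sqrt V * sqrt (info w)"
      using real_sqrt_le_mono[OF V] w by (simp add: vnorm_eq_sqrt real_sqrt_mult)
    then have "t \<le> sqrt V / r * sqrt (info w)"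
      by (simp add: pos_le_divide_eq)
    then have "t * (sqrt (info w) * T) \<le> sqrt V / r * sqrt (info w) * (sqrt (info w) * T)"
      by (rule mult_right_mono) (simp add: T_def)
    also have "\<dots> = info w * (T * (sqrt V / r))"
      by simp
    finally have "t * (sqrt (info w) * T) \<le> info w * (T * (sqrt V / r))" .
    moreover have "info w * (1 + 12 * (T * (sqrt V / r) + t))
        = info w + 12 * (info w * (T * (sqrt V / r))) + 12 * t * info w"
      by (simp add: algebra_simps)
    moreover have "12 * t * sqrt (info w) * T = 12 * (t * (sqrt (info w) * T))" by simp
    ultimately show ?thesis by linarith
  qed
  finally have IY: "(\<integral>x. Y x * ratio c x \<partial>sm) \<le> info w * (1 + 12 * (T * (sqrt V / r) + t))" .
  have up: "exp (X x) * ratio c x \<le> ratio c x + X x * ratio c x + Y x * ratio c x / 2" for x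
    using mult_right_mono[OF exp_le_second_order[of "X x"], of "ratio c x"]
    by (simp add: Y_def algebra_simps)
  have iup: "integrable sm (\<lambda>x. ratio c x + X x * ratio c x + Y x * ratio c x / 2)"
    using integrable_ratio iXr iYr by auto
  have "(\<integral>\<^sup>+x. ennreal (exp (X x)) * ennreal (ratio c x) \<partial>sm)
      \<le> (\<integral>\<^sup>+x. ennreal (ratio c x + X x * ratio c x + Y x * ratio c x / 2) \<partial>sm)"
    by (intro nn_integral_mono) (use up in \<open>auto intro!: ennreal_leI simp flip: ennreal_mult\<close>)
  also have "\<dots> = ennreal (\<integral>x. ratio c x + X x * ratio c x + Y x * ratio c x / 2 \<partial>sm)"
    by (rule nn_integral_eq_integral[OF iup])
      (use up in \<open>auto intro!: AE_I2 order_trans[OF _ up]\<close>)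
  also have "(\<integral>x. ratio c x + X x * ratio c x + Y x * ratio c x / 2 \<partial>sm)
      = 1 + drift c w + (\<integral>x. Y x * ratio c x \<partial>sm) / 2"
    using integrable_ratio iXr iYr integral_ratio by (simp add: drift_def X_def)
  also have "ennreal \<dots> \<le> ennreal (exp (drift c w + info w / 2 * (1 + 12 * (T * (sqrt V / r) + t))))"
    using IY by (intro ennreal_leI order_trans[OF _ exp_ge_add_one_self]) simp
  finally show ?thesis by (simp add: X_def T_def)
qed

end

section \<open>Dimension-free concentration\<close>

text \<open>\<open>ennreal\<close> sends negative values to 0, so the right-hand side is the
  integral of the positive part.\<close>

lemma integral_le_nn_integral:
  fixes g :: "'a \<Rightarrow> real"
  assumes "integrable M g"
  shows "ennreal (\<integral>x. g x \<partial>M) \<le> (\<integral>\<^sup>+x. ennreal (g x) \<partial>M)"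
proof -
  have int: "integrable M (\<lambda>x. max 0 (g x))"
    using assms by auto
  have "ennreal (\<integral>x. g x \<partial>M) \<le> ennreal (\<integral>x. max 0 (g x) \<partial>M)"
    by (intro ennreal_leI integral_mono assms int) simp
  also have "\<dots> = (\<integral>\<^sup>+x. ennreal (max 0 (g x)) \<partial>M)"
    by (rule nn_integral_eq_integral[symmetric, OF int]) simp
  also have "\<dots> = (\<integral>\<^sup>+x. ennreal (g x) \<partial>M)"
    by (intro nn_integral_cong) (auto simp: max_def ennreal_neg)
  finally show ?thesis .
qed

text \<open>Matrices as plain functions of two indices keep the concentration argument independent
  of the matrix type; \<open>mat_app_eq_mv\<close> translates.\<close>

definition mv :: "nat \<Rightarrow> (nat \<Rightarrow> nat \<Rightarrow> real) \<Rightarrow> (nat \<Rightarrow> real) \<Rightarrow> nat \<Rightarrow> real" where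
  "mv d J x = (\<lambda>i. \<Sum>j<d. J i j * x j)"

lemma mv_add: "mv d J (\<lambda>i. x i + y i) = (\<lambda>i. mv d J x i + mv d J y i)"
  by (simp add: mv_def algebra_simps sum.distrib)

lemma mv_scale: "mv d J (\<lambda>i. c * x i) = (\<lambda>i. c * mv d J x i)"
  by (simp add: mv_def algebra_simps sum_distrib_left)

lemma mv_cong: "(\<And>i. i < d \<Longrightarrow> x i = y i) \<Longrightarrow> mv d J x = mv d J y"
  by (simp add: mv_def)

lemma mv_symmetric:
  assumes "\<And>i j. i < d \<Longrightarrow> j < d \<Longrightarrow> J i j = J j i"
  shows "ip d x (mv d J y) = ip d (mv d J x) y"
proof -
  have "ip d x (mv d J y) = (\<Sum>i<d. \<Sum>j<d. x i * J i j * y j)"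
    by (simp add: ip_def mv_def sum_distrib_left mult.assoc)
  also have "\<dots> = (\<Sum>j<d. \<Sum>i<d. x i * J i j * y j)"
    by (rule sum.swap)
  also have "\<dots> = (\<Sum>j<d. \<Sum>i<d. J j i * x i * y j)"
    by (intro sum.cong refl) (simp add: assms)
  also have "\<dots> = ip d (mv d J x) y"
    by (simp add: ip_def mv_def sum_distrib_right)
  finally show ?thesis .
qed

lemma mv_measurable [measurable (raw)]:
  assumes "\<And>i. i < d \<Longrightarrow> (\<lambda>x. h x i) \<in> borel_measurable M"
  shows "(\<lambda>x. mv d J (h x) i) \<in> borel_measurable M"
  unfolding mv_def using assms by (intro borel_measurable_sum borel_measurable_times) auto

text \<open>A PAC-Bayesian argument: the prior is a standard Gaussian over directions, and for a
  realized vector \<open>S\<close> the posterior is its shift towards \<open>S\<close>, truncated to the directions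
  where the hypothesis on the moment generating function is available.\<close>

lemma gaussian_mixture_ge:
  fixes J :: "nat \<Rightarrow> nat \<Rightarrow> real" and s :: "nat \<Rightarrow> real"
  assumes sym: "\<And>i j. i < d \<Longrightarrow> j < d \<Longrightarrow> J i j = J j i"
    and nonneg: "\<And>x. 0 \<le> ip d x (mv d J x)"
    and norm_le: "\<And>x. vnorm d (mv d J x) \<le> p * vnorm d x"
    and T: "(\<Sum>i<d. J i i) = T" and F: "(\<Sum>i<d. \<Sum>j<d. (J i j)\<^sup>2) \<le> p * T"
    and \<gamma>: "0 < \<gamma>" "\<gamma> \<le> 1" and p: "0 < p" and T0: "0 < T" and a: "0 < a" and h: "0 < h"
    and s: "0 < vnorm d s" and \<rho>: "a * (h * p + sqrt (2 * p * T / \<gamma>)) \<le> \<rho>"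
  shows "ennreal (exp (a * h * vnorm d s - h\<^sup>2 / 2 - (1 + \<gamma>) / 2 * a\<^sup>2 * (h\<^sup>2 * p + (1 + \<gamma>) * T)) / 2)
    \<le> (\<integral>\<^sup>+x. indicator {x. a * vnorm d (mv d J x) \<le> \<rho>} x *
          ennreal (exp (a * ip d x s - (1 + \<gamma>) / 2 * a\<^sup>2 * ip d x (mv d J x))) \<partial>gaussN d 1)"
proof -
  interpret prob_space "gaussN d 1" by (rule prob_space_gaussN) simp
  let ?N = "gaussN d 1"
  define q where "q x = ip d x (mv d J x)" for x
  define B where "B = sqrt (2 * p * T / \<gamma>)"
  \<comment> \<open>Truncation set. Since E|Jx|^2 is the sum of the squared entries of J, at most p
    T, Markov's inequality leaves it mass at least 1 - \<gamma>/2. It is symmetric, so odd functions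
    still integrate to zero over it.\<close>
  define G where "G = {x. vnorm d (mv d J x) \<le> B}"
  define g where "g = (1 + \<gamma>) / 2 * a\<^sup>2"
  define v where "v = (\<lambda>i. h / vnorm d s * s i)"
  \<comment> \<open>After the shift by v the exponent is C + c.x - g q(x); the linear part will
    vanish by symmetry.\<close>
  define c where "c = (\<lambda>i. a * s i - 2 * g * mv d J v i - v i)"
  define C where "C = a * h * vnorm d s - h\<^sup>2 / 2 - g * q v"
  \<comment> \<open>The point where exp is linearized. The mean of q conditioned on \<open>G\<close>
    is at most (1 + \<gamma>) T, so m bounds the conditional mean exponent from below, and the only
    further loss is the mass of \<open>G\<close>, at least 1/2.\<close>
  define m where "m = C - g * (1 + \<gamma>) * T"
  have B2: "B\<^sup>2 = 2 * p * T / \<gamma>" and B0: "0 < B"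
    using p T0 \<gamma> by (simp_all add: B_def)
  have g0: "0 \<le> g" using \<gamma> by (simp add: g_def)
  have v_norm: "vnorm d v = h" 
    unfolding v_def vnorm_scale using h s by simp
  have vv: "ip d v v = h\<^sup>2" using v_norm by (simp flip: vnorm_sq)
  have vs: "ip d v s = h * vnorm d s"
    unfolding v_def ip_scale_left using s by (simp add: power2_eq_square flip: vnorm_sq)
  have qv: "q v \<le> h\<^sup>2 * p"
  proof -
    have "q v \<le> vnorm d v * vnorm d (mv d J v)"
      unfolding q_def using abs_ip_le[of d v "mv d J v"] by linarith
    also have "\<dots> \<le> h * (p * h)"
      unfolding v_norm using norm_le[of v] v_norm h by (intro mult_left_mono) auto
    finally show ?thesis by (simp add: power2_eq_square mult_ac)
  qed
  have [measurable]: "q \<in> borel_measurable (Rd d)" unfolding q_def by measurable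
  have [measurable]: "(\<lambda>x. vnorm d (mv d J x)) \<in> borel_measurable (Rd d)" by measurable
  have Gset: "G \<inter> space (Rd d) \<in> sets (Rd d)"
  proof -
    have "{x \<in> space (Rd d). vnorm d (mv d J x) \<le> B} \<in> sets (Rd d)" by measurable
    then show ?thesis by (simp add: G_def Int_def conj_commute)
  qed
  have indG [measurable]: "indicat_real G \<in> borel_measurable (Rd d)"
    using Gset by (simp add: borel_measurable_indicator_iff Int_commute)
  have intlin: "integrable ?N (\<lambda>x. ip d w x)" for w
    by (simp add: gaussN_linear_moment)
  have q_eq: "q x = (\<Sum>i<d. \<Sum>j<d. J i j * (x i * x j))" for x
    by (simp add: q_def ip_def mv_def sum_distrib_left mult_ac)
  have qint: "integrable ?N q"
    unfolding q_eq[abs_def] by (intro integral_double_sum gaussN_second_moment) auto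
  have Eq: "(\<integral>x. q x \<partial>?N) = T"
  proof -
    have "(\<integral>x. q x \<partial>?N) = (\<Sum>i<d. \<Sum>j<d. J i j * (\<integral>x. x i * x j \<partial>?N))"
      unfolding q_eq by (intro integral_double_sum gaussN_second_moment) auto
    also have "\<dots> = (\<Sum>i<d. \<Sum>j<d. if i = j then J i i else 0)"
      by (intro sum.cong refl) (simp add: gaussN_second_moment)
    also have "\<dots> = T" using T by simp
    finally show ?thesis .
  qed
  have Jq: "ip d (mv d J x) (mv d J x) = (\<Sum>i<d. ip d (J i) x * ip d (J i) x)" for x
    by (simp add: ip_def mv_def)
  have "prob {x \<in> space ?N. B\<^sup>2 \<le> ip d (mv d J x) (mv d J x)} \<le> (\<integral>x. ip d (mv d J x) (mv d J x) \<partial>?N) / B\<^sup>2"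
    using B0 by (intro integral_Markov_inequality_measure[where A="{}"])
      (auto simp: Jq gaussN_bilinear_moment intro!: sum_nonneg)
  also have "(\<integral>x. ip d (mv d J x) (mv d J x) \<partial>?N) = (\<Sum>i<d. \<Sum>j<d. (J i j)\<^sup>2)"
    unfolding Jq by (subst Bochner_Integration.integral_sum)
      (auto simp: gaussN_bilinear_moment, simp add: ip_def power2_eq_square)
  also have "\<dots> / B\<^sup>2 \<le> p * T / B\<^sup>2"
    using F by (rule divide_right_mono) simp
  also have "\<dots> = \<gamma> / 2"
    using p T0 \<gamma> by (simp add: B2)
  finally have bad: "prob {x \<in> space ?N. B\<^sup>2 \<le> ip d (mv d J x) (mv d J x)} \<le> \<gamma> / 2" .
  define P where "P = prob (G \<inter> space ?N)"
  have "1 - P = prob (space ?N - (G \<inter> space ?N))"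
    unfolding P_def using Gset by (subst prob_compl) auto
  also have "\<dots> \<le> prob {x \<in> space ?N. B\<^sup>2 \<le> ip d (mv d J x) (mv d J x)}"
  proof (rule finite_measure_mono)
    have "B\<^sup>2 \<le> ip d (mv d J x) (mv d J x)" if "\<not> vnorm d (mv d J x) \<le> B" for x
      using that B0 power_mono[of B "vnorm d (mv d J x)" 2] by (simp add: vnorm_sq)
    then show "space ?N - G \<inter> space ?N \<subseteq> {x \<in> space ?N. B\<^sup>2 \<le> ip d (mv d J x) (mv d J x)}"
      by (auto simp: G_def)
    have "{x \<in> space (Rd d). B\<^sup>2 \<le> ip d (mv d J x) (mv d J x)} \<in> sets (Rd d)" by measurable
    then show "{x \<in> space ?N. B\<^sup>2 \<le> ip d (mv d J x) (mv d J x)} \<in> events" by simp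
  qed
  finally have P1: "1 - \<gamma> / 2 \<le> P" using bad by simp
  then have Phalf: "1 / 2 \<le> P" using \<gamma> by simp
  \<comment> \<open>The factor 1 + \<gamma> on T pays for the mass lost by truncation; this is where
    \<gamma> <= 1 is used.\<close>
  have "1 \<le> (1 - \<gamma> / 2) * (1 + \<gamma>)"
    using \<gamma> mult_left_mono[of \<gamma> 1 \<gamma>] by (simp add: algebra_simps)
  also have "\<dots> \<le> P * (1 + \<gamma>)"
    using P1 \<gamma> by (intro mult_right_mono) auto
  finally have P2: "1 \<le> P * (1 + \<gamma>)" .
  have ind_int: "integrable ?N (indicat_real G)"
    by (rule integrable_const_bound[where B=1]) auto
  have ind_P: "(\<integral>x. indicat_real G x \<partial>?N) = P"
    by (simp add: P_def)
  have indlin_int: "integrable ?N (\<lambda>x. indicat_real G x * ip d c x)"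
    by (rule Bochner_Integration.integrable_bound[OF intlin[of c]], measurable)
      (auto simp: indicator_def)
  have indlin: "(\<integral>x. indicat_real G x * ip d c x \<partial>?N) = 0"
  proof -
    have "mv d J (vsub d (\<lambda>_. 0) x) = (\<lambda>i. - mv d J x i)" for x
      by (simp add: mv_def vsub_def sum_negf)
    then have "indicat_real G (vsub d (\<lambda>_. 0) x) = indicat_real G x" for x
      by (simp add: G_def vnorm_minus indicator_def)
    moreover have "ip d c (vsub d (\<lambda>_. 0) x) = - ip d c x" for x
      by (simp add: ip_def vsub_def sum_negf)
    moreover have "(\<integral>x. indicat_real G (vsub d (\<lambda>_. 0) x) * ip d c (vsub d (\<lambda>_. 0) x) \<partial>?N)
        = (\<integral>x. indicat_real G x * ip d c x \<partial>?N)"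
      by (rule integral_gaussN_minus) measurable
    ultimately show ?thesis by simp
  qed
  have indq_int: "integrable ?N (\<lambda>x. indicat_real G x * q x)"
    by (rule Bochner_Integration.integrable_bound[OF qint], measurable)
      (auto simp: indicator_def)
  have indq: "(\<integral>x. indicat_real G x * q x \<partial>?N) \<le> T"
    unfolding Eq[symmetric] using nonneg
    by (intro integral_mono indq_int qint) (auto simp: indicator_def q_def)
  \<comment> \<open>The chain leads to the integral over \<open>G\<close> of the tangent of exp at
    m.\<close>
  have "exp m / 2 \<le> exp m * P" using Phalf by simp
  also have "\<dots> \<le> exp m * (P + g * T * (P * (1 + \<gamma>) - 1))"
    using P2 g0 T0 by (intro mult_left_mono) auto
  also have "\<dots> \<le> exp m * ((1 + C - m) * P - g * (\<integral>x. indicat_real G x * q x \<partial>?N))"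
    using mult_left_mono[OF indq g0] by (intro mult_left_mono) (auto simp: m_def algebra_simps)
  also have "\<dots> = (\<integral>x. exp m * ((1 + C - m) * indicat_real G x + indicat_real G x * ip d c x
        - g * (indicat_real G x * q x)) \<partial>?N)"
    using ind_int ind_P indlin_int indlin indq_int by simp
  finally have "ennreal (exp m / 2) \<le> ennreal (\<integral>x. exp m * ((1 + C - m) * indicat_real G x
        + indicat_real G x * ip d c x - g * (indicat_real G x * q x)) \<partial>?N)"
    by (rule ennreal_leI)
  also have "\<dots> \<le> (\<integral>\<^sup>+x. ennreal (exp m * ((1 + C - m) * indicat_real G x
        + indicat_real G x * ip d c x - g * (indicat_real G x * q x))) \<partial>?N)"
    using ind_int indlin_int indq_int by (intro integral_le_nn_integral) simp
  also have "\<dots> \<le> (\<integral>\<^sup>+x. indicator {x. a * vnorm d (mv d J x) \<le> \<rho>} (vadd d x v) *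
          ennreal (exp (a * ip d (vadd d x v) s - g * q (vadd d x v)))
          * ennreal (exp (- (ip d v x / 1\<^sup>2) - ip d v v / (2 * 1\<^sup>2))) \<partial>?N)"
  proof (intro nn_integral_mono)
    fix x
    show "ennreal (exp m * ((1 + C - m) * indicat_real G x
        + indicat_real G x * ip d c x - g * (indicat_real G x * q x)))
        \<le> indicator {x. a * vnorm d (mv d J x) \<le> \<rho>} (vadd d x v) *
          ennreal (exp (a * ip d (vadd d x v) s - g * q (vadd d x v)))
          * ennreal (exp (- (ip d v x / 1\<^sup>2) - ip d v v / (2 * 1\<^sup>2)))"
    proof (cases "x \<in> G")
      case True
      have mvadd: "mv d J (vadd d x v) = (\<lambda>i. mv d J x i + mv d J v i)"
        by (subst mv_add[symmetric], rule mv_cong) (simp add: vadd_def)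
      have ipadd: "ip d (vadd d x v) y = ip d x y + ip d v y" for y
        by (subst ip_add_left[symmetric], rule ip_cong) (simp_all add: vadd_def)
      have "vnorm d (mv d J (vadd d x v)) \<le> vnorm d (mv d J x) + vnorm d (mv d J v)"
        unfolding mvadd by (rule vnorm_triangle)
      also have "\<dots> \<le> B + p * h"
        using True norm_le[of v] by (simp add: G_def v_norm)
      finally have "a * vnorm d (mv d J (vadd d x v)) \<le> a * (B + p * h)"
        using a by simp
      with \<rho> have dom: "a * vnorm d (mv d J (vadd d x v)) \<le> \<rho>"
        by (simp add: B_def algebra_simps)
      have cr: "ip d x (mv d J v) = ip d (mv d J v) x" "ip d v (mv d J x) = ip d (mv d J v) x"
        using mv_symmetric[OF sym, where x=v and y=x] by (simp_all add: ip_commute)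
      have qadd: "q (vadd d x v) = q x + q v + 2 * ip d (mv d J v) x"
        unfolding q_def mvadd ipadd ip_add_right by (simp add: cr)
      have cx: "ip d c x = a * ip d x s - 2 * g * ip d (mv d J v) x - ip d v x"
        unfolding c_def ip_diff_left ip_scale_left by (simp add: ip_commute[of d s x])
      have E: "(a * ip d (vadd d x v) s - g * q (vadd d x v)) + (- ip d v x - h\<^sup>2 / 2)
          = C + ip d c x - g * q x"
        unfolding qadd ipadd vs cx C_def by (simp add: algebra_simps)
      have "exp m * (1 + (C + ip d c x - g * q x - m)) \<le> exp m * exp (C + ip d c x - g * q x - m)"
        by (intro mult_left_mono exp_ge_add_one_self) simp
      also have "\<dots> = exp (C + ip d c x - g * q x)" by (simp flip: exp_add)
      also have "\<dots> = exp (a * ip d (vadd d x v) s - g * q (vadd d x v)) * exp (- ip d v x - h\<^sup>2 / 2)"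
        by (simp only: E flip: exp_add)
      finally show ?thesis
        using True dom by (simp add: vv algebra_simps flip: ennreal_mult)
    qed simp
  qed
  also have "\<dots> = (\<integral>\<^sup>+x. indicator {x. a * vnorm d (mv d J x) \<le> \<rho>} x *
          ennreal (exp (a * ip d x s - g * q x)) \<partial>?N)"
  proof (rule nn_integral_gaussN_shift[symmetric])
    have "{x \<in> space (Rd d). a * vnorm d (mv d J x) \<le> \<rho>} \<in> sets (Rd d)" by measurable
    then have [measurable]: "indicator {x. a * vnorm d (mv d J x) \<le> \<rho>} \<in> borel_measurable (Rd d)"
      by (simp add: borel_measurable_indicator_iff Int_def conj_commute)
    show "(\<lambda>x. indicator {x. a * vnorm d (mv d J x) \<le> \<rho>} x *
          ennreal (exp (a * ip d x s - g * q x))) \<in> borel_measurable (Rd d)"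
      by measurable
  qed
  finally have main: "ennreal (exp m / 2) \<le> (\<integral>\<^sup>+x. indicator {x. a * vnorm d (mv d J x) \<le> \<rho>} x *
          ennreal (exp (a * ip d x s - g * q x)) \<partial>?N)" .
  have "a * h * vnorm d s - h\<^sup>2 / 2 - g * (h\<^sup>2 * p + (1 + \<gamma>) * T) \<le> m"
    using mult_left_mono[OF qv g0] by (simp add: m_def C_def algebra_simps)
  then have "ennreal (exp (a * h * vnorm d s - h\<^sup>2 / 2 - g * (h\<^sup>2 * p + (1 + \<gamma>) * T)) / 2)
      \<le> ennreal (exp m / 2)"
    by (intro ennreal_leI) simp
  with main show ?thesis
    unfolding g_def q_def by (rule order_trans[rotated])
qed

text \<open>The mixture over directions has mean at most 1 on A, while
  \<open>gaussian_mixture_ge\<close> makes it at least exp(L0) on the bad event; Markov's inequality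
  concludes. No union over directions is taken, hence no dimension appears. A stands for a
  successful first stage.\<close>

lemma norm_concentration:
  fixes J :: "nat \<Rightarrow> nat \<Rightarrow> real" and S :: "'a \<Rightarrow> nat \<Rightarrow> real"
  assumes M: "prob_space M" and A [measurable]: "A \<in> sets M"
    and S [measurable]: "\<And>i. i < d \<Longrightarrow> (\<lambda>\<omega>. S \<omega> i) \<in> borel_measurable M"
    and sym: "\<And>i j. i < d \<Longrightarrow> j < d \<Longrightarrow> J i j = J j i"
    and nonneg: "\<And>x. 0 \<le> ip d x (mv d J x)"
    and norm_le: "\<And>x. vnorm d (mv d J x) \<le> p * vnorm d x"
    and T: "(\<Sum>i<d. J i i) = T" and F: "(\<Sum>i<d. \<Sum>j<d. (J i j)\<^sup>2) \<le> p * T"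
    and \<gamma>: "0 < \<gamma>" "\<gamma> \<le> 1" and p: "0 < p" and T0: "0 < T" and L0: "0 < L0"
    and mgf: "\<And>x. vnorm d (mv d J x) \<le> \<rho> \<Longrightarrow>
      (\<integral>\<^sup>+\<omega>. indicator A \<omega> * ennreal (exp (ip d x (S \<omega>))) \<partial>M)
        \<le> ennreal (exp ((1 + \<gamma>) / 2 * ip d x (mv d J x)))"
    and \<rho>: "(1 + sqrt (2 / \<gamma>)) * (sqrt (p * (ln 2 + L0)) + sqrt T) \<le> \<rho>"
  shows "measure M {\<omega> \<in> space M. \<omega> \<in> A \<and>
    (1 + 3 / 2 * \<gamma>) * sqrt T + 3 * sqrt (p * (ln 2 + L0)) < vnorm d (S \<omega>)} \<le> exp (- L0)"
proof -
  interpret prob_space M by (rule M)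
  interpret N: prob_space "gaussN d 1" by (rule prob_space_gaussN) simp
  interpret NM: pair_sigma_finite "gaussN d 1" M ..
  \<comment> \<open>The additional ln 2 pays for the factor 1/2 lost in the mixture bound.\<close>
  define L where "L = ln 2 + L0"
  have L: "0 < L" using L0 by (simp add: L_def add_pos_pos)
  \<comment> \<open>lam is tuned so that lam^2 p = L. With the product \<open>a * h = lam\<close>
    fixed, a balances the costs h^2 and a^2 T: both equal lam sqrt(T), and their halves add up to
    sqrt(T) with leading constant 1.\<close>
  define lam where "lam = sqrt (L / p)"
  define a where "a = sqrt (lam / sqrt T)"
  define h where "h = lam / a"
  have lam: "0 < lam" and a: "0 < a" using L p T0 by (simp_all add: lam_def a_def)
  have h: "0 < h" and ah: "a * h = lam" using lam a by (simp_all add: h_def)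
  have a2: "a\<^sup>2 = lam / sqrt T" using lam T0 by (simp add: a_def)
  have h2: "h\<^sup>2 = lam * sqrt T" using a2 lam T0 by (simp add: h_def power_divide power2_eq_square)
  have lam2: "lam\<^sup>2 * p = L" using L p by (simp add: lam_def)
  have lamp: "lam * p = sqrt (p * L)"
    by (metis lam2 lam p less_imp_le mult.commute mult.left_commute power2_eq_square
      real_sqrt_unique mult_nonneg_nonneg)
  have dom: "a * (h * p + sqrt (2 * p * T / \<gamma>)) \<le> \<rho>"
  proof -
    let ?x = "sqrt (p * L)" and ?y = "sqrt T"
    have xy: "0 \<le> ?x" "0 \<le> ?y" using p L T0 by simp_all
    have "a * sqrt (2 * p * T / \<gamma>) = sqrt (lam / sqrt T * (2 * p * T / \<gamma>))"
      unfolding a_def real_sqrt_mult ..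
    also have "lam / sqrt T * (2 * p * T / \<gamma>) = 2 / \<gamma> * (?x * ?y)"
    proof -
      have "lam / sqrt T * (2 * p * T / \<gamma>) = 2 / \<gamma> * (lam * p * (T / sqrt T))"
        by (simp add: mult_ac)
      also have "T / sqrt T = sqrt T" using T0 by (simp add: real_div_sqrt)
      finally show ?thesis unfolding lamp[symmetric] .
    qed
    also have "sqrt (2 / \<gamma> * (?x * ?y)) = sqrt (2 / \<gamma>) * sqrt (?x * ?y)"
      by (rule real_sqrt_mult)
    also have "sqrt (?x * ?y) \<le> ?x + ?y"
    proof (rule real_le_lsqrt)
      show "?x * ?y \<le> (?x + ?y)\<^sup>2"
        unfolding power2_sum
        using mult_nonneg_nonneg[OF xy] zero_le_power2[of ?x] zero_le_power2[of ?y] by linarith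
    qed (use xy in auto)
    finally have 1: "a * sqrt (2 * p * T / \<gamma>) \<le> sqrt (2 / \<gamma>) * (?x + ?y)"
      using \<gamma> by (simp add: mult_left_mono)
    have "a * (h * p + sqrt (2 * p * T / \<gamma>)) = ?x + a * sqrt (2 * p * T / \<gamma>)"
      using ah lamp by (simp add: distrib_left flip: mult.assoc)
    also have "\<dots> \<le> (1 + sqrt (2 / \<gamma>)) * (?x + ?y)"
      using add_mono[OF _ 1, of ?x "?x + ?y"] xy by (simp only: distrib_right[of 1] mult_1)
    also have "\<dots> \<le> \<rho>" using \<rho> by (simp add: L_def)
    finally show ?thesis .
  qed
  define \<Phi> where "\<Phi> x \<omega> = indicator {x. a * vnorm d (mv d J x) \<le> \<rho>} x *
      ennreal (exp (a * ip d x (S \<omega>) - (1 + \<gamma>) / 2 * a\<^sup>2 * ip d x (mv d J x)))" for x \<omega>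
  have "{x \<in> space (Rd d). a * vnorm d (mv d J x) \<le> \<rho>} \<in> sets (Rd d)" by measurable
  then have ind_meas [measurable]: "indicator {x. a * vnorm d (mv d J x) \<le> \<rho>} \<in> borel_measurable (Rd d)"
    by (simp add: borel_measurable_indicator_iff Int_def conj_commute)
  have Smeas [measurable]: "(\<lambda>q. S (snd q) i) \<in> borel_measurable (gaussN d 1 \<Otimes>\<^sub>M M)" if "i < d" for i
    using that by measurable
  have \<Phi>_meas [measurable]: "(\<lambda>(x, \<omega>). indicator A \<omega> * \<Phi> x \<omega>) \<in> borel_measurable (gaussN d 1 \<Otimes>\<^sub>M M)"
    unfolding \<Phi>_def by measurable
  have up: "(\<integral>\<^sup>+\<omega>. indicator A \<omega> * \<Phi> x \<omega> \<partial>M) \<le> 1" for x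
  proof (cases "a * vnorm d (mv d J x) \<le> \<rho>")
    case True
    have q: "ip d (\<lambda>i. a * x i) (mv d J (\<lambda>i. a * x i)) = a\<^sup>2 * ip d x (mv d J x)"
      by (simp add: mv_scale ip_linear power2_eq_square)
    have "(\<integral>\<^sup>+\<omega>. indicator A \<omega> * \<Phi> x \<omega> \<partial>M)
        = (\<integral>\<^sup>+\<omega>. ennreal (exp (- ((1 + \<gamma>) / 2 * a\<^sup>2 * ip d x (mv d J x)))) *
            (indicator A \<omega> * ennreal (exp (ip d (\<lambda>i. a * x i) (S \<omega>)))) \<partial>M)"
      using True by (intro nn_integral_cong)
        (simp add: \<Phi>_def ip_scale_left mult.left_commute flip: ennreal_mult exp_add)
    also have "\<dots> = ennreal (exp (- ((1 + \<gamma>) / 2 * a\<^sup>2 * ip d x (mv d J x)))) *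
        (\<integral>\<^sup>+\<omega>. indicator A \<omega> * ennreal (exp (ip d (\<lambda>i. a * x i) (S \<omega>))) \<partial>M)"
      by (rule nn_integral_cmult) measurable
    also have "\<dots> \<le> ennreal (exp (- ((1 + \<gamma>) / 2 * a\<^sup>2 * ip d x (mv d J x)))) *
        ennreal (exp ((1 + \<gamma>) / 2 * ip d (\<lambda>i. a * x i) (mv d J (\<lambda>i. a * x i))))"
      using True a by (intro mult_left_mono mgf) (auto simp: mv_scale vnorm_scale)
    also have "\<dots> = 1"
      by (simp add: q mult.assoc flip: ennreal_mult exp_add)
    finally show ?thesis .
  qed (simp add: \<Phi>_def)
  define b where "b = (1 + 3 / 2 * \<gamma>) * sqrt T + 3 * sqrt (p * (ln 2 + L0))"
  define Bad where "Bad = {\<omega> \<in> space M. \<omega> \<in> A \<and> b < vnorm d (S \<omega>)}"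
  have [measurable]: "Bad \<in> sets M" unfolding Bad_def by measurable
  have b0: "0 \<le> b" using \<gamma> p L T0 by (simp add: b_def L_def)
  have low: "ennreal (exp L0) * indicator Bad \<omega> \<le> (\<integral>\<^sup>+x. indicator A \<omega> * \<Phi> x \<omega> \<partial>gaussN d 1)"
    if "\<omega> \<in> space M" for \<omega>
  proof (cases "\<omega> \<in> Bad")
    case True
    then have bS: "b < vnorm d (S \<omega>)" and A\<omega>: "\<omega> \<in> A" by (auto simp: Bad_def)
    let ?m = "a * h * vnorm d (S \<omega>) - h\<^sup>2 / 2 - (1 + \<gamma>) / 2 * a\<^sup>2 * (h\<^sup>2 * p + (1 + \<gamma>) * T)"
    have "L \<le> ?m"
    proof -
      have "lam * b \<le> lam * vnorm d (S \<omega>)" using bS lam by simp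
      moreover have "lam * b = (1 + 3 / 2 * \<gamma>) * (lam * sqrt T) + 3 * L"
      proof -
        have "lam * sqrt (p * (ln 2 + L0)) = L"
          using lam2 lamp by (simp add: L_def power2_eq_square mult.assoc)
        then show ?thesis by (simp add: b_def distrib_left mult_ac)
      qed
      moreover have "a\<^sup>2 * (h\<^sup>2 * p + (1 + \<gamma>) * T) = L + (1 + \<gamma>) * (lam * sqrt T)"
      proof -
        have "a\<^sup>2 * (h\<^sup>2 * p) = (a * h)\<^sup>2 * p" by (simp add: power_mult_distrib)
        moreover have "a\<^sup>2 * T = lam * sqrt T"
          unfolding a2 using T0 by (simp add: field_simps)
        ultimately show ?thesis by (simp add: ah lam2 distrib_left mult.left_commute)
      qed
      moreover have "(1 + \<gamma>) / 2 * L \<le> L" using \<gamma> L by simp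
      \<comment> \<open>With the 1/2 coming from h^2 this uses up exactly the coefficient 1 +
        3\<gamma>/2 of sqrt(T).\<close>
      moreover have "(1 + \<gamma>) / 2 * ((1 + \<gamma>) * (lam * sqrt T)) \<le> (1 / 2 + 3 / 2 * \<gamma>) * (lam * sqrt T)"
      proof -
        have "(1 + \<gamma>) / 2 * (1 + \<gamma>) \<le> 1 / 2 + 3 / 2 * \<gamma>"
          using \<gamma> mult_left_mono[of \<gamma> 1 \<gamma>] by (simp add: algebra_simps)
        then show ?thesis using lam T0 unfolding mult.assoc[symmetric]
          by (intro mult_right_mono) auto
      qed
      ultimately have "L \<le> lam * vnorm d (S \<omega>) - lam * sqrt T / 2
          - (1 + \<gamma>) / 2 * (a\<^sup>2 * (h\<^sup>2 * p + (1 + \<gamma>) * T))"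
        using L by (simp only: distrib_left[of "(1 + \<gamma>) / 2"] distrib_right[of 1] distrib_right[of "1 / 2"])
      then show ?thesis
        unfolding h2 ah by (simp only: mult.assoc)
    qed
    then have "exp L \<le> exp ?m" by simp
    moreover have "exp L0 = exp L / 2" by (simp add: L_def exp_add)
    ultimately have "ennreal (exp L0) \<le> ennreal (exp ?m / 2)"
      by (intro ennreal_leI) linarith
    also have "\<dots> \<le> (\<integral>\<^sup>+x. \<Phi> x \<omega> \<partial>gaussN d 1)"
      unfolding \<Phi>_def
      by (rule gaussian_mixture_ge[OF sym nonneg norm_le T F \<gamma> p T0 a h _ dom]) (use bS b0 in auto)
    finally show ?thesis using True A\<omega> by simp
  qed simp
  have "ennreal (exp L0) * emeasure M Bad = (\<integral>\<^sup>+\<omega>. ennreal (exp L0) * indicator Bad \<omega> \<partial>M)"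
    by (simp add: nn_integral_cmult)
  also have "\<dots> \<le> (\<integral>\<^sup>+\<omega>. \<integral>\<^sup>+x. indicator A \<omega> * \<Phi> x \<omega> \<partial>gaussN d 1 \<partial>M)"
    by (intro nn_integral_mono low)
  also have "\<dots> = (\<integral>\<^sup>+x. \<integral>\<^sup>+\<omega>. indicator A \<omega> * \<Phi> x \<omega> \<partial>M \<partial>gaussN d 1)"
    by (rule NM.Fubini') measurable
  also have "\<dots> \<le> (\<integral>\<^sup>+x. 1 \<partial>gaussN d 1)"
    by (intro nn_integral_mono up)
  also have "\<dots> = ennreal 1" using N.emeasure_space_1 by simp
  finally have "exp L0 * measure M Bad \<le> 1"
    by (simp add: emeasure_eq_measure flip: ennreal_mult)
  then show ?thesis
    unfolding Bad_def b_def by (simp add: exp_minus field_simps)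
qed

section \<open>Operator norms and the inverse information matrix\<close>

definition ent :: "real mat \<Rightarrow> nat \<Rightarrow> nat \<Rightarrow> real" where
  "ent A i j = A $$ (i, j)"

lemma mat_app_eq_mv:
  assumes "A \<in> carrier_mat d d" "i < d"
  shows "mat_app A x i = mv d (ent A) x i"
  using assms by (auto simp: mat_app_def mv_def ent_def scalar_prod_def lessThan_atLeast0 intro!: sum.cong)

lemma vnorm_mat_app:
  assumes "A \<in> carrier_mat d d"
  shows "vnorm d (mat_app A x) = vnorm d (mv d (ent A) x)"
  by (rule vnorm_cong) (rule mat_app_eq_mv[OF assms])

text \<open>Frobenius bound, row by row. It shows that \<open>op_norm\<close> is the supremum of a
  bounded set, without which \<open>SUP\<close> would carry no information.\<close>

lemma vnorm_mv_le: "vnorm d (mv d J x) \<le> sqrt (\<Sum>i<d. ip d (J i) (J i)) * vnorm d x"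
proof -
  have "ip d (mv d J x) (mv d J x) = (\<Sum>i<d. (ip d (J i) x)\<^sup>2)"
    by (simp add: ip_def mv_def power2_eq_square)
  also have "\<dots> \<le> (\<Sum>i<d. ip d (J i) (J i) * ip d x x)"
    by (intro sum_mono ip_sq_le)
  finally show ?thesis
    by (simp add: vnorm_eq_sqrt flip: real_sqrt_mult sum_distrib_right)
qed

lemma op_norm_eq:
  assumes "A \<in> carrier_mat d d"
  shows "op_norm A = (SUP x\<in>{x. vnorm d x \<le> 1}. vnorm d (mv d (ent A) x))"
  using assms by (auto simp: op_norm_def vnorm_mat_app[OF assms])

lemma bdd_op_norm: "bdd_above ((\<lambda>x. vnorm d (mv d J x)) ` {x. vnorm d x \<le> 1})"
proof (rule bdd_aboveI2)
  fix x assume "x \<in> {x. vnorm d x \<le> 1}"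
  then have "sqrt (\<Sum>i<d. ip d (J i) (J i)) * vnorm d x \<le> sqrt (\<Sum>i<d. ip d (J i) (J i)) * 1"
    by (intro mult_left_mono) (auto intro: sum_nonneg)
  with vnorm_mv_le[of d J x] show "vnorm d (mv d J x) \<le> sqrt (\<Sum>i<d. ip d (J i) (J i))"
    by simp
qed

lemma vnorm_mv_le_op_norm:
  assumes A: "A \<in> carrier_mat d d"
  shows "vnorm d (mv d (ent A) x) \<le> op_norm A * vnorm d x"
proof (cases "vnorm d x = 0")
  case True
  then have "mv d (ent A) x = (\<lambda>_. 0)" by (simp add: vnorm_zero_iff mv_def)
  with True show ?thesis by (simp add: vnorm_def L2_set_def)
next
  case False
  then have x: "0 < vnorm d x" using vnorm_nonneg[of d x] by linarith
  define u where "u = (\<lambda>i. 1 / vnorm d x * x i)"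
  have "vnorm d u = 1"
    unfolding u_def vnorm_scale using x by simp
  then have "vnorm d (mv d (ent A) u) \<le> op_norm A"
    unfolding op_norm_eq[OF A] by (intro cSUP_upper bdd_op_norm) simp
  moreover have "vnorm d (mv d (ent A) u) = vnorm d (mv d (ent A) x) / vnorm d x"
    unfolding u_def mv_scale vnorm_scale using x by simp
  ultimately show ?thesis
    using x by (simp add: pos_divide_le_eq)
qed

lemma op_norm_le:
  assumes A: "A \<in> carrier_mat d d" and "0 \<le> c" and "\<And>x. vnorm d (mv d (ent A) x) \<le> c * vnorm d x"
  shows "op_norm A \<le> c"
  unfolding op_norm_eq[OF A]
proof (rule cSUP_least)
  have "vnorm d (\<lambda>_. 0) \<le> 1" by (simp add: vnorm_def L2_set_def)
  then show "{x. vnorm d x \<le> 1} \<noteq> {}" by blast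
  fix x assume "x \<in> {x. vnorm d x \<le> 1}"
  then have "c * vnorm d x \<le> c * 1" using assms(2) by (intro mult_left_mono) auto
  with assms(3)[of x] show "vnorm d (mv d (ent A) x) \<le> c" by simp
qed

definition unit_vec_fun :: "nat \<Rightarrow> nat \<Rightarrow> real" where
  "unit_vec_fun i = (\<lambda>j. if j = i then 1 else 0)"

lemma ip_unit [simp]: "i < d \<Longrightarrow> ip d (unit_vec_fun i) x = x i" "i < d \<Longrightarrow> ip d x (unit_vec_fun i) = x i"
  by (simp_all add: ip_def unit_vec_fun_def if_distrib[of "\<lambda>x. x * _"] if_distrib[of "\<lambda>x. _ * x"] cong: if_cong)

lemma mv_unit [simp]: "i < d \<Longrightarrow> mv d J (unit_vec_fun i) k = J k i"
  by (simp add: mv_def unit_vec_fun_def if_distrib[of "\<lambda>x. _ * x"] cong: if_cong)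

section \<open>Quadratic forms of the Fisher and covariance matrices, and the inverse of the
  former\<close>

context smoothing
begin

abbreviation "Fi \<equiv> fisher d f (r\<^sup>2 \<cdot>\<^sub>m 1\<^sub>m d)"
abbreviation "Ji \<equiv> mat_inv Fi"
abbreviation "jm \<equiv> ent Ji"

lemma fisher_carrier [simp]: "Fi \<in> carrier_mat d d"
  by (simp add: fisher_def)

lemma fisher_dim [simp]: "dim_row Fi = d" "dim_col Fi = d"
  by (simp_all add: fisher_def)

lemma cov_carrier [simp]: "cov_mat d f \<in> carrier_mat d d"
  by (simp add: cov_mat_def)

lemma fisher_form: "(\<integral>x. ip d v (sc x) * ip d w (sc x) \<partial>sm) = ip d v (mv d (ent Fi) w)"
proof -
  have int: "integrable sm (\<lambda>x. sc x i * sc x j)" if "i < d" "j < d" for i j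
    using integrable_score_prod[of "unit_vec_fun i" "unit_vec_fun j"] that by simp
  have "(\<integral>x. ip d v (sc x) * ip d w (sc x) \<partial>sm)
      = (\<integral>x. (\<Sum>i<d. \<Sum>j<d. v i * w j * (sc x i * sc x j)) \<partial>sm)"
    by (intro Bochner_Integration.integral_cong refl) (simp add: ip_def sum_product mult_ac)
  also have "\<dots> = (\<Sum>i<d. \<Sum>j<d. v i * w j * (\<integral>x. sc x i * sc x j \<partial>sm))"
    by (intro integral_double_sum int)
  also have "\<dots> = ip d v (mv d (ent Fi) w)"
    by (simp add: ip_def mv_def ent_def fisher_def sum_distrib_left mult_ac)
  finally show ?thesis .
qed

lemma info_form: "info w = ip d w (mv d (ent Fi) w)"
  using fisher_form[of w w] by (simp add: info_def power2_eq_square)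

lemma cov_form:
  "(\<integral>y. (ip d v (vsub d y (mean_vec d f)))\<^sup>2 \<partial>f) = ip d v (mv d (ent (cov_mat d f)) v)"
proof -
  define m where "m = mean_vec d f"
  have sq: "integrable f (\<lambda>y. (y i - m i)\<^sup>2)" if "i < d" for i
    using integrable_centered_sq[of "unit_vec_fun i"] that by (simp add: vsub_def m_def)
  have int: "integrable f (\<lambda>y. (y i - m i) * (y j - m j))" if "i < d" "j < d" for i j
    using that by (intro Cauchy_Schwarz_integral sq) auto
  have "(\<integral>y. (ip d v (vsub d y m))\<^sup>2 \<partial>f)
      = (\<integral>y. (\<Sum>i<d. \<Sum>j<d. v i * v j * ((y i - m i) * (y j - m j))) \<partial>f)"
    by (intro Bochner_Integration.integral_cong refl)
      (simp add: ip_def vsub_def sum_product power2_eq_square mult_ac)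
  also have "\<dots> = (\<Sum>i<d. \<Sum>j<d. v i * v j * (\<integral>y. (y i - m i) * (y j - m j) \<partial>f))"
    by (intro integral_double_sum int)
  also have "\<dots> = ip d v (mv d (ent (cov_mat d f)) v)"
    by (simp add: ip_def mv_def ent_def cov_mat_def m_def sum_distrib_left mult_ac)
  finally show ?thesis by (simp add: m_def)
qed

lemma cov_form_le: "(\<integral>y. (ip d v (vsub d y (mean_vec d f)))\<^sup>2 \<partial>f) \<le> op_norm (cov_mat d f) * ip d v v"
proof -
  have "ip d v (mv d (ent (cov_mat d f)) v) \<le> vnorm d v * vnorm d (mv d (ent (cov_mat d f)) v)"
    using abs_ip_le[of d v "mv d (ent (cov_mat d f)) v"] by linarith
  also have "\<dots> \<le> vnorm d v * (op_norm (cov_mat d f) * vnorm d v)"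
    by (intro mult_left_mono vnorm_mv_le_op_norm) auto
  also have "\<dots> = op_norm (cov_mat d f) * ip d v v"
    by (simp add: power2_eq_square flip: vnorm_sq)
  finally show ?thesis by (simp add: cov_form)
qed

end

text \<open>The lower bound on the information is the covariance inequality in abstract form,
  instantiated at the end with V equal to four times the norm of \<Sigma>. It gives invertibility of
  the Fisher matrix and control of the norm of J.\<close>

locale regular_smoothing = smoothing +
  fixes V :: real
  assumes V_pos: "0 < V" and d_pos: "0 < d"
    and info_lower: "\<And>w. ip d w w \<le> V * info w"
begin

text \<open>A kernel vector of the Fisher matrix would carry zero information, which the lower bound
  forbids.\<close>

lemma inverse_exists: "Fi * Ji = 1\<^sub>m d" "Ji \<in> carrier_mat d d"
proof -
  have "Determinant.det Fi \<noteq> 0"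
  proof
    assume "Determinant.det Fi = 0"
    then obtain v where v: "v \<in> carrier_vec d" "v \<noteq> 0\<^sub>v d" "Fi *\<^sub>v v = 0\<^sub>v d"
      using det_0_iff_vec_prod_zero[OF fisher_carrier] by blast
    define w where "w i = vec_index v i" for i
    have "mv d (ent Fi) w i = 0" if "i < d" for i
    proof -
      have "vec_index (Fi *\<^sub>v v) i = 0" using v(3) that by simp
      moreover have "vec_index (Fi *\<^sub>v v) i = mv d (ent Fi) w i"
        using that v(1) fisher_carrier
        by (auto simp: mv_def ent_def w_def scalar_prod_def lessThan_atLeast0 intro!: sum.cong)
      ultimately show ?thesis by simp
    qed
    then have "info w = 0" by (simp add: info_form ip_def)
    with info_lower[of w] have "ip d w w \<le> 0" by simp
    then have "vnorm d w = 0" by (simp add: vnorm_eq_sqrt order_antisym)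
    then have "v = 0\<^sub>v d"
      using v(1) by (intro eq_vecI) (auto simp: vnorm_zero_iff w_def)
    with v(2) show False by simp
  qed
  then have U: "Fi \<in> Units (ring_mat TYPE(real) d ())"
    by (rule det_non_zero_imp_unit[OF fisher_carrier])
  then obtain B where B: "mat_inverse Fi = Some B"
    using mat_inverse(1)[OF fisher_carrier, of "()"] by (cases "mat_inverse Fi") auto
  show "Fi * Ji = 1\<^sub>m d" "Ji \<in> carrier_mat d d"
    using mat_inverse(2)[OF fisher_carrier B] by (auto simp: mat_inv_def B)
qed

lemma fisher_inverse: "i < d \<Longrightarrow> mv d (ent Fi) (mv d jm x) i = x i"
proof -
  assume i: "i < d"
  have "(\<Sum>k<d. ent Fi i k * jm k j) = (if i = j then 1 else 0)" if "j < d" for j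
  proof -
    have "(Fi * Ji) $$ (i, j) = (\<Sum>k<d. ent Fi i k * jm k j)"
      using i that carrier_matD[OF inverse_exists(2)]
      by (auto simp: ent_def scalar_prod_def lessThan_atLeast0 intro!: sum.cong)
    then show ?thesis using i that by (simp add: inverse_exists)
  qed
  note * = this
  have "mv d (ent Fi) (mv d jm x) i = (\<Sum>k<d. \<Sum>j<d. ent Fi i k * jm k j * x j)"
    by (simp add: mv_def sum_distrib_left mult.assoc)
  also have "\<dots> = (\<Sum>j<d. (\<Sum>k<d. ent Fi i k * jm k j) * x j)"
    by (subst sum.swap) (simp add: sum_distrib_right)
  also have "\<dots> = (\<Sum>j<d. if i = j then x j else 0)"
    by (intro sum.cong refl) (simp add: *)
  also have "\<dots> = x i" using i by simp
  finally show ?thesis .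
qed

text \<open>Properties of J are read off from this identity. With w replaced by Jw it exhibits J as
  a Gram matrix of square-integrable functions, whence symmetry, positivity and Cauchy-Schwarz for
  its form.\<close>

lemma score_inverse: "(\<integral>x. ip d (mv d jm v) (sc x) * ip d w (sc x) \<partial>sm) = ip d v w"
proof -
  have "(\<integral>x. ip d (mv d jm v) (sc x) * ip d w (sc x) \<partial>sm) = ip d w (mv d (ent Fi) (mv d jm v))"
    using fisher_form[of w "mv d jm v"] by (simp add: mult.commute)
  also have "\<dots> = ip d w v"
    by (rule ip_cong) (auto simp: fisher_inverse)
  finally show ?thesis by (simp add: ip_commute)
qed

lemma jm_form: "(\<integral>x. ip d (mv d jm v) (sc x) * ip d (mv d jm w) (sc x) \<partial>sm) = ip d v (mv d jm w)"
  by (rule score_inverse)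

lemma jm_info: "ip d v (mv d jm v) = info (mv d jm v)"
  unfolding info_def jm_form[symmetric] by (simp add: power2_eq_square)

lemma jm_nonneg: "0 \<le> ip d v (mv d jm v)"
  by (simp add: jm_info)

lemma jm_sym:
  assumes "i < d" "j < d"
  shows "jm i j = jm j i"
proof -
  have "ip d (unit_vec_fun i) (mv d jm (unit_vec_fun j)) = ip d (unit_vec_fun j) (mv d jm (unit_vec_fun i))"
    unfolding jm_form[symmetric] by (simp add: mult.commute)
  then show ?thesis using assms by simp
qed

abbreviation "p \<equiv> op_norm Ji"
abbreviation "T \<equiv> mat_trace Ji"

lemma jm_norm_le: "vnorm d (mv d jm x) \<le> p * vnorm d x"
  by (rule vnorm_mv_le_op_norm) (rule inverse_exists)

text \<open>From |Jx|^2 <= V info(Jx) = V x.Jx <= V |x| |Jx|, dividing by |Jx|.\<close>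

lemma p_le: "p \<le> V"
proof (rule op_norm_le[OF inverse_exists(2)])
  fix x
  have "vnorm d (mv d jm x) * vnorm d (mv d jm x) \<le> V * info (mv d jm x)"
    using info_lower[of "mv d jm x"] by (simp add: power2_eq_square flip: vnorm_sq)
  also have "\<dots> \<le> V * (vnorm d x * vnorm d (mv d jm x))"
    using abs_ip_le[of d x "mv d jm x"] V_pos by (intro mult_left_mono) (auto simp flip: jm_info)
  finally have *: "vnorm d (mv d jm x) * vnorm d (mv d jm x) \<le> vnorm d (mv d jm x) * (V * vnorm d x)"
    by (simp add: mult_ac)
  show "vnorm d (mv d jm x) \<le> V * vnorm d x"
  proof (cases "vnorm d (mv d jm x) = 0")
    case False
    then have "0 < vnorm d (mv d jm x)" using vnorm_nonneg[of d "mv d jm x"] by linarith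
    with * show ?thesis using mult_le_cancel_left_pos by blast
  qed (use V_pos in simp)
qed (use V_pos in simp)

lemma jm_unit_nonzero: "i < d \<Longrightarrow> 0 < vnorm d (mv d jm (unit_vec_fun i))"
proof (rule ccontr)
  assume i: "i < d" and "\<not> 0 < vnorm d (mv d jm (unit_vec_fun i))"
  then have "vnorm d (mv d jm (unit_vec_fun i)) = 0"
    using vnorm_nonneg[of d "mv d jm (unit_vec_fun i)"] by linarith
  then have "mv d (ent Fi) (mv d jm (unit_vec_fun i)) i = 0"
    by (subst mv_def) (simp add: vnorm_zero_iff)
  then show False
    using fisher_inverse[OF i, of "unit_vec_fun i"] by (simp add: unit_vec_fun_def)
qed

lemma vnorm_unit: "i < d \<Longrightarrow> vnorm d (unit_vec_fun i) = 1"
  by (simp add: vnorm_eq_sqrt) (simp add: unit_vec_fun_def)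

lemma p_pos: "0 < p"
  using jm_unit_nonzero[OF d_pos] jm_norm_le[of "unit_vec_fun 0"] d_pos by (simp add: vnorm_unit)

lemma jm_form_le: "ip d x (mv d jm x) \<le> p * ip d x x"
proof -
  have "ip d x (mv d jm x) \<le> vnorm d x * vnorm d (mv d jm x)"
    using abs_ip_le[of d x "mv d jm x"] by linarith
  also have "\<dots> \<le> vnorm d x * (p * vnorm d x)"
    by (intro mult_left_mono jm_norm_le) simp
  also have "\<dots> = p * ip d x x"
    by (simp add: power2_eq_square flip: vnorm_sq)
  finally show ?thesis .
qed

text \<open>The matrix inequality J^2 <= p J. With y = Jx, Cauchy-Schwarz for the form of J gives
  |y|^2 = x.Jy <= sqrt(x.Jx) sqrt(y.Jy), and y.Jy <= p |y|^2.\<close>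

lemma jm_norm_sq_le: "ip d (mv d jm x) (mv d jm x) \<le> p * ip d x (mv d jm x)"
proof -
  define y where "y = mv d jm x"
  have "ip d y y = ip d x (mv d jm y)"
    unfolding y_def by (rule mv_symmetric[symmetric]) (rule jm_sym)
  also have "\<dots> \<le> sqrt (ip d x y) * sqrt (ip d y (mv d jm y))"
  proof -
    have "ip d x (mv d jm y) \<le> \<bar>\<integral>u. ip d (mv d jm x) (sc u) * ip d (mv d jm y) (sc u) \<partial>sm\<bar>"
      unfolding jm_form by simp
    also have "\<dots> \<le> sqrt (info (mv d jm x)) * sqrt (info (mv d jm y))"
      unfolding info_def
      by (rule Cauchy_Schwarz_integral) (auto intro: integrable_score_sq)
    finally show ?thesis by (simp add: y_def flip: jm_info)
  qed
  also have "\<dots> \<le> sqrt (ip d x y) * sqrt (p * ip d y y)"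
    using jm_nonneg[of x] by (intro mult_left_mono real_sqrt_le_mono jm_form_le) (simp add: y_def)
  finally have "ip d y y \<le> sqrt (ip d x y * p) * sqrt (ip d y y)"
    by (simp add: real_sqrt_mult mult_ac)
  then have *: "sqrt (ip d y y) * sqrt (ip d y y) \<le> sqrt (ip d y y) * sqrt (ip d x y * p)"
    by (simp add: mult.commute)
  have 0: "0 \<le> ip d x y * p" using jm_nonneg[of x] p_pos by (simp add: y_def)
  show ?thesis
  proof (cases "ip d y y = 0")
    case False
    with ip_self_nonneg[of d y] have "0 < sqrt (ip d y y)" by (simp add: less_le)
    with * have "sqrt (ip d y y) \<le> sqrt (ip d x y * p)"
      using mult_le_cancel_left_pos by blast
    then show ?thesis by (simp add: y_def mult.commute)
  qed (use 0 in \<open>simp add: y_def mult.commute\<close>)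
qed

lemma trace_eq: "(\<Sum>i<d. jm i i) = T"
  using inverse_exists(2) by (auto simp: mat_trace_def ent_def)

text \<open>The inequality J^2 <= p J, tested on unit vectors and summed. It controls the truncation
  of the Gaussian mixture.\<close>

lemma frobenius_le: "(\<Sum>i<d. \<Sum>j<d. (jm i j)\<^sup>2) \<le> p * T"
proof -
  have "(\<Sum>j<d. (jm i j)\<^sup>2) \<le> p * jm i i" if "i < d" for i
  proof -
    have "(\<Sum>j<d. (jm i j)\<^sup>2) = ip d (mv d jm (unit_vec_fun i)) (mv d jm (unit_vec_fun i))"
      using that by (auto simp: ip_def power2_eq_square[of "jm _ _"] jm_sym[OF that] intro!: sum.cong)
    also have "\<dots> \<le> p * ip d (unit_vec_fun i) (mv d jm (unit_vec_fun i))"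
      by (rule jm_norm_sq_le)
    finally show ?thesis using that by simp
  qed
  then have "(\<Sum>i<d. \<Sum>j<d. (jm i j)\<^sup>2) \<le> (\<Sum>i<d. p * jm i i)"
    by (intro sum_mono) auto
  then show ?thesis by (simp add: trace_eq flip: sum_distrib_left)
qed

lemma trace_pos: "0 < T"
proof -
  have pos: "0 < jm i i" if "i < d" for i
  proof -
    have "0 < ip d (mv d jm (unit_vec_fun i)) (mv d jm (unit_vec_fun i))"
      using jm_unit_nonzero[OF that] by (simp add: vnorm_eq_sqrt)
    also have "\<dots> \<le> p * jm i i"
      using jm_norm_sq_le[of "unit_vec_fun i"] that by simp
    finally show ?thesis using p_pos by (simp add: zero_less_mult_iff)
  qed
  show ?thesis
    unfolding trace_eq[symmetric] using pos d_pos by (intro sum_pos) auto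
qed

lemma T_eq: "T = p * d_eff Ji"
  using p_pos by (simp add: d_eff_def)

end

section \<open>The two-stage estimator\<close>

text \<open>Fubini for the split sample: given the first stage a, the remaining pairs of sample and
  perturbation are independent, so the product integrates to a power. The dependence of G on a lets
  the random centre in.\<close>

lemma nn_integral_two_stage:
  fixes m n :: nat
  assumes D: "prob_space D" and K: "prob_space K" and mn: "m \<le> n"
    and \<phi> [measurable]: "\<phi> \<in> borel_measurable (PiM {..<m} (\<lambda>_. D))"
    and G [measurable]: "(\<lambda>(a, x, z). G a x z) \<in> borel_measurable (PiM {..<m} (\<lambda>_. D) \<Otimes>\<^sub>M D \<Otimes>\<^sub>M K)"
  shows "(\<integral>\<^sup>+\<omega>. \<phi> (restrict (fst \<omega>) {..<m}) *
        (\<Prod>k=m..<n. G (restrict (fst \<omega>) {..<m}) (fst \<omega> k) (snd \<omega> k))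
        \<partial>(PiM {..<n} (\<lambda>_. D) \<Otimes>\<^sub>M PiM {..<n} (\<lambda>_. K)))
    = (\<integral>\<^sup>+a. \<phi> a * (\<integral>\<^sup>+x. \<integral>\<^sup>+z. G a x z \<partial>K \<partial>D) ^ (n - m) \<partial>PiM {..<m} (\<lambda>_. D))"
proof -
  interpret D: prob_space D by (rule D)
  interpret K: prob_space K by (rule K)
  interpret PD: product_prob_space "\<lambda>_. D" "{..<n}" by standard
  interpret PK: product_prob_space "\<lambda>_. K" "{..<n}" by standard
  have sK: "sigma_finite_measure (PiM {..<n} (\<lambda>_. K))"
    by (intro prob_space_imp_sigma_finite prob_space_PiM K)
  have rest [measurable]: "(\<lambda>xs. restrict xs {..<m}) \<in> PiM {..<n} (\<lambda>_. D) \<rightarrow>\<^sub>M PiM {..<m} (\<lambda>_. D)"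
    using mn by (intro measurable_restrict_subset) auto
  have G' [measurable]: "(\<lambda>q. G (fst (fst q)) (snd (fst q)) (snd q))
      \<in> borel_measurable ((PiM {..<m} (\<lambda>_. D) \<Otimes>\<^sub>M D) \<Otimes>\<^sub>M K)"
    by (rule measurable_compose[where f="\<lambda>q. (fst (fst q), snd (fst q), snd q)", OF _ G, simplified])
      measurable
  define H where "H a x = (\<integral>\<^sup>+z. G a x z \<partial>K)" for a x
  have H [measurable]: "(\<lambda>(a, x). H a x) \<in> borel_measurable (PiM {..<m} (\<lambda>_. D) \<Otimes>\<^sub>M D)"
    unfolding H_def by measurable
  have comp [measurable]: "(\<lambda>\<omega>. fst \<omega> k) \<in> PiM {..<n} (\<lambda>_. D) \<Otimes>\<^sub>M PiM {..<n} (\<lambda>_. K) \<rightarrow>\<^sub>M D"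
    "(\<lambda>\<omega>. snd \<omega> k) \<in> PiM {..<n} (\<lambda>_. D) \<Otimes>\<^sub>M PiM {..<n} (\<lambda>_. K) \<rightarrow>\<^sub>M K" 
    "(\<lambda>xs. xs k) \<in> PiM {..<n} (\<lambda>_. D) \<rightarrow>\<^sub>M D" if "k \<in> {m..<n}" for k
    using that by (auto intro!: measurable_compose[OF measurable_fst]
      measurable_compose[OF measurable_snd] measurable_component_singleton)
  have G\<omega> [measurable]: "(\<lambda>\<omega>. G (restrict (fst \<omega>) {..<m}) (fst \<omega> k) (snd \<omega> k))
      \<in> borel_measurable (PiM {..<n} (\<lambda>_. D) \<Otimes>\<^sub>M PiM {..<n} (\<lambda>_. K))" if k: "k \<in> {m..<n}" for k
  proof -
    note [measurable] = comp(1,2)[OF k]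
    show ?thesis
      by (rule measurable_compose[where f="\<lambda>\<omega>. (restrict (fst \<omega>) {..<m}, fst \<omega> k, snd \<omega> k)", OF _ G, simplified])
        measurable
  qed
  have "(\<integral>\<^sup>+\<omega>. \<phi> (restrict (fst \<omega>) {..<m}) *
        (\<Prod>k=m..<n. G (restrict (fst \<omega>) {..<m}) (fst \<omega> k) (snd \<omega> k))
        \<partial>(PiM {..<n} (\<lambda>_. D) \<Otimes>\<^sub>M PiM {..<n} (\<lambda>_. K)))
    = (\<integral>\<^sup>+xs. \<integral>\<^sup>+zs. \<phi> (restrict xs {..<m}) *
        (\<Prod>k=m..<n. G (restrict xs {..<m}) (xs k) (zs k)) \<partial>PiM {..<n} (\<lambda>_. K) \<partial>PiM {..<n} (\<lambda>_. D))"
    by (subst sigma_finite_measure.nn_integral_fst[OF sK, symmetric])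
      (intro borel_measurable_times_ennreal borel_measurable_prod_ennreal G\<omega>, measurable, use mn in simp_all)
  also have "\<dots> = (\<integral>\<^sup>+xs. \<phi> (restrict xs {..<m}) * (\<Prod>k=m..<n. H (restrict xs {..<m}) (xs k)) \<partial>PiM {..<n} (\<lambda>_. D))"
  proof (rule nn_integral_cong)
    fix xs assume xs [measurable]: "xs \<in> space (PiM {..<n} (\<lambda>_. D))"
    have xa [measurable]: "restrict xs {..<m} \<in> space (PiM {..<m} (\<lambda>_. D))"
      by (rule measurable_space[OF rest xs])
    have xk [measurable]: "xs k \<in> space D" if "k \<in> {m..<n}" for k
      by (rule measurable_space[OF comp(3)[OF that] xs])
    \<comment> \<open>The perturbations of the first m samples receive the factor 1, so that the
      product runs over all coordinates of \<open>zs\<close>.\<close>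
    define g where "g k z = (if m \<le> k then G (restrict xs {..<m}) (xs k) z else 1)" for k z
    have Gk: "(\<lambda>z. G (restrict xs {..<m}) (xs k) z) \<in> borel_measurable K" if "k \<in> {m..<n}" for k
      using xk[OF that] by measurable
    then have gm: "g k \<in> borel_measurable K" if "k < n" for k
      using that by (cases "m \<le> k") (auto simp: g_def[abs_def])
    have split: "(\<Prod>k<n. if m \<le> k then F k else 1) = (\<Prod>k=m..<n. F k)" for F :: "nat \<Rightarrow> ennreal"
      by (rule prod.mono_neutral_cong_right) auto
    have "(\<integral>\<^sup>+zs. \<phi> (restrict xs {..<m}) * (\<Prod>k=m..<n. G (restrict xs {..<m}) (xs k) (zs k)) \<partial>PiM {..<n} (\<lambda>_. K))
      = \<phi> (restrict xs {..<m}) * (\<integral>\<^sup>+zs. (\<Prod>k=m..<n. G (restrict xs {..<m}) (xs k) (zs k)) \<partial>PiM {..<n} (\<lambda>_. K))"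
    proof (rule nn_integral_cmult, rule borel_measurable_prod_ennreal)
      fix k assume k: "k \<in> {m..<n}"
      show "(\<lambda>zs. G (restrict xs {..<m}) (xs k) (zs k)) \<in> borel_measurable (PiM {..<n} (\<lambda>_. K))"
        by (rule measurable_compose[OF _ Gk[OF k]]) (use k in auto)
    qed
    also have "(\<integral>\<^sup>+zs. (\<Prod>k=m..<n. G (restrict xs {..<m}) (xs k) (zs k)) \<partial>PiM {..<n} (\<lambda>_. K))
      = (\<integral>\<^sup>+zs. (\<Prod>k<n. g k (zs k)) \<partial>PiM {..<n} (\<lambda>_. K))"
      by (simp add: g_def split)
    also have "\<dots> = (\<Prod>k<n. integral\<^sup>N K (g k))"
      by (rule PK.product_nn_integral_prod) (auto intro: gm)
    also have "\<dots> = (\<Prod>k<n. if m \<le> k then H (restrict xs {..<m}) (xs k) else 1)"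
      by (intro prod.cong refl) (auto simp: g_def[abs_def] H_def K.emeasure_space_1)
    also have "\<dots> = (\<Prod>k=m..<n. H (restrict xs {..<m}) (xs k))"
      by (rule split)
    finally show "(\<integral>\<^sup>+zs. \<phi> (restrict xs {..<m}) * (\<Prod>k=m..<n. G (restrict xs {..<m}) (xs k) (zs k)) \<partial>PiM {..<n} (\<lambda>_. K))
      = \<phi> (restrict xs {..<m}) * (\<Prod>k=m..<n. H (restrict xs {..<m}) (xs k))" .
  qed
  also have "\<dots> = (\<integral>\<^sup>+a. \<integral>\<^sup>+b. \<phi> a * (\<Prod>k=m..<n. H a (b k)) \<partial>PiM {m..<n} (\<lambda>_. D) \<partial>PiM {..<m} (\<lambda>_. D))"
  proof -
    have I: "{..<m} \<union> {m..<n} = {..<n}" using mn by auto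
    let ?f = "\<lambda>xs. \<phi> (restrict xs {..<m}) * (\<Prod>k=m..<n. H (restrict xs {..<m}) (xs k))"
    have "?f \<in> borel_measurable (PiM {..<n} (\<lambda>_. D))" by measurable
    then have "(\<integral>\<^sup>+xs. ?f xs \<partial>PiM {..<n} (\<lambda>_. D))
        = (\<integral>\<^sup>+a. \<integral>\<^sup>+b. ?f (merge {..<m} {m..<n} (a, b)) \<partial>PiM {m..<n} (\<lambda>_. D) \<partial>PiM {..<m} (\<lambda>_. D))"
      using PD.product_nn_integral_fold[of "{..<m}" "{m..<n}" ?f] by (simp add: I ivl_disj_int)
    also have "\<dots> = (\<integral>\<^sup>+a. \<integral>\<^sup>+b. \<phi> a * (\<Prod>k=m..<n. H a (b k)) \<partial>PiM {m..<n} (\<lambda>_. D) \<partial>PiM {..<m} (\<lambda>_. D))"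
    proof (intro nn_integral_cong)
      fix a b assume a: "a \<in> space (PiM {..<m} (\<lambda>_. D))"
      have "restrict (merge {..<m} {m..<n} (a, b)) {..<m} = a"
        using a by (auto simp: space_PiM PiE_def extensional_restrict ivl_disj_int)
      moreover have "(\<Prod>k=m..<n. H a (merge {..<m} {m..<n} (a, b) k)) = (\<Prod>k=m..<n. H a (b k))"
        by (intro prod.cong refl) (auto simp: merge_def)
      ultimately show "?f (merge {..<m} {m..<n} (a, b)) = \<phi> a * (\<Prod>k=m..<n. H a (b k))" by simp
    qed
    finally show ?thesis .
  qed
  also have "\<dots> = (\<integral>\<^sup>+a. \<phi> a * (\<integral>\<^sup>+x. H a x \<partial>D) ^ (n - m) \<partial>PiM {..<m} (\<lambda>_. D))"
  proof (rule nn_integral_cong)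
    fix a assume a [measurable]: "a \<in> space (PiM {..<m} (\<lambda>_. D))"
    have Ha: "H a \<in> borel_measurable D" by measurable
    have "(\<integral>\<^sup>+b. \<phi> a * (\<Prod>k=m..<n. H a (b k)) \<partial>PiM {m..<n} (\<lambda>_. D))
        = \<phi> a * (\<integral>\<^sup>+b. (\<Prod>k=m..<n. H a (b k)) \<partial>PiM {m..<n} (\<lambda>_. D))"
    proof (rule nn_integral_cmult, rule borel_measurable_prod_ennreal)
      fix k assume k: "k \<in> {m..<n}"
      show "(\<lambda>b. H a (b k)) \<in> borel_measurable (PiM {m..<n} (\<lambda>_. D))"
        by (rule measurable_compose[OF _ Ha]) (use k in auto)
    qed
    also have "(\<integral>\<^sup>+b. (\<Prod>k=m..<n. H a (b k)) \<partial>PiM {m..<n} (\<lambda>_. D)) = (\<Prod>k=m..<n. integral\<^sup>N D (H a))"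
      by (rule PD.product_nn_integral_prod) (auto intro: Ha)
    finally show "(\<integral>\<^sup>+b. \<phi> a * (\<Prod>k=m..<n. H a (b k)) \<partial>PiM {m..<n} (\<lambda>_. D))
        = \<phi> a * (\<integral>\<^sup>+x. H a x \<partial>D) ^ (n - m)"
      by simp
  qed
  finally show ?thesis unfolding H_def .
qed

lemma exp_minus_one_minus_le_sq:
  assumes "0 \<le> x" "x \<le> (1::real)"
  shows "sqrt (exp x - 1 - x) \<le> x" "exp x - 1 \<le> 2 * x"
proof -
  have e: "exp x \<le> 1 + x + x\<^sup>2" by (rule exp_bound[OF assms])
  then show "sqrt (exp x - 1 - x) \<le> x"
    using assms by (intro real_le_lsqrt) auto
  have "x\<^sup>2 \<le> x" using assms by (simp add: power2_eq_square mult_left_le)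
  with e show "exp x - 1 \<le> 2 * x" by simp
qed

section \<open>The law of a perturbed and recentred sample\<close>

context smoothing
begin

lemma score_coordinate_measurable [measurable (raw)]:
  assumes "i < d" and [measurable]: "g \<in> M \<rightarrow>\<^sub>M Rd d"
  shows "(\<lambda>x. sc (g x) i) \<in> borel_measurable M"
  by (rule component_measurable[OF _ assms(1)]) measurable

text \<open>Linearity in w makes the drift a vector, with coordinates taken on unit vectors, to
  which J can be applied.\<close>

lemma drift_sum: "drift c w = ip d w (\<lambda>j. drift c (unit_vec_fun j))"
proof -
  have int: "integrable sm (\<lambda>x. sc x j * ratio c x)" if "j < d" for j
    using integrable_score_ratio[OF _ integrable_score_sq[of "unit_vec_fun j"], of c] that by simp
  have "drift c w = (\<integral>x. (\<Sum>j<d. w j * (sc x j * ratio c x)) \<partial>sm)"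
    unfolding drift_def by (simp add: ip_def sum_distrib_right mult.assoc)
  also have "\<dots> = (\<Sum>j<d. w j * (\<integral>x. sc x j * ratio c x \<partial>sm))"
    using int by (subst Bochner_Integration.integral_sum) auto
  also have "\<dots> = ip d w (\<lambda>j. drift c (unit_vec_fun j))"
    by (simp add: ip_def[of d w] drift_def)
  finally show ?thesis .
qed

text \<open>The displacement is random through the first stage, so the drift has to be measurable in
  it.\<close>

lemma drift_measurable [measurable]: "(\<lambda>c. drift c w) \<in> borel_measurable (Rd d)"
  unfolding drift_def ratio_def
proof (rule sm.borel_measurable_lebesgue_integral)
  have "(\<lambda>(c, x). ip d w (sc x) * (dens (vadd d x c) / dens x)) \<in> borel_measurable (Rd d \<Otimes>\<^sub>M Rd d)"
    by measurable
  then show "(\<lambda>(c, x). ip d w (sc x) * (dens (vadd d x c) / dens x)) \<in> borel_measurable (Rd d \<Otimes>\<^sub>M sm)"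
    by (simp cong: measurable_cong_sets sets_pair_measure_cong)
qed

abbreviation "Gi \<equiv> gauss d (r\<^sup>2 \<cdot>\<^sub>m 1\<^sub>m d)"

lemma gauss_eq: "Gi = N"
  by (rule gauss_isotropic) simp

lemma sets_translate [measurable_cong, simp]: "sets (translate d f l) = sets (Rd d)"
  by (simp add: translate_def)

lemma space_translate [simp]: "space (translate d f l) = space (Rd d)"
  by (rule sets_eq_imp_space_eq) simp

lemma prob_space_translate: "prob_space (translate d f l)"
  unfolding translate_def by (rule f.prob_space_distr) measurable

text \<open>Sample plus perturbation minus centre is a smoothed point displaced by the error of the
  centre, and the displacement becomes a weight on the undisplaced law.\<close>

lemma nn_integral_translate:
  assumes [measurable]: "g \<in> borel_measurable (Rd d)"
  shows "(\<integral>\<^sup>+x. \<integral>\<^sup>+z. g (vsub d (vadd d x z) c) \<partial>N \<partial>translate d f l)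
    = (\<integral>\<^sup>+x. g x * ennreal (ratio (vsub d c l) x) \<partial>sm)"
proof -
  have "(\<integral>\<^sup>+x. \<integral>\<^sup>+z. g (vsub d (vadd d x z) c) \<partial>N \<partial>translate d f l)
      = (\<integral>\<^sup>+y. \<integral>\<^sup>+z. g (vsub d (vadd d (vadd d y l) z) c) \<partial>N \<partial>f)"
    unfolding translate_def by (subst nn_integral_distr) auto
  also have "\<dots> = (\<integral>\<^sup>+y. \<integral>\<^sup>+z. g (vsub d (vadd d y z) (vsub d c l)) \<partial>N \<partial>f)"
    by (intro nn_integral_cong arg_cong[where f=g]) (auto simp: vsub_def vadd_def)
  also have "\<dots> = (\<integral>\<^sup>+x. g (vsub d x (vsub d c l)) \<partial>sm)"
    by (rule sm_law[symmetric]) measurable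
  also have "\<dots> = (\<integral>\<^sup>+x. g x * ennreal (ratio (vsub d c l) x) \<partial>sm)"
    by (rule nn_integral_sm_vsub) measurable
  finally show ?thesis .
qed

end

section \<open>One local step: moment bound, bias, and concentration\<close>

context regular_smoothing
begin

text \<open>The relative error in \<open>score_mgf\<close> is 12 times a sum of two terms, one from
  the displaced centre and one from the length of w. Each gets the budget \<gamma>/24, for a total
  of \<gamma>.\<close>

lemma sample_mgf:
  assumes c: "ip d (vsub d c l) (vsub d c l) \<le> t * r\<^sup>2" and t: "t \<le> 1"
    and t\<gamma>: "24 * sqrt (2 * t) * (sqrt V / r) \<le> \<gamma>"
    and \<gamma>: "\<gamma> \<le> 1" and w: "vnorm d w \<le> \<gamma> / 24 * r"
  shows "(\<integral>\<^sup>+x. \<integral>\<^sup>+z. ennreal (exp (ip d w (sc (vsub d (vadd d x z) c)) - drift (vsub d c l) w)) \<partial>N \<partial>translate d f l)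
    \<le> ennreal (exp ((1 + \<gamma>) / 2 * info w))"
proof -
  let ?e = "vsub d c l"
  let ?B = "1 + 12 * (sqrt (exp (ip d ?e ?e / r\<^sup>2) - 1) * (sqrt V / r) + vnorm d w / r)"
  have wr: "vnorm d w / r \<le> \<gamma> / 24" using w by (simp add: pos_divide_le_eq)
  have tau: "ip d ?e ?e / r\<^sup>2 \<le> t" using c by (simp add: pos_divide_le_eq)
  have tau0: "0 \<le> ip d ?e ?e / r\<^sup>2" by simp
  have "exp (ip d ?e ?e / r\<^sup>2) - 1 \<le> 2 * (ip d ?e ?e / r\<^sup>2)"
    by (rule exp_minus_one_minus_le_sq(2)[OF tau0]) (use tau t in linarith)
  also have "\<dots> \<le> 2 * t" using tau by simp
  finally have "sqrt (exp (ip d ?e ?e / r\<^sup>2) - 1) * (sqrt V / r) \<le> sqrt (2 * t) * (sqrt V / r)"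
    using V_pos r_pos by (intro mult_right_mono divide_nonneg_pos) auto
  moreover have "24 * (sqrt (2 * t) * (sqrt V / r)) \<le> \<gamma>"
    using t\<gamma> by (simp only: mult.assoc)
  moreover have "1 + 12 * (x + z) \<le> 1 + \<gamma>" if "x \<le> y" "24 * y \<le> \<gamma>" "z \<le> \<gamma> / 24" for x y z :: real
    using that by simp
  ultimately have B: "?B \<le> 1 + \<gamma>" using wr by blast
  have "(\<integral>\<^sup>+x. ennreal (exp (ip d w (sc x))) * ennreal (ratio ?e x) \<partial>sm)
      \<le> ennreal (exp (drift ?e w + info w / 2 * ?B))"
  proof (rule score_mgf[OF _ _ _ info_lower])
    show "0 \<le> vnorm d w / r" by (rule divide_nonneg_pos) auto
    show "vnorm d w / r \<le> 1 / 4" using wr \<gamma> by linarith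
  qed simp
  also have "\<dots> \<le> ennreal (exp (drift ?e w + info w / 2 * (1 + \<gamma>)))"
    using B by (intro ennreal_leI) (simp add: mult_left_mono)
  finally have le: "(\<integral>\<^sup>+x. ennreal (exp (ip d w (sc x))) * ennreal (ratio ?e x) \<partial>sm)
      \<le> ennreal (exp (drift ?e w + info w / 2 * (1 + \<gamma>)))" .
  have "(\<integral>\<^sup>+x. \<integral>\<^sup>+z. ennreal (exp (ip d w (sc (vsub d (vadd d x z) c)) - drift ?e w)) \<partial>N \<partial>translate d f l)
      = (\<integral>\<^sup>+x. ennreal (exp (ip d w (sc x) - drift ?e w)) * ennreal (ratio ?e x) \<partial>sm)"
    by (rule nn_integral_translate) measurable
  also have "\<dots> = (\<integral>\<^sup>+x. ennreal (exp (- drift ?e w)) * (ennreal (exp (ip d w (sc x))) * ennreal (ratio ?e x)) \<partial>sm)"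
    by (intro nn_integral_cong) (simp add: exp_diff exp_minus divide_inverse ennreal_mult mult_ac)
  also have "\<dots> = ennreal (exp (- drift ?e w)) * (\<integral>\<^sup>+x. ennreal (exp (ip d w (sc x))) * ennreal (ratio ?e x) \<partial>sm)"
    by (rule nn_integral_cmult) measurable
  also have "\<dots> \<le> ennreal (exp (- drift ?e w)) * ennreal (exp (drift ?e w + info w / 2 * (1 + \<gamma>)))"
    by (rule mult_left_mono[OF le]) simp
  also have "\<dots> = ennreal (exp ((1 + \<gamma>) / 2 * info w))"
    by (simp add: mult.commute flip: ennreal_mult exp_add)
  finally show ?thesis .
qed

text \<open>The residual \<theta> is tested against itself: by \<open>score_inverse\<close>,
  |\<theta>|^2 is exactly the linearization error of the drift in direction J\<theta>. The
  information of J\<theta> is \<theta>.J\<theta> <= p |\<theta>|^2, so one factor |\<theta>| cancels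
  and sqrt(p) remains in front.\<close>

lemma bias_bound:
  assumes c: "ip d c c \<le> t * r\<^sup>2" and t: "t \<le> 1"
  shows "vnorm d (\<lambda>i. c i - mv d jm (\<lambda>j. drift c (unit_vec_fun j)) i) \<le> sqrt p * t"
proof -
  define b where "b = mv d jm (\<lambda>j. drift c (unit_vec_fun j))"
  define \<theta> where "\<theta> = (\<lambda>i. c i - b i)"
  have tau: "ip d c c / r\<^sup>2 \<le> t" using c by (simp add: pos_divide_le_eq)
  have "sqrt (exp (ip d c c / r\<^sup>2) - 1 - ip d c c / r\<^sup>2) \<le> ip d c c / r\<^sup>2"
    by (rule exp_minus_one_minus_le_sq(1)) (use tau t in \<open>simp, linarith\<close>)
  with tau have s: "sqrt (exp (ip d c c / r\<^sup>2) - 1 - ip d c c / r\<^sup>2) \<le> t" by linarith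
  have "0 \<le> ip d c c / r\<^sup>2" by simp
  with tau have t0: "0 \<le> t" by linarith
  have \<theta>b: "ip d \<theta> b = drift c (mv d jm \<theta>)"
    unfolding b_def by (subst drift_sum) (rule mv_symmetric, rule jm_sym)
  have "vnorm d \<theta> * vnorm d \<theta> = ip d \<theta> c - ip d \<theta> b"
    by (subst (3) \<theta>_def) (simp add: power2_eq_square flip: vnorm_sq ip_diff_right \<theta>_def)
  also have "\<dots> \<le> \<bar>drift c (mv d jm \<theta>) - (\<integral>x. ip d (mv d jm \<theta>) (sc x) * ip d c (sc x) \<partial>sm)\<bar>"
    unfolding \<theta>b score_inverse by simp
  also have "\<dots> \<le> sqrt (info (mv d jm \<theta>)) * sqrt (exp (ip d c c / r\<^sup>2) - 1 - ip d c c / r\<^sup>2)"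
    by (rule drift_linearization)
  also have "\<dots> \<le> sqrt (p * ip d \<theta> \<theta>) * t"
  proof (intro mult_mono s)
    have "0 \<le> exp (ip d c c / r\<^sup>2) - 1 - ip d c c / r\<^sup>2"
      using exp_ge_add_one_self[of "ip d c c / r\<^sup>2"] by linarith
    then show "0 \<le> sqrt (exp (ip d c c / r\<^sup>2) - 1 - ip d c c / r\<^sup>2)" by simp
  qed (use jm_form_le[of \<theta>] p_pos in \<open>auto simp flip: jm_info\<close>)
  also have "\<dots> = vnorm d \<theta> * (sqrt p * t)"
    by (simp add: vnorm_eq_sqrt real_sqrt_mult)
  finally have *: "vnorm d \<theta> * vnorm d \<theta> \<le> vnorm d \<theta> * (sqrt p * t)" .
  have "vnorm d \<theta> \<le> sqrt p * t"
  proof (cases "vnorm d \<theta> = 0")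
    case False
    then have "0 < vnorm d \<theta>" using vnorm_nonneg[of d \<theta>] by linarith
    with * show ?thesis using mult_le_cancel_left_pos by blast
  qed (use t0 p_pos in simp)
  then show ?thesis by (simp add: \<theta>_def b_def)
qed

text \<open>The error splits into -S/sqrt(n - m), with S = J Z the normalized sum of centred
  summands, and the residual e - J drift(e), a function of the centre alone.
  \<open>norm_concentration\<close> treats S and \<open>bias_bound\<close> the residual.\<close>

lemma local_stage:
  fixes m n :: nat and l :: "nat \<Rightarrow> real"
  defines "M \<equiv> PiM {..<n} (\<lambda>_. translate d f l) \<Otimes>\<^sub>M PiM {..<n} (\<lambda>_. Gi)"
  assumes E [measurable]: "E \<in> PiM {..<m} (\<lambda>_. Rd d) \<rightarrow>\<^sub>M Rd d" and mn: "m < n"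
    and A0 [measurable]: "A0 \<in> sets (PiM {..<m} (\<lambda>_. translate d f l))"
    and close: "\<And>a. a \<in> A0 \<Longrightarrow> ip d (vsub d (E a) l) (vsub d (E a) l) \<le> t * r\<^sup>2"
    and t: "t \<le> 1" and t\<gamma>: "24 * sqrt (2 * t) * (sqrt V / r) \<le> \<gamma>"
    and \<gamma>: "0 < \<gamma>" "\<gamma> \<le> 1" and L0: "0 < L0"
    and \<rho>: "(1 + sqrt (2 / \<gamma>)) * (sqrt (p * (ln 2 + L0)) + sqrt T) \<le> \<gamma> / 24 * r * sqrt (n - m)"
  shows "measure M {\<omega> \<in> space M. restrict (fst \<omega>) {..<m} \<in> A0 \<and>
      ((1 + 3 / 2 * \<gamma>) * sqrt T + 3 * sqrt (p * (ln 2 + L0))) / sqrt (n - m) + sqrt p * t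
      < vnorm d (vsub d (local_mle d f (r\<^sup>2 \<cdot>\<^sub>m 1\<^sub>m d) (n - m) (\<lambda>k. fst \<omega> (m + k)) (\<lambda>k. snd \<omega> (m + k))
          (E (restrict (fst \<omega>) {..<m}))) l)} \<le> exp (- L0)"
proof -
  let ?D = "translate d f l"
  interpret D: prob_space ?D by (rule prob_space_translate)
  interpret PD: product_prob_space "\<lambda>_. ?D" "{..<n}" by standard
  interpret PK: product_prob_space "\<lambda>_. N" "{..<n}" by standard
  interpret P: pair_prob_space "PiM {..<n} (\<lambda>_. ?D)" "PiM {..<n} (\<lambda>_. N)" ..
  have M_eq: "M = PiM {..<n} (\<lambda>_. ?D) \<Otimes>\<^sub>M PiM {..<n} (\<lambda>_. N)"
    by (simp add: M_def gauss_eq)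
  have M: "prob_space M" unfolding M_eq by (rule P.prob_space_axioms)
  define c where "c \<omega> = E (restrict (fst \<omega>) {..<m})" for \<omega> :: "(nat \<Rightarrow> nat \<Rightarrow> real) \<times> (nat \<Rightarrow> nat \<Rightarrow> real)"
  define e where "e \<omega> = vsub d (c \<omega>) l" for \<omega>
  define u where "u k \<omega> = vsub d (vadd d (fst \<omega> k) (snd \<omega> k)) (c \<omega>)" for k \<omega>
  define s where "s = sqrt (real (n - m))"
  have s: "0 < s" "s\<^sup>2 = real (n - m)" "s * s = real (n - m)" using mn by (simp_all add: s_def)
  \<comment> \<open>Centred at the drift of the realized centre and normalized by the square root of
    the sample count, so that the log moment generating function of S is compared with
    x.Jx/2.\<close>
  define Z where "Z \<omega> j = (\<Sum>k=m..<n. sc (u k \<omega>) j) / s - s * drift (e \<omega>) (unit_vec_fun j)" for \<omega> j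
  define S where "S \<omega> = mv d jm (Z \<omega>)" for \<omega>
  have rest [measurable]: "(\<lambda>xs. restrict xs {..<m}) \<in> PiM {..<n} (\<lambda>_. ?D) \<rightarrow>\<^sub>M PiM {..<m} (\<lambda>_. ?D)"
    using mn by (intro measurable_restrict_subset) auto
  have E' [measurable]: "E \<in> PiM {..<m} (\<lambda>_. ?D) \<rightarrow>\<^sub>M Rd d"
    using E by (simp cong: measurable_cong_sets sets_PiM_cong)
  have c_meas [measurable]: "c \<in> M \<rightarrow>\<^sub>M Rd d"
    unfolding c_def M_eq by measurable
  have e_meas [measurable]: "e \<in> M \<rightarrow>\<^sub>M Rd d"
    unfolding e_def by measurable
  have fs [measurable]: "(\<lambda>\<omega>. fst \<omega> k) \<in> M \<rightarrow>\<^sub>M Rd d" "(\<lambda>\<omega>. snd \<omega> k) \<in> M \<rightarrow>\<^sub>M Rd d" if "k \<in> {m..<n}" for k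
  proof -
    have "(\<lambda>\<omega>. fst \<omega> k) \<in> M \<rightarrow>\<^sub>M ?D" "(\<lambda>\<omega>. snd \<omega> k) \<in> M \<rightarrow>\<^sub>M N"
      unfolding M_eq using that
      by (auto intro!: measurable_compose[OF measurable_fst] measurable_compose[OF measurable_snd]
        measurable_component_singleton)
    then show "(\<lambda>\<omega>. fst \<omega> k) \<in> M \<rightarrow>\<^sub>M Rd d" "(\<lambda>\<omega>. snd \<omega> k) \<in> M \<rightarrow>\<^sub>M Rd d"
      by (simp_all cong: measurable_cong_sets)
  qed
  have u_meas [measurable]: "u k \<in> M \<rightarrow>\<^sub>M Rd d" if "k \<in> {m..<n}" for k
    unfolding u_def using fs[OF that] by measurable
  have Z_meas: "(\<lambda>\<omega>. Z \<omega> j) \<in> borel_measurable M" if "j < d" for j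
  proof -
    have "(\<lambda>\<omega>. sc (u k \<omega>) j) \<in> borel_measurable M" if "k \<in> {m..<n}" for k
      using u_meas[OF that] \<open>j < d\<close> by measurable
    then have [measurable]: "(\<lambda>\<omega>. \<Sum>k=m..<n. sc (u k \<omega>) j) \<in> borel_measurable M"
      by (rule borel_measurable_sum)
    show ?thesis unfolding Z_def by measurable
  qed
  have S_meas [measurable]: "(\<lambda>\<omega>. S \<omega> i) \<in> borel_measurable M" for i
    unfolding S_def by (rule mv_measurable) (rule Z_meas)
  define A where "A = {\<omega> \<in> space M. restrict (fst \<omega>) {..<m} \<in> A0}"
  have A [measurable]: "A \<in> sets M"
    unfolding A_def M_eq by measurable
  have ipS: "ip d x (S \<omega>) = (\<Sum>k=m..<n. ip d (\<lambda>i. 1 / s * mv d jm x i) (sc (u k \<omega>))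
      - drift (e \<omega>) (\<lambda>i. 1 / s * mv d jm x i))" for x \<omega>
  proof -
    let ?w = "\<lambda>i. 1 / s * mv d jm x i"
    have "ip d x (S \<omega>) = ip d (mv d jm x) (Z \<omega>)"
      unfolding S_def by (rule mv_symmetric) (rule jm_sym)
    also have "\<dots> = s * ip d ?w (Z \<omega>)"
      unfolding ip_scale_left using s by simp
    also have "Z \<omega> = (\<lambda>j. 1 / s * (\<Sum>k=m..<n. sc (u k \<omega>) j) - s * drift (e \<omega>) (unit_vec_fun j))"
      by (simp add: Z_def fun_eq_iff)
    also have "s * ip d ?w \<dots> = ip d ?w (\<lambda>j. \<Sum>k=m..<n. sc (u k \<omega>) j)
        - real (n - m) * ip d ?w (\<lambda>j. drift (e \<omega>) (unit_vec_fun j))"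
      unfolding ip_diff_right ip_scale_right using s(1)
      by (simp add: right_diff_distrib s(3)[symmetric] mult.assoc)
    also have "ip d ?w (\<lambda>j. \<Sum>k=m..<n. sc (u k \<omega>) j) = (\<Sum>k=m..<n. ip d ?w (sc (u k \<omega>)))"
      unfolding ip_def sum_distrib_left by (rule sum.swap)
    finally show ?thesis
      by (simp only: sum_subtractf sum_constant card_atLeastLessThan drift_sum[of "e \<omega>" ?w])
  qed
  have mgf: "(\<integral>\<^sup>+\<omega>. indicator A \<omega> * ennreal (exp (ip d x (S \<omega>))) \<partial>M)
      \<le> ennreal (exp ((1 + \<gamma>) / 2 * ip d x (mv d jm x)))"
    if x: "vnorm d (mv d jm x) \<le> \<gamma> / 24 * r * sqrt (n - m)" for x
  proof -
    \<comment> \<open>Each summand enters x.S through w = J x / sqrt(n - m). The admissible radius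
      for J x is thus sqrt(n - m) times the radius \<gamma> r / 24 for w.\<close>
    define w where "w = (\<lambda>i. 1 / s * mv d jm x i)"
    have w: "vnorm d w \<le> \<gamma> / 24 * r"
      unfolding w_def vnorm_scale using x s mn by (simp add: pos_divide_le_eq s_def)
    have infow: "real (n - m) * info w = ip d x (mv d jm x)"
    proof -
      have "info w = info (mv d jm x) / s\<^sup>2"
        unfolding info_form w_def mv_scale ip_scale_left ip_scale_right by (simp add: power2_eq_square)
      then show ?thesis using s mn by (simp add: jm_info)
    qed
    define G where "G a y z = ennreal (exp (ip d w (sc (vsub d (vadd d y z) (E a))) - drift (vsub d (E a) l) w))" for a y z
    have Gm: "(\<lambda>(a, y, z). G a y z) \<in> borel_measurable (PiM {..<m} (\<lambda>_. ?D) \<Otimes>\<^sub>M ?D \<Otimes>\<^sub>M N)"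
    proof -
      let ?K = "PiM {..<m} (\<lambda>_. Rd d) \<Otimes>\<^sub>M Rd d \<Otimes>\<^sub>M Rd d"
      have q: "(\<lambda>q. E (fst q)) \<in> ?K \<rightarrow>\<^sub>M Rd d" "(\<lambda>q. fst (snd q)) \<in> ?K \<rightarrow>\<^sub>M Rd d"
        "(\<lambda>q. snd (snd q)) \<in> ?K \<rightarrow>\<^sub>M Rd d"
        by measurable
      note [measurable] = component_measurable[OF q(1)] component_measurable[OF q(2)]
        component_measurable[OF q(3)]
      have v [measurable]: "(\<lambda>q. vsub d (vadd d (fst (snd q)) (snd (snd q))) (E (fst q))) \<in> ?K \<rightarrow>\<^sub>M Rd d"
        "(\<lambda>q. vsub d (E (fst q)) l) \<in> ?K \<rightarrow>\<^sub>M Rd d"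
        by measurable
      have [measurable]: "(\<lambda>q. drift (vsub d (E (fst q)) l) w) \<in> borel_measurable ?K"
        by (rule measurable_compose[OF v(2) drift_measurable])
      have "(\<lambda>(a, y, z). G a y z) \<in> borel_measurable ?K"
        unfolding G_def split_beta' by measurable
      then show ?thesis
        by (simp cong: measurable_cong_sets sets_pair_measure_cong sets_PiM_cong)
    qed
    have "(\<integral>\<^sup>+\<omega>. indicator A \<omega> * ennreal (exp (ip d x (S \<omega>))) \<partial>M)
      = (\<integral>\<^sup>+\<omega>. indicator A0 (restrict (fst \<omega>) {..<m}) *
        (\<Prod>k=m..<n. G (restrict (fst \<omega>) {..<m}) (fst \<omega> k) (snd \<omega> k))
        \<partial>(PiM {..<n} (\<lambda>_. ?D) \<Otimes>\<^sub>M PiM {..<n} (\<lambda>_. N)))"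
      unfolding M_eq[symmetric]
    proof (rule nn_integral_cong)
      fix \<omega> assume "\<omega> \<in> space M"
      then have "indicator A \<omega> = (indicator A0 (restrict (fst \<omega>) {..<m}) :: ennreal)"
        by (simp add: A_def indicator_def)
      moreover have "ennreal (exp (ip d x (S \<omega>))) = (\<Prod>k=m..<n. G (restrict (fst \<omega>) {..<m}) (fst \<omega> k) (snd \<omega> k))"
        unfolding ipS G_def by (simp add: exp_sum prod_ennreal u_def e_def c_def w_def)
      ultimately show "indicator A \<omega> * ennreal (exp (ip d x (S \<omega>)))
        = indicator A0 (restrict (fst \<omega>) {..<m}) * (\<Prod>k=m..<n. G (restrict (fst \<omega>) {..<m}) (fst \<omega> k) (snd \<omega> k))"
        by simp
    qed
    also have "\<dots> = (\<integral>\<^sup>+a. indicator A0 a * (\<integral>\<^sup>+y. \<integral>\<^sup>+z. G a y z \<partial>N \<partial>?D) ^ (n - m) \<partial>PiM {..<m} (\<lambda>_. ?D))"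
      by (rule nn_integral_two_stage[OF D.prob_space_axioms N.prob_space_axioms _ _ Gm]) (use mn in auto)
    also have "\<dots> \<le> (\<integral>\<^sup>+a. ennreal (exp ((1 + \<gamma>) / 2 * info w)) ^ (n - m) \<partial>PiM {..<m} (\<lambda>_. ?D))"
    proof (intro nn_integral_mono)
      fix a
      show "indicator A0 a * (\<integral>\<^sup>+y. \<integral>\<^sup>+z. G a y z \<partial>N \<partial>?D) ^ (n - m)
          \<le> ennreal (exp ((1 + \<gamma>) / 2 * info w)) ^ (n - m)"
      proof (cases "a \<in> A0")
        case True
        have "(\<integral>\<^sup>+y. \<integral>\<^sup>+z. G a y z \<partial>N \<partial>?D) \<le> ennreal (exp ((1 + \<gamma>) / 2 * info w))"
          unfolding G_def by (rule sample_mgf[OF close[OF True] t t\<gamma> \<gamma>(2) w])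
        then show ?thesis using True by (simp add: power_mono)
      qed simp
    qed
    also have "\<dots> = ennreal (exp ((1 + \<gamma>) / 2 * info w)) ^ (n - m)"
    proof -
      interpret PDm: product_prob_space "\<lambda>_. ?D" "{..<m}" by standard
      show ?thesis by (simp add: PDm.emeasure_space_1)
    qed
    also have "\<dots> = ennreal (exp ((1 + \<gamma>) / 2 * ip d x (mv d jm x)))"
      by (simp add: ennreal_power infow[symmetric] mult_ac flip: exp_of_nat_mult)
    finally show ?thesis .
  qed
  have conc: "measure M {\<omega> \<in> space M. \<omega> \<in> A \<and>
    (1 + 3 / 2 * \<gamma>) * sqrt T + 3 * sqrt (p * (ln 2 + L0)) < vnorm d (S \<omega>)} \<le> exp (- L0)"
    by (rule norm_concentration[OF M A S_meas jm_sym jm_nonneg jm_norm_le trace_eq frobenius_le \<gamma> p_pos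
      trace_pos L0 mgf \<rho>])
  let ?b = "(1 + 3 / 2 * \<gamma>) * sqrt T + 3 * sqrt (p * (ln 2 + L0))"
  let ?out = "\<lambda>\<omega>. local_mle d f (r\<^sup>2 \<cdot>\<^sub>m 1\<^sub>m d) (n - m) (\<lambda>k. fst \<omega> (m + k)) (\<lambda>k. snd \<omega> (m + k)) (c \<omega>)"
  have err: "vnorm d (vsub d (?out \<omega>) l) \<le> vnorm d (S \<omega>) / s + sqrt p * t" if "\<omega> \<in> A" for \<omega>
  proof -
    let ?b = "mv d jm (\<lambda>j. drift (e \<omega>) (unit_vec_fun j))"
    have shift: "(\<Sum>k<n - m. F (m + k)) = (\<Sum>k=m..<n. F k)" for F :: "nat \<Rightarrow> real"
      using sum.shift_bounds_nat_ivl[of F 0 m "n - m"] mn by (simp add: atLeast0LessThan add.commute)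
    have out: "vsub d (?out \<omega>) l i = - (1 / s) * S \<omega> i + (e \<omega> i - ?b i)" if i: "i < d" for i
    proof -
      have "?out \<omega> i = c \<omega> i - 1 / real (n - m) * (\<Sum>k=m..<n. mv d jm (sc (u k \<omega>)) i)"
        using i by (simp add: local_mle_def vsub_def[of d "c \<omega>"] u_def
          mat_app_eq_mv[OF inverse_exists(2)] flip: shift)
      moreover have "(\<Sum>k=m..<n. mv d jm (sc (u k \<omega>)) i) = mv d jm (\<lambda>j. \<Sum>k=m..<n. sc (u k \<omega>) j) i"
        unfolding mv_def sum_distrib_left by (rule sum.swap)
      moreover have "S \<omega> i = 1 / s * mv d jm (\<lambda>j. \<Sum>k=m..<n. sc (u k \<omega>) j) i - s * ?b i"
        by (simp add: S_def Z_def mv_def sum_subtractf sum_distrib_left sum_divide_distrib algebra_simps)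
      moreover have "1 / s * (1 / s) = 1 / real (n - m)" by (simp add: s(3)[symmetric])
      ultimately show ?thesis
        using i s(1) by (simp add: vsub_def e_def right_diff_distrib s(3)[symmetric])
    qed
    have "vnorm d (vsub d (?out \<omega>) l) = vnorm d (\<lambda>i. - (1 / s) * S \<omega> i + (e \<omega> i - ?b i))"
      by (rule vnorm_cong) (rule out)
    also have "\<dots> \<le> vnorm d (\<lambda>i. - (1 / s) * S \<omega> i) + vnorm d (\<lambda>i. e \<omega> i - ?b i)"
      by (rule vnorm_triangle)
    also have "vnorm d (\<lambda>i. - (1 / s) * S \<omega> i) = vnorm d (S \<omega>) / s"
      unfolding vnorm_scale using s by simp
    also have "vnorm d (\<lambda>i. e \<omega> i - ?b i) \<le> sqrt p * t"
      by (rule bias_bound[OF _ t]) (use that close in \<open>auto simp: A_def e_def c_def\<close>)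
    finally show ?thesis by simp
  qed
  have "measure M {\<omega> \<in> space M. restrict (fst \<omega>) {..<m} \<in> A0 \<and>
      ?b / sqrt (n - m) + sqrt p * t < vnorm d (vsub d (?out \<omega>) l)}
      \<le> measure M {\<omega> \<in> space M. \<omega> \<in> A \<and> ?b < vnorm d (S \<omega>)}"
  proof (rule finite_measure.finite_measure_mono)
    show "finite_measure M" using M by (simp add: prob_space_def)
    show "{\<omega> \<in> space M. \<omega> \<in> A \<and> ?b < vnorm d (S \<omega>)} \<in> sets M" by measurable
    show "{\<omega> \<in> space M. restrict (fst \<omega>) {..<m} \<in> A0 \<and>
      ?b / sqrt (n - m) + sqrt p * t < vnorm d (vsub d (?out \<omega>) l)}
      \<subseteq> {\<omega> \<in> space M. \<omega> \<in> A \<and> ?b < vnorm d (S \<omega>)}"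
    proof safe
      fix x z assume *: "(x, z) \<in> space M" "restrict (fst (x, z)) {..<m} \<in> A0"
        and lt: "?b / sqrt (n - m) + sqrt p * t < vnorm d (vsub d (?out (x, z)) l)"
      show A: "(x, z) \<in> A" using * by (simp add: A_def)
      have "sqrt (n - m) = s" by (simp add: s_def)
      then have "?b / s + sqrt p * t < vnorm d (S (x, z)) / s + sqrt p * t"
        using err[OF A] lt by simp
      then have "?b / s < vnorm d (S (x, z)) / s" by simp
      then show "?b < vnorm d (S (x, z))"
        using s(1) by (simp add: divide_less_cancel)
    qed
  qed
  with conc show ?thesis unfolding c_def by linarith
qed

end

section \<open>Moments of translates and events of the first stage\<close>

context smoothing
begin

lemma integrable_coordinate_sq: "i < d \<Longrightarrow> integrable f (\<lambda>y. (y i)\<^sup>2)"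
  using fin_cov by (simp add: finite_cov_distribution_def)

lemma integrable_coordinate: "i < d \<Longrightarrow> integrable f (\<lambda>y. y i)"
  by (rule f.square_integrable_imp_integrable[OF _ integrable_coordinate_sq]) auto

lemma integral_translate:
  fixes g :: "(nat \<Rightarrow> real) \<Rightarrow> real"
  assumes [measurable]: "g \<in> borel_measurable (Rd d)"
  shows "(\<integral>x. g x \<partial>translate d f l) = (\<integral>y. g (vadd d y l) \<partial>f)"
    and "integrable (translate d f l) g \<longleftrightarrow> integrable f (\<lambda>y. g (vadd d y l))"
  unfolding translate_def by (rule integral_distr integrable_distr_eq; measurable)+

lemma finite_cov_translate: "finite_cov_distribution d (translate d f l)"
  unfolding finite_cov_distribution_def
proof (intro conjI allI impI)
  fix i assume i: "i < d"
  have "integrable f (\<lambda>y. (y i)\<^sup>2 + 2 * l i * y i + (l i)\<^sup>2)"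
    using integrable_coordinate_sq[OF i] integrable_coordinate[OF i] by simp
  moreover have "(vadd d y l i)\<^sup>2 = (y i)\<^sup>2 + 2 * l i * y i + (l i)\<^sup>2" for y
    using i by (simp add: vadd_def power2_sum)
  ultimately show "integrable (translate d f l) (\<lambda>x. (x i)\<^sup>2)"
    using i by (subst integral_translate(2)) auto
qed (auto intro: prob_space_translate)

lemma mean_translate: "i < d \<Longrightarrow> mean_vec d (translate d f l) i = mean_vec d f i + l i"
proof -
  assume i: "i < d"
  have "(\<integral>x. x i \<partial>translate d f l) = (\<integral>y. y i + l i \<partial>f)"
    using i by (subst integral_translate(1)) (auto simp: vadd_def)
  also have "\<dots> = (\<integral>y. y i \<partial>f) + l i"
    using integrable_coordinate[OF i] by (simp add: f.prob_space[simplified])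
  finally show ?thesis using i by (simp add: mean_vec_def)
qed

lemma cov_translate: "cov_mat d (translate d f l) = cov_mat d f"
  unfolding cov_mat_def
proof (rule cong_mat, goal_cases)
  case (3 i j)
  then have "(\<integral>x. (x i - mean_vec d (translate d f l) i) * (x j - mean_vec d (translate d f l) j) \<partial>translate d f l)
      = (\<integral>y. (y i - mean_vec d f i) * (y j - mean_vec d f j) \<partial>f)"
    by (subst integral_translate(1)) (auto simp: vadd_def mean_translate)
  then show ?case by simp
qed auto

lemma trace_cov_nonneg: "0 \<le> mat_trace (cov_mat d f)"
proof -
  have "mat_trace (cov_mat d f) = (\<Sum>i<d. \<integral>x. (x i - mean_vec d f i) * (x i - mean_vec d f i) \<partial>f)"
    by (simp add: mat_trace_def cov_mat_def)
  also have "0 \<le> \<dots>"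
    by (intro sum_nonneg integral_nonneg_AE) simp
  finally show ?thesis .
qed

end

lemma (in regular_smoothing) local_mle_measurable:
  assumes x: "\<And>k. k < m \<Longrightarrow> (\<lambda>\<omega>. x \<omega> k) \<in> M \<rightarrow>\<^sub>M Rd d" and z: "\<And>k. k < m \<Longrightarrow> (\<lambda>\<omega>. z \<omega> k) \<in> M \<rightarrow>\<^sub>M Rd d"
    and c [measurable]: "c \<in> M \<rightarrow>\<^sub>M Rd d"
  shows "(\<lambda>\<omega>. vnorm d (vsub d (local_mle d f (r\<^sup>2 \<cdot>\<^sub>m 1\<^sub>m d) m (x \<omega>) (z \<omega>) (c \<omega>)) l)) \<in> borel_measurable M"
proof -
  have u: "(\<lambda>\<omega>. vsub d (vadd d (x \<omega> k) (z \<omega> k)) (c \<omega>)) \<in> M \<rightarrow>\<^sub>M Rd d" if "k < m" for k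
  proof -
    note [measurable] = x[OF that] z[OF that]
    show ?thesis by measurable
  qed
  have sum: "(\<lambda>\<omega>. \<Sum>k<m. mat_app Ji (sc (vsub d (vadd d (x \<omega> k) (z \<omega> k)) (c \<omega>))) i) \<in> borel_measurable M"
    if i: "i < d" for i
  proof (rule borel_measurable_sum)
    fix k assume k: "k \<in> {..<m}"
    have "(\<lambda>\<omega>. sc (vsub d (vadd d (x \<omega> k) (z \<omega> k)) (c \<omega>)) j) \<in> borel_measurable M" if "j < d" for j
      using score_coordinate_measurable[OF that u] k by simp
    then show "(\<lambda>\<omega>. mat_app Ji (sc (vsub d (vadd d (x \<omega> k) (z \<omega> k)) (c \<omega>))) i) \<in> borel_measurable M"
      unfolding mat_app_eq_mv[OF inverse_exists(2) i] by (rule mv_measurable)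
  qed
  have coord: "vsub d (local_mle d f (r\<^sup>2 \<cdot>\<^sub>m 1\<^sub>m d) m (x \<omega>) (z \<omega>) (c \<omega>)) l i
      = c \<omega> i - 1 / real m * (\<Sum>k<m. mat_app Ji (sc (vsub d (vadd d (x \<omega> k) (z \<omega> k)) (c \<omega>))) i) - l i"
    if "i < d" for i \<omega>
    using that by (simp add: local_mle_def vsub_def[of d "c \<omega>"] vsub_def[of d _ l])
  show ?thesis
  proof (rule vnorm_measurable)
    fix i assume i: "i < d"
    have [measurable]: "(\<lambda>\<omega>. c \<omega> i) \<in> borel_measurable M" using i by measurable
    show "(\<lambda>\<omega>. vsub d (local_mle d f (r\<^sup>2 \<cdot>\<^sub>m 1\<^sub>m d) m (x \<omega>) (z \<omega>) (c \<omega>)) l i) \<in> borel_measurable M"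
      unfolding coord[OF i] using sum[OF i] by measurable
  qed
qed

text \<open>The two-stage formula with G = 1.\<close>

lemma (in smoothing) first_stage_prob:
  fixes m n :: nat and l :: "nat \<Rightarrow> real"
  defines "M \<equiv> PiM {..<n} (\<lambda>_. translate d f l) \<Otimes>\<^sub>M PiM {..<n} (\<lambda>_. Gi)"
  assumes mn: "m \<le> n" and A0 [measurable]: "A0 \<in> sets (PiM {..<m} (\<lambda>_. translate d f l))"
  shows "{\<omega> \<in> space M. restrict (fst \<omega>) {..<m} \<in> A0} \<in> sets M" (is "?A \<in> _")
    and "measure M {\<omega> \<in> space M. restrict (fst \<omega>) {..<m} \<in> A0}
      = measure (PiM {..<m} (\<lambda>_. translate d f l)) A0"
proof -
  let ?D = "translate d f l"
  interpret D: prob_space ?D by (rule prob_space_translate)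
  have M_eq: "M = PiM {..<n} (\<lambda>_. ?D) \<Otimes>\<^sub>M PiM {..<n} (\<lambda>_. N)"
    by (simp add: M_def gauss_eq)
  have [measurable]: "(\<lambda>xs. restrict xs {..<m}) \<in> PiM {..<n} (\<lambda>_. ?D) \<rightarrow>\<^sub>M PiM {..<m} (\<lambda>_. ?D)"
    using mn by (intro measurable_restrict_subset) auto
  show A: "?A \<in> sets M" unfolding M_eq by measurable
  have "emeasure M ?A = (\<integral>\<^sup>+\<omega>. indicator ?A \<omega> \<partial>M)"
    using A by simp
  also have "\<dots> = (\<integral>\<^sup>+\<omega>. indicator A0 (restrict (fst \<omega>) {..<m}) * (\<Prod>k=m..<n. 1) \<partial>M)"
    by (intro nn_integral_cong) (simp add: indicator_def)
  also have "\<dots> = (\<integral>\<^sup>+a. indicator A0 a * (\<integral>\<^sup>+x. \<integral>\<^sup>+z. 1 \<partial>N \<partial>?D) ^ (n - m) \<partial>PiM {..<m} (\<lambda>_. ?D))"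
    unfolding M_eq
    by (rule nn_integral_two_stage[OF D.prob_space_axioms N.prob_space_axioms mn]) auto
  also have "\<dots> = emeasure (PiM {..<m} (\<lambda>_. ?D)) A0"
    by (simp add: N.emeasure_space_1[simplified] D.emeasure_space_1[simplified])
  finally show "measure M ?A = measure (PiM {..<m} (\<lambda>_. ?D)) A0"
    by (simp add: measure_def)
qed

text \<open>The summands secure, in this order: rounding of the first-stage sample size, the admissible
  failure probability of the first stage, a first-stage error small enough for the moment generating
  function of the second stage, the range of that function needed for concentration, and a
  negligible second-order bias. Here \<open>c\<close> is the fraction of first-stage samples.\<close>

definition sample_const :: "real \<Rightarrow> real \<Rightarrow> real \<Rightarrow> real \<Rightarrow> real" where
  "sample_const C\<^sub>1 C\<^sub>2 c \<gamma> = 4 / c + 4 * C\<^sub>2 / c + 4608 * (4 * C\<^sub>1\<^sup>2 / c) / \<gamma>\<^sup>2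
    + 36864 * (1 + sqrt (2 / \<gamma>))\<^sup>2 / \<gamma>\<^sup>2 + (4 * C\<^sub>1\<^sup>2 / c / \<gamma>)\<^sup>2"

text \<open>Here j and s stand for d_eff(J) and d_eff(\<Sigma>), \<kappa> for the ratio of the norm
  of \<Sigma> to r^2, L0 for log(2/\<delta>), and t for the bound on the squared first-stage error
  in units of r^2.\<close>

lemma sample_size:
  fixes n :: nat and c D \<gamma> \<kappa> L0 j s :: real
  assumes C: "0 < C\<^sub>1" "0 < C\<^sub>2" and c: "0 < c" "c \<le> 1 / 4" and \<gamma>: "0 < \<gamma>" and \<kappa>: "1 \<le> \<kappa>"
    and L0: "ln 2 \<le> L0" and j: "0 < j" and s: "0 \<le> s"
    and n: "real n > sample_const C\<^sub>1 C\<^sub>2 c \<gamma> * (\<kappa>\<^sup>2 * (L0 + j + s\<^sup>2 / j))"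
  defines "m \<equiv> nat \<lfloor>c * real n\<rfloor>" and "D \<equiv> 4 * C\<^sub>1\<^sup>2 / c"
  defines "t \<equiv> D * \<kappa> * (s + L0) / real n"
  shows "0 < n" and "m < n" and "c * real n / 2 \<le> real m" and "real n * (1 - c) \<le> real (n - m)"
    and "L0 < real m * ln 2 / C\<^sub>2"
    and "t \<le> \<gamma>\<^sup>2 / (4608 * \<kappa>)"
    and "(1 + sqrt (2 / \<gamma>))\<^sup>2 * (16 * \<kappa> * (2 * L0 + j)) \<le> \<gamma>\<^sup>2 / 576 * real (n - m)"
    and "t * sqrt (real n) \<le> \<gamma> * (sqrt j + sqrt L0)"
proof -
  define W where "W = L0 + j + s\<^sup>2 / j"
  have ln2: "1 / 2 \<le> ln (2::real)" using ln_2_less_1 ln2_ge_two_thirds by simp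
  have L0': "1 / 2 \<le> L0" using L0 ln2 by linarith
  have sj: "0 \<le> s\<^sup>2 / j" using j by simp
  have W: "L0 \<le> W" "0 < W" unfolding W_def using L0' j sj by linarith+
  have k2: "\<kappa> \<le> \<kappa>\<^sup>2" using \<kappa> by (simp add: power2_eq_square)
  have k21: "1 \<le> \<kappa>\<^sup>2" using k2 \<kappa> by linarith
  have D: "0 < D" using C c by (simp add: D_def)
  \<comment> \<open>Arithmetic-geometric mean inequality: a demand linear in d_eff(\<Sigma>) is
    already covered by W.\<close>
  have "s \<le> j + s\<^sup>2 / j"
  proof -
    have "2 * (s * j) \<le> s\<^sup>2 + j\<^sup>2"
      using sum_squares_bound[of s j] by (simp add: mult.assoc)
    moreover have "0 \<le> s * j" using s j by simp
    moreover have "(j + s\<^sup>2 / j) * j = s\<^sup>2 + j\<^sup>2"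
      using j by (simp add: distrib_right power2_eq_square)
    ultimately have "s * j \<le> (j + s\<^sup>2 / j) * j" by linarith
    then show ?thesis using j by simp
  qed
  then have sW: "s + L0 \<le> W" by (simp add: W_def)
  let ?k = "\<kappa>\<^sup>2 * W"
  have kW: "0 < ?k" using W k21 by (intro mult_pos_pos) linarith+
  have kL: "L0 \<le> ?k" using mult_mono[OF k21 W(1)] L0' by simp
  have parts: "4 / c * ?k \<le> real n" "4 * C\<^sub>2 / c * ?k < real n" "4608 * D / \<gamma>\<^sup>2 * ?k \<le> real n"
    "36864 * (1 + sqrt (2 / \<gamma>))\<^sup>2 / \<gamma>\<^sup>2 * ?k \<le> real n" "(D / \<gamma>)\<^sup>2 * ?k \<le> real n"
  proof -
    have n': "(4 / c + 4 * C\<^sub>2 / c + 4608 * D / \<gamma>\<^sup>2 + 36864 * (1 + sqrt (2 / \<gamma>))\<^sup>2 / \<gamma>\<^sup>2 + (D / \<gamma>)\<^sup>2) * ?k < real n"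
      using n by (simp add: sample_const_def D_def W_def)
    have nn: "0 \<le> 4 / c * ?k" "0 \<le> 4 * C\<^sub>2 / c * ?k" "0 \<le> 4608 * D / \<gamma>\<^sup>2 * ?k"
      "0 \<le> 36864 * (1 + sqrt (2 / \<gamma>))\<^sup>2 / \<gamma>\<^sup>2 * ?k" "0 \<le> (D / \<gamma>)\<^sup>2 * ?k"
      using c C D kW by (auto intro!: mult_nonneg_nonneg divide_nonneg_nonneg)
    show "4 / c * ?k \<le> real n" "4 * C\<^sub>2 / c * ?k < real n" "4608 * D / \<gamma>\<^sup>2 * ?k \<le> real n"
    "36864 * (1 + sqrt (2 / \<gamma>))\<^sup>2 / \<gamma>\<^sup>2 * ?k \<le> real n" "(D / \<gamma>)\<^sup>2 * ?k \<le> real n"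
      using n' nn unfolding distrib_right by linarith+
  qed
  have "0 < 4 / c * ?k" using c kW by simp
  then have n0: "0 < real n" using parts(1) by linarith
  then show "0 < n" by simp
  have "4 * ?k \<le> c * real n"
    using mult_left_mono[OF parts(1), of c] c by simp
  \<comment> \<open>Makes rounding harmless: the floor of c n exceeds c n - 1, which is at least c n
    / 2.\<close>
  then have cn: "2 \<le> c * real n" using kL L0' by linarith
  have m: "real m = of_int \<lfloor>c * real n\<rfloor>" using cn by (simp add: m_def)
  show m_lo: "c * real n / 2 \<le> real m" using cn m by linarith
  have m_hi: "real m \<le> c * real n" using m by linarith
  also have "\<dots> < real n" using c n0 by simp
  finally show mn: "m < n" by simp
  show nm: "real n * (1 - c) \<le> real (n - m)" using m_hi mn by (simp add: algebra_simps of_nat_diff)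
  have "4 * C\<^sub>2 * ?k < c * real n"
    using mult_strict_left_mono[OF parts(2), of c] c by simp
  then have "2 * C\<^sub>2 * ?k < real m" using m_lo by linarith
  moreover have "2 * C\<^sub>2 * L0 \<le> 2 * C\<^sub>2 * ?k" using kL C by (intro mult_left_mono) auto
  ultimately have "2 * C\<^sub>2 * L0 < real m" by linarith
  moreover have "real m * (1 / 2) \<le> real m * ln 2" using ln2 by (intro mult_left_mono) auto
  ultimately have "C\<^sub>2 * L0 < real m * ln 2" by linarith
  then show "L0 < real m * ln 2 / C\<^sub>2" using C by (simp add: pos_less_divide_eq mult.commute)
  have "D * \<kappa> * (s + L0) \<le> D * \<kappa> * W" using D \<kappa> sW by (intro mult_left_mono) auto
  then have "4608 * \<kappa> * (D * \<kappa> * (s + L0)) \<le> 4608 * \<kappa> * (D * \<kappa> * W)"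
    by (rule mult_left_mono) (use \<kappa> in simp)
  also have "\<dots> = 4608 * D * ?k" by (simp add: power2_eq_square)
  also have "\<dots> \<le> \<gamma>\<^sup>2 * real n"
    using mult_left_mono[OF parts(3), of "\<gamma>\<^sup>2"] \<gamma> by simp
  finally have "D * \<kappa> * (s + L0) * (4608 * \<kappa>) \<le> \<gamma>\<^sup>2 * real n" by (simp add: mult_ac)
  then show "t \<le> \<gamma>\<^sup>2 / (4608 * \<kappa>)"
    using n0 \<kappa> by (simp add: t_def pos_divide_le_eq pos_le_divide_eq mult_ac)
  let ?q = "(1 + sqrt (2 / \<gamma>))\<^sup>2"
  have "2 * L0 + j \<le> 2 * W" using L0' j sj by (simp add: W_def)
  then have "\<kappa> * (2 * L0 + j) \<le> \<kappa>\<^sup>2 * (2 * W)"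
    using k2 L0' j W \<kappa> by (intro mult_mono) auto
  then have "16 * \<kappa> * (2 * L0 + j) \<le> 32 * ?k" by linarith
  then have "?q * (16 * \<kappa> * (2 * L0 + j)) \<le> ?q * (32 * ?k)"
    by (rule mult_left_mono) simp
  \<comment> \<open>36864 is 2 times 32 times 576; the 2 pays for replacing n - m by n/2.\<close>
  also have "\<dots> = \<gamma>\<^sup>2 / 576 * (36864 * ?q / \<gamma>\<^sup>2 * ?k / 2)"
    using \<gamma> by simp
  also have "\<dots> \<le> \<gamma>\<^sup>2 / 576 * real (n - m)"
  proof (rule mult_left_mono)
    have "real n * (1 / 2) \<le> real n * (1 - c)" using c by (intro mult_left_mono) auto
    with nm have "real n / 2 \<le> real (n - m)" by linarith
    with divide_right_mono[OF parts(4), of 2] show "36864 * ?q / \<gamma>\<^sup>2 * ?k / 2 \<le> real (n - m)"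
      by linarith
  qed simp
  finally show "?q * (16 * \<kappa> * (2 * L0 + j)) \<le> \<gamma>\<^sup>2 / 576 * real (n - m)" .
  \<comment> \<open>In these terms t sqrt(n) is \<gamma> x (s + L0) / sqrt(n). The bound x s <=
    sqrt(n j) is what requires n to exceed a multiple of s^2/j.\<close>
  define x where "x = D * \<kappa> / \<gamma>"
  have x0: "0 \<le> x" using D \<kappa> \<gamma> by (simp add: x_def)
  have x2: "x\<^sup>2 * W \<le> real n"
    using parts(5) by (simp add: x_def power_mult_distrib power_divide mult_ac)
  have "x * s \<le> sqrt (real n) * sqrt j"
  proof -
    have "x\<^sup>2 * (s\<^sup>2 / j) \<le> x\<^sup>2 * W" using L0' j by (intro mult_left_mono) (auto simp: W_def)
    with x2 have "x\<^sup>2 * (s\<^sup>2 / j) \<le> real n" by linarith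
    then have "(x * s)\<^sup>2 \<le> real n * j" using j by (simp add: power_mult_distrib pos_divide_le_eq)
    then have "x * s \<le> sqrt (real n * j)" by (rule real_le_rsqrt)
    then show ?thesis by (simp add: real_sqrt_mult)
  qed
  moreover have "x * L0 \<le> sqrt (real n) * sqrt L0"
  proof -
    have "x\<^sup>2 * L0 \<le> x\<^sup>2 * W" using W by (intro mult_left_mono) auto
    with x2 have "x\<^sup>2 * L0 \<le> real n" by linarith
    then have "x\<^sup>2 * L0 * L0 \<le> real n * L0" using L0' by (intro mult_right_mono) auto
    then have "(x * L0)\<^sup>2 \<le> real n * L0" by (simp add: power2_eq_square mult_ac)
    then have "x * L0 \<le> sqrt (real n * L0)" by (rule real_le_rsqrt)
    then show ?thesis by (simp add: real_sqrt_mult)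
  qed
  ultimately have "x * (s + L0) \<le> sqrt (real n) * (sqrt j + sqrt L0)"
    by (simp add: distrib_left)
  then have "\<gamma> * (x * (s + L0)) \<le> \<gamma> * (sqrt (real n) * (sqrt j + sqrt L0))"
    using \<gamma> by (intro mult_left_mono) auto
  moreover have "t * sqrt (real n) = \<gamma> * (x * (s + L0)) / sqrt (real n)"
    using n0 \<gamma> by (simp add: t_def x_def field_simps)
  ultimately show "t * sqrt (real n) \<le> \<gamma> * (sqrt j + sqrt L0)"
    using n0 by (simp add: pos_divide_le_eq mult_ac)
qed

text \<open>x and y stand for sqrt(Tr J) and sqrt(|J| log(4/\<delta>)). Giving up the first-stage
  samples costs a factor 1 + \<eta>/4. With \<gamma> = \<eta>/8 the coefficient of x becomes 1 +
  9\<eta>/16 + 3\<eta>^2/64, and that of y stays below 4.\<close>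

lemma error_budget:
  fixes x y :: real and n k :: nat
  assumes n: "0 < n" and k: "real n * (1 - \<eta> / 4) \<le> real k" and \<eta>: "0 < \<eta>" "\<eta> < 1"
    and x: "0 \<le> x" and y: "0 \<le> y"
  shows "((1 + 3 / 2 * (\<eta> / 8)) * x + 3 * y) / sqrt (real k) + \<eta> / 8 * (x + y) / sqrt (real n)
    \<le> (1 + \<eta>) * (x / sqrt (real n)) + 5 * (y / sqrt (real n))"
proof -
  have "1 \<le> (1 + \<eta> / 4)\<^sup>2 * (1 - \<eta> / 4)"
  proof -
    have "0 \<le> \<eta> / 4 * (1 - \<eta> / 4 - (\<eta> / 4)\<^sup>2)"
    proof (rule mult_nonneg_nonneg)
      have "(\<eta> / 4)\<^sup>2 \<le> (1 / 4)\<^sup>2" using \<eta> by (intro power_mono) auto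
      then show "0 \<le> 1 - \<eta> / 4 - (\<eta> / 4)\<^sup>2" using \<eta> by (simp add: power2_eq_square)
    qed (use \<eta> in simp)
    moreover have "(1 + x)\<^sup>2 * (1 - x) = 1 + x * (1 - x - x\<^sup>2)" for x :: real
      by (simp add: power2_eq_square algebra_simps)
    ultimately show ?thesis by simp
  qed
  then have "real n * 1 \<le> real n * ((1 + \<eta> / 4)\<^sup>2 * (1 - \<eta> / 4))"
    by (intro mult_left_mono) auto
  also have "\<dots> = (1 + \<eta> / 4)\<^sup>2 * (real n * (1 - \<eta> / 4))" by simp
  also have "\<dots> \<le> (1 + \<eta> / 4)\<^sup>2 * real k"
    using k by (intro mult_left_mono) auto
  finally have "sqrt (real n) \<le> sqrt ((1 + \<eta> / 4)\<^sup>2 * real k)" by simp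
  also have "\<dots> = (1 + \<eta> / 4) * sqrt (real k)"
    using \<eta> by (simp add: real_sqrt_mult)
  finally have nk: "sqrt (real n) \<le> (1 + \<eta> / 4) * sqrt (real k)" .
  have k0: "0 < sqrt (real k)"
  proof -
    have "0 < real n * (1 - \<eta> / 4)" using n \<eta> by simp
    with k show ?thesis by simp
  qed
  have n0: "0 < sqrt (real n)" using n by simp
  have inv: "1 / sqrt (real k) \<le> (1 + \<eta> / 4) * (1 / sqrt (real n))"
    using nk k0 n0 by (simp add: field_simps)
  let ?N = "1 / sqrt (real n)"
  have "((1 + 3 / 2 * (\<eta> / 8)) * x + 3 * y) * (1 / sqrt (real k)) \<le> ((1 + 3 / 2 * (\<eta> / 8)) * x + 3 * y) * ((1 + \<eta> / 4) * ?N)"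
    using x y \<eta> by (intro mult_left_mono[OF inv]) auto
  moreover have "((1 + 3 / 2 * (\<eta> / 8)) * x + 3 * y) * (1 + \<eta> / 4) + \<eta> / 8 * (x + y) \<le> (1 + \<eta>) * x + 5 * y"
  proof -
    have "\<eta> * \<eta> \<le> \<eta>" using \<eta> by simp
    then have "(1 + 3 / 2 * (\<eta> / 8)) * (1 + \<eta> / 4) + \<eta> / 8 \<le> 1 + \<eta>"
      using \<eta> by (simp add: field_simps)
    note a = mult_right_mono[OF this x]
    have "3 * (1 + \<eta> / 4) + \<eta> / 8 \<le> 5" using \<eta> by simp
    note add_mono[OF a mult_right_mono[OF this y]]
    then have "((1 + 3 / 2 * (\<eta> / 8)) * (1 + \<eta> / 4) + \<eta> / 8) * x + (3 * (1 + \<eta> / 4) + \<eta> / 8) * y \<le> (1 + \<eta>) * x + 5 * y"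
      .
    moreover have eq: "(a * x + 3 * y) * q + g * (x + y) = (a * q + g) * x + (3 * q + g) * y" for a q g
      by (simp add: algebra_simps)
    ultimately show ?thesis unfolding eq by blast
  qed
  then have "(((1 + 3 / 2 * (\<eta> / 8)) * x + 3 * y) * (1 + \<eta> / 4) + \<eta> / 8 * (x + y)) * ?N \<le> ((1 + \<eta>) * x + 5 * y) * ?N"
    using n0 by (intro mult_right_mono) auto
  ultimately show ?thesis by (simp add: algebra_simps add_divide_distrib)
qed


section \<open>Assembling the two stages\<close>

lemma sqrt_add_sq_le: "0 \<le> x \<Longrightarrow> 0 \<le> y \<Longrightarrow> (sqrt x + sqrt y)\<^sup>2 \<le> 2 * x + 2 * y"
  using sum_squares_bound[of "sqrt x" "sqrt y"] by (simp add: power2_sum)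

text \<open>Each stage may fail with probability \<delta>/2. The second uses L0 = log(2/\<delta>),
  and the additional ln 2 of the mixture bound turns this into the log(4/\<delta>) of the
  conclusion.\<close>

lemma two_stage_error_bound:
  fixes C\<^sub>1 C\<^sub>2 C \<eta> r \<delta> :: real and d n :: nat
  defines "c \<equiv> \<eta> / C" and "\<gamma> \<equiv> \<eta> / 8"
  assumes C12: "0 < C\<^sub>1" "0 < C\<^sub>2" and C: "4 \<le> C" and \<eta>: "0 < \<eta>" "\<eta> < 1"
    and est: "heavy_tailed_mean_estimator C\<^sub>1 C\<^sub>2 est" and d: "0 < d"
    and f: "finite_cov_distribution d f" and \<delta>: "0 < \<delta>" "\<delta> < 1"
    and r: "0 < r\<^sup>2" and rS: "r\<^sup>2 \<le> op_norm (cov_mat d f)" (is "_ \<le> op_norm ?\<Sigma>")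
    and n: "real n > sample_const C\<^sub>1 C\<^sub>2 c \<gamma> * ((op_norm (cov_mat d f) / r\<^sup>2)\<^sup>2 *
      (ln (2 / \<delta>) + d_eff (mat_inv (fisher d f (r\<^sup>2 \<cdot>\<^sub>m 1\<^sub>m d)))
        + (d_eff (cov_mat d f))\<^sup>2 / d_eff (mat_inv (fisher d f (r\<^sup>2 \<cdot>\<^sub>m 1\<^sub>m d)))))"
      (is "_ > _ * (_ * (_ + d_eff ?J + _))")
  shows "1 - \<delta> \<le> measure (sample_space d f n (r\<^sup>2 \<cdot>\<^sub>m 1\<^sub>m d) l)
    {(xs, zs) \<in> space (sample_space d f n (r\<^sup>2 \<cdot>\<^sub>m 1\<^sub>m d) l).
      vnorm d (vsub d (global_mle C est d \<delta> f n (r\<^sup>2 \<cdot>\<^sub>m 1\<^sub>m d) \<eta> xs zs) l) \<le>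
        (1 + \<eta>) * sqrt (mat_trace ?J / real n) + 5 * sqrt (op_norm ?J * ln (4 / \<delta>) / real n)}"
proof -
  have c: "0 < c" "c \<le> \<eta> / 4" "c \<le> 1 / 4" and \<gamma>: "0 < \<gamma>" "\<gamma> \<le> 1"
  proof -
    show "0 < c" "0 < \<gamma>" "\<gamma> \<le> 1" using C \<eta> by (simp_all add: c_def \<gamma>_def)
    show "c \<le> \<eta> / 4" unfolding c_def using C \<eta> by (intro divide_left_mono) auto
    then show "c \<le> 1 / 4" using \<eta> by linarith
  qed
  \<comment> \<open>The statement involves r only through its square, so the sign of r is free; the
    absolute value provides the positive scale.\<close>
  define s where "s = \<bar>r\<bar>"
  have s: "0 < s" and rs: "r\<^sup>2 = s\<^sup>2" using r by (simp_all add: s_def)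
  define Sg where "Sg = op_norm ?\<Sigma>"
  interpret smoothing d f s
    by standard (use s f in auto)
  have Sg: "0 < Sg" "s\<^sup>2 \<le> Sg" using r rS unfolding Sg_def rs by linarith+
  interpret regular_smoothing d f s "4 * Sg"
    by standard (use Sg d norm_sq_le_info[OF cov_form_le] in \<open>auto simp: Sg_def\<close>)
  have n': "real n > sample_const C\<^sub>1 C\<^sub>2 c \<gamma> * ((Sg / s\<^sup>2)\<^sup>2 *
      (ln (2 / \<delta>) + d_eff Ji + (d_eff ?\<Sigma>)\<^sup>2 / d_eff Ji))"
    using n by (simp only: rs Sg_def)
  define L0 where "L0 = ln (2 / \<delta>)"
  define \<kappa> where "\<kappa> = Sg / s\<^sup>2"
  define j where "j = d_eff Ji"
  define dS where "dS = d_eff ?\<Sigma>"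
  define m where "m = nat \<lfloor>c * real n\<rfloor>"
  define D where "D = 4 * C\<^sub>1\<^sup>2 / c"
  define t where "t = D * \<kappa> * (dS + L0) / real n"
  have \<kappa>: "1 \<le> \<kappa>" using Sg s by (simp add: \<kappa>_def)
  have L0: "ln 2 \<le> L0" using \<delta> by (simp add: L0_def ln_div)
  have L0_pos: "0 < L0" using L0 ln_gt_zero[of "2::real"] by linarith
  have j: "0 < j" using T_eq trace_pos p_pos by (simp add: j_def zero_less_mult_iff)
  have Tj: "T = p * j" using T_eq by (simp add: j_def)
  have dS: "0 \<le> dS" using trace_cov_nonneg Sg by (simp add: dS_def d_eff_def Sg_def)
  have TS: "mat_trace ?\<Sigma> = Sg * dS" using Sg by (simp add: dS_def d_eff_def Sg_def)
  note size = sample_size[OF C12 c(1,3) \<gamma>(1) \<kappa> L0 j dS n'[folded L0_def j_def dS_def \<kappa>_def],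
    folded m_def D_def t_def]
  let ?M = "PiM {..<n} (\<lambda>_. translate d f l) \<Otimes>\<^sub>M PiM {..<n} (\<lambda>_. Gi)"
  let ?P = "PiM {..<m} (\<lambda>_. translate d f l)"
  define E where "E a = vsub d (est d m (\<delta> / 2) a) (mean_vec d f)" for a
  have adm: "2 powr (- (real m / C\<^sub>2)) < \<delta> / 2"
  proof -
    have "- (real m / C\<^sub>2) * ln 2 < ln (\<delta> / 2)"
      using size(5) \<delta> by (simp add: L0_def ln_div)
    then have "exp (- (real m / C\<^sub>2) * ln 2) < exp (ln (\<delta> / 2))" by simp
    then show ?thesis using \<delta> by (simp add: powr_def)
  qed
  have "0 < d \<and> 2 powr (- (real m / C\<^sub>2)) < \<delta> / 2 \<and> \<delta> / 2 < 1"
    using d adm \<delta> by simp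
  note spec = est[unfolded heavy_tailed_mean_estimator_def, rule_format, OF this]
  have est_meas [measurable]: "est d m (\<delta> / 2) \<in> PiM {..<m} (\<lambda>_. Rd d) \<rightarrow>\<^sub>M Rd d"
    by (rule conjunct1[OF spec])
  have est_prob: "1 - \<delta> / 2 \<le> measure ?P {xs \<in> space ?P.
      vnorm d (vsub d (est d m (\<delta> / 2) xs) (mean_vec d (translate d f l))) \<le>
        C\<^sub>1 * (sqrt (mat_trace (cov_mat d (translate d f l)) / real m)
          + sqrt (op_norm (cov_mat d (translate d f l)) * ln (1 / (\<delta> / 2)) / real m))}"
    by (rule conjunct2[OF spec, rule_format, OF finite_cov_translate])
  define b where "b = C\<^sub>1 * (sqrt (Sg * dS / real m) + sqrt (Sg * L0 / real m))"
  define A0 where "A0 = {xs \<in> space ?P. vnorm d (vsub d (est d m (\<delta> / 2) xs) (mean_vec d (translate d f l))) \<le> b}"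
  have A0_prob: "1 - \<delta> / 2 \<le> measure ?P A0"
    using est_prob by (simp add: A0_def b_def cov_translate TS L0_def flip: Sg_def)
  have E_meas [measurable]: "E \<in> PiM {..<m} (\<lambda>_. Rd d) \<rightarrow>\<^sub>M Rd d"
    unfolding E_def by measurable
  have est_meas' [measurable]: "est d m (\<delta> / 2) \<in> ?P \<rightarrow>\<^sub>M Rd d"
    using est_meas by (simp cong: measurable_cong_sets sets_PiM_cong)
  have A0_meas: "A0 \<in> sets ?P"
    unfolding A0_def by measurable
  have m_pos: "0 < real m"
    using size(1,3) c by (smt (verit) divide_pos_pos mult_pos_pos of_nat_0_less_iff)
  have close: "ip d (vsub d (E a) l) (vsub d (E a) l) \<le> t * s\<^sup>2" if "a \<in> A0" for a
  proof -
    have "vnorm d (vsub d (E a) l) = vnorm d (vsub d (est d m (\<delta> / 2) a) (mean_vec d (translate d f l)))"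
      by (rule vnorm_cong) (simp add: E_def vsub_def mean_translate)
    also have "\<dots> \<le> b" using that by (simp add: A0_def)
    finally have "(vnorm d (vsub d (E a) l))\<^sup>2 \<le> b\<^sup>2" by (rule power_mono) simp
    also have "b\<^sup>2 \<le> C\<^sub>1\<^sup>2 * (2 * (Sg * dS / real m) + 2 * (Sg * L0 / real m))"
    proof -
      have "0 \<le> Sg * dS / real m" "0 \<le> Sg * L0 / real m" using Sg dS L0_pos by simp_all
      from mult_left_mono[OF sqrt_add_sq_le[OF this], of "C\<^sub>1\<^sup>2"] show ?thesis
        by (simp add: b_def power_mult_distrib)
    qed
    also have "\<dots> = 2 * C\<^sub>1\<^sup>2 * (Sg * (dS + L0)) / real m"
      by (simp add: add_divide_distrib distrib_left mult_ac)
    \<comment> \<open>From m >= c n / 2; this turns the constant 2 into the 4 in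
      \<open>D\<close>.\<close>
    also have "\<dots> \<le> 2 * C\<^sub>1\<^sup>2 * (Sg * (dS + L0)) / (c * real n / 2)"
      using size(1,3) m_pos c Sg dS L0_pos by (intro divide_left_mono) auto
    also have "\<dots> = t * s\<^sup>2"
      using s c size(1) by (simp add: t_def D_def \<kappa>_def)
    finally show ?thesis by (simp add: vnorm_sq)
  qed
  have \<gamma>2: "\<gamma>\<^sup>2 \<le> 1" using \<gamma> by (simp add: power_le_one)
  have t0: "0 \<le> t"
    using c dS L0_pos \<kappa> by (simp add: t_def D_def)
  have t1: "t \<le> 1"
  proof -
    have "\<gamma>\<^sup>2 / (4608 * \<kappa>) \<le> 1" using \<gamma>2 \<kappa> by (simp add: divide_le_eq)
    with size(6) show ?thesis by linarith
  qed
  have t\<gamma>: "24 * sqrt (2 * t) * (sqrt (4 * Sg) / s) \<le> \<gamma>"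
  proof -
    \<comment> \<open>Origin of 4608: 24 squared, times 2, times the 4 from the covariance
      inequality.\<close>
    have "(24 * sqrt (2 * t) * (sqrt (4 * Sg) / s))\<^sup>2 = t * (4608 * \<kappa>)"
      using t0 Sg by (simp add: power_mult_distrib power_divide \<kappa>_def)
    also have "\<dots> \<le> \<gamma>\<^sup>2"
      using size(6) \<kappa> by (simp add: pos_le_divide_eq)
    finally show ?thesis
      by (rule power2_le_imp_le) (use \<gamma> in simp)
  qed
  let ?L = "ln 2 + L0"
  have L4: "ln (4 / \<delta>) = ?L"
    using \<delta> ln_mult[of 2 "2 / \<delta>"] by (simp add: L0_def)
  have p4: "p \<le> 4 * Sg" by (rule p_le)
  have pL: "0 \<le> p * ?L" using p_pos L0_pos by simp
  have \<rho>: "(1 + sqrt (2 / \<gamma>)) * (sqrt (p * ?L) + sqrt T) \<le> \<gamma> / 24 * s * sqrt (real (n - m))"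
  proof -
    have "((1 + sqrt (2 / \<gamma>)) * (sqrt (p * ?L) + sqrt T))\<^sup>2 \<le> (1 + sqrt (2 / \<gamma>))\<^sup>2 * (2 * (p * ?L) + 2 * (p * j))"
    proof -
      have "(sqrt (p * ?L) + sqrt (p * j))\<^sup>2 \<le> 2 * (p * ?L) + 2 * (p * j)"
        using pL p_pos j by (intro sqrt_add_sq_le) auto
      then show ?thesis
        unfolding power_mult_distrib Tj by (intro mult_left_mono) auto
    qed
    also have "2 * (p * ?L) + 2 * (p * j) = p * (2 * (?L + j))" by (simp add: algebra_simps)
    also have "\<dots> \<le> 4 * Sg * (2 * (2 * L0 + j))"
      using p4 L0 L0_pos j Sg by (intro mult_mono) auto
    also have "4 * Sg * (2 * (2 * L0 + j)) \<le> s\<^sup>2 * (16 * \<kappa> * (2 * L0 + j))"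
      using s Sg L0_pos j by (simp add: \<kappa>_def)
    finally have "((1 + sqrt (2 / \<gamma>)) * (sqrt (p * ?L) + sqrt T))\<^sup>2
        \<le> (1 + sqrt (2 / \<gamma>))\<^sup>2 * (s\<^sup>2 * (16 * \<kappa> * (2 * L0 + j)))"
      by (simp add: mult_left_mono)
    also have "\<dots> = s\<^sup>2 * ((1 + sqrt (2 / \<gamma>))\<^sup>2 * (16 * \<kappa> * (2 * L0 + j)))" by simp
    also have "\<dots> \<le> s\<^sup>2 * (\<gamma>\<^sup>2 / 576 * real (n - m))"
      by (intro mult_left_mono size(7)) simp
    also have "\<dots> = (\<gamma> / 24 * s * sqrt (real (n - m)))\<^sup>2"
      by (simp add: power_mult_distrib power_divide)
    finally show ?thesis
      by (rule power2_le_imp_le) (intro mult_nonneg_nonneg; use \<gamma> less_imp_le[OF s] in simp)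
  qed
  define err where "err \<omega> = vnorm d (vsub d (local_mle d f (s\<^sup>2 \<cdot>\<^sub>m 1\<^sub>m d) (n - m)
    (\<lambda>k. fst \<omega> (m + k)) (\<lambda>k. snd \<omega> (m + k)) (E (restrict (fst \<omega>) {..<m}))) l)" for \<omega>
  define B1 where "B1 = ((1 + 3 / 2 * \<gamma>) * sqrt T + 3 * sqrt (p * ?L)) / sqrt (real (n - m)) + sqrt p * t"
  define B2 where "B2 = (1 + \<eta>) * sqrt (T / real n) + 5 * sqrt (p * ln (4 / \<delta>) / real n)"
  have B12: "B1 \<le> B2"
  proof -
    have rn: "0 < sqrt (real n)" using size(1) by simp
    have "t \<le> \<gamma> * (sqrt j + sqrt L0) / sqrt (real n)"
      using size(8) rn by (simp add: pos_le_divide_eq)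
    also have "\<dots> \<le> \<gamma> * (sqrt j + sqrt ?L) / sqrt (real n)"
      using \<gamma> rn by (intro divide_right_mono mult_left_mono) auto
    finally have "sqrt p * t \<le> sqrt p * (\<gamma> * (sqrt j + sqrt ?L) / sqrt (real n))"
      using p_pos by (intro mult_left_mono) auto
    also have "\<dots> = \<gamma> * (sqrt T + sqrt (p * ?L)) / sqrt (real n)"
      unfolding Tj real_sqrt_mult by (simp add: distrib_left distrib_right mult_ac)
    finally have "B1 \<le> ((1 + 3 / 2 * \<gamma>) * sqrt T + 3 * sqrt (p * ?L)) / sqrt (real (n - m))
        + \<gamma> * (sqrt T + sqrt (p * ?L)) / sqrt (real n)"
      by (simp add: B1_def)
    also have "\<dots> \<le> (1 + \<eta>) * (sqrt T / sqrt (real n)) + 5 * (sqrt (p * ?L) / sqrt (real n))"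
      unfolding \<gamma>_def
    proof (rule error_budget)
      have "real n * (1 - \<eta> / 4) \<le> real n * (1 - c)" using c by (intro mult_left_mono) auto
      with size(4) show "real n * (1 - \<eta> / 4) \<le> real (n - m)" by linarith
    qed (use size(1) \<eta> trace_pos pL in auto)
    also have "\<dots> = B2"
      by (simp add: B2_def L4 real_sqrt_divide)
    finally show ?thesis .
  qed
  let ?A = "{\<omega> \<in> space ?M. restrict (fst \<omega>) {..<m} \<in> A0}"
  let ?Bad = "{\<omega> \<in> space ?M. restrict (fst \<omega>) {..<m} \<in> A0 \<and> B1 < err \<omega>}"
  let ?Good = "{\<omega> \<in> space ?M. err \<omega> \<le> B2}"
  have M: "prob_space ?M"
  proof -
    interpret A: prob_space "PiM {..<n} (\<lambda>_. translate d f l)"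
      by (intro prob_space_PiM prob_space_translate)
    interpret B: prob_space "PiM {..<n} (\<lambda>_. Gi)"
      by (intro prob_space_PiM) (simp add: gauss_eq N.prob_space_axioms)
    interpret pair_prob_space "PiM {..<n} (\<lambda>_. translate d f l)" "PiM {..<n} (\<lambda>_. Gi)" ..
    show ?thesis by (rule prob_space_axioms)
  qed
  interpret M: prob_space ?M by (rule M)
  have A_sets: "?A \<in> sets ?M" and A_prob: "measure ?M ?A = measure ?P A0"
    using first_stage_prob[of m n A0 l] size(2) A0_meas by auto
  have err_meas [measurable]: "err \<in> borel_measurable ?M"
    unfolding err_def
  proof (rule local_mle_measurable)
    have rest: "(\<lambda>xs. restrict xs {..<m}) \<in> PiM {..<n} (\<lambda>_. translate d f l) \<rightarrow>\<^sub>M ?P"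
      using size(2) by (intro measurable_restrict_subset) auto
    have E': "E \<in> ?P \<rightarrow>\<^sub>M Rd d"
      using E_meas by (simp cong: measurable_cong_sets sets_PiM_cong)
    show "(\<lambda>\<omega>. E (restrict (fst \<omega>) {..<m})) \<in> ?M \<rightarrow>\<^sub>M Rd d"
      by (rule measurable_compose[OF measurable_compose[OF measurable_fst rest] E'])
    fix k assume k: "k < n - m"
    have "(\<lambda>\<omega>. fst \<omega> (m + k)) \<in> ?M \<rightarrow>\<^sub>M translate d f l" "(\<lambda>\<omega>. snd \<omega> (m + k)) \<in> ?M \<rightarrow>\<^sub>M Gi"
      using k by (auto intro!: measurable_compose[OF measurable_fst] measurable_compose[OF measurable_snd]
        measurable_component_singleton)
    then show "(\<lambda>\<omega>. fst \<omega> (m + k)) \<in> ?M \<rightarrow>\<^sub>M Rd d" "(\<lambda>\<omega>. snd \<omega> (m + k)) \<in> ?M \<rightarrow>\<^sub>M Rd d"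
      by (simp_all add: gauss_eq cong: measurable_cong_sets)
  qed
  have Good_sets: "?Good \<in> sets ?M" by measurable
  have Bad_sets: "?Bad \<in> sets ?M"
  proof -
    have "?Bad = ?A \<inter> {\<omega> \<in> space ?M. B1 < err \<omega>}" by auto
    moreover have "{\<omega> \<in> space ?M. B1 < err \<omega>} \<in> sets ?M" by measurable
    ultimately show ?thesis using sets.Int[OF A_sets] by simp
  qed
  have Bad: "measure ?M ?Bad \<le> \<delta> / 2"
  proof -
    have "measure ?M ?Bad \<le> exp (- L0)"
      unfolding err_def B1_def
      by (rule local_stage[OF E_meas size(2) A0_meas close t1 t\<gamma> \<gamma> L0_pos \<rho>])
    also have "\<dots> = \<delta> / 2" using \<delta> by (simp add: L0_def ln_div exp_diff)
    finally show ?thesis .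
  qed
  \<comment> \<open>Failure means a bad first stage, or a good one followed by an error above
    \<open>B2\<close>, hence above \<open>B1\<close>.\<close>
  have "1 - measure ?M ?Good = measure ?M (space ?M - ?Good)"
    using M.prob_compl[OF Good_sets] by simp
  also have "\<dots> \<le> measure ?M ((space ?M - ?A) \<union> ?Bad)"
    using A_sets Bad_sets B12 by (intro M.finite_measure_mono) auto
  also have "\<dots> \<le> measure ?M (space ?M - ?A) + measure ?M ?Bad"
    using A_sets Bad_sets by (intro measure_Un_le) auto
  also have "measure ?M (space ?M - ?A) \<le> \<delta> / 2"
    using M.prob_compl[OF A_sets] A_prob A0_prob by simp
  finally have fin: "1 - \<delta> \<le> measure ?M ?Good" using Bad by linarith
  have "{(xs, zs) \<in> space ?M. vnorm d (vsub d (global_mle C est d \<delta> f n (s\<^sup>2 \<cdot>\<^sub>m 1\<^sub>m d) \<eta> xs zs) l) \<le> B2} = ?Good"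
    by (auto simp: global_mle_def Let_def err_def E_def m_def c_def)
  with fin show ?thesis
    unfolding rs sample_space_def B2_def by simp
qed

theorem theorem1p2:
  fixes C\<^sub>1 C\<^sub>2 :: real
  assumes "0 < C\<^sub>1" and "0 < C\<^sub>2"
  shows "\<exists>C0\<ge>1. \<forall>C\<ge>C0. \<forall>\<eta>::real. 0 < \<eta> \<and> \<eta> < 1 \<longrightarrow>
    (\<exists>K>0. \<forall>est (d::nat) f l (r::real) (\<delta>::real) (n::nat).
      heavy_tailed_mean_estimator C\<^sub>1 C\<^sub>2 est \<longrightarrow>
      0 < d \<longrightarrow> finite_cov_distribution d f \<longrightarrow> l \<in> space (Rd d) \<longrightarrow>
      0 < \<delta> \<longrightarrow> \<delta> < 1 \<longrightarrow>
      (let \<Sigma> = cov_mat d f; R = r\<^sup>2 \<cdot>\<^sub>m 1\<^sub>m d; J = mat_inv (fisher d f R) in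
        0 < r\<^sup>2 \<longrightarrow> r\<^sup>2 \<le> op_norm \<Sigma> \<longrightarrow>
        real n > K * ((op_norm \<Sigma> / r\<^sup>2)\<^sup>2 *
          (ln (2 / \<delta>) + d_eff J + (d_eff \<Sigma>)\<^sup>2 / d_eff J)) \<longrightarrow>
        measure (sample_space d f n R l)
          {(xs, zs) \<in> space (sample_space d f n R l).
            vnorm d (vsub d (global_mle C est d \<delta> f n R \<eta> xs zs) l) \<le>
              (1 + \<eta>) * sqrt (mat_trace J / real n)
              + 5 * sqrt (op_norm J * ln (4 / \<delta>) / real n)}
        \<ge> 1 - \<delta>))"
proof (rule exI[of _ 4], intro conjI allI impI, goal_cases)
  \<comment> \<open>The threshold 4 keeps the first-stage fraction \<eta>/C below \<eta>/4. The
    witness for K involves only \<open>C\<^sub>1\<close>, \<open>C\<^sub>2\<close>, C and \<eta>, so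
    it is fixed before the dimension, the distribution and the estimator.\<close>
  case (2 C \<eta>)
  show ?case
  proof (rule exI[of _ "sample_const C\<^sub>1 C\<^sub>2 (\<eta> / C) (\<eta> / 8)"], intro conjI allI impI, goal_cases)
    case 1
    show ?case
      unfolding sample_const_def using assms 2 by (intro add_pos_nonneg add_pos_pos) auto
  next
    case (2 est d f l r \<delta> n)
    with assms \<open>4 \<le> C\<close> \<open>0 < \<eta> \<and> \<eta> < 1\<close> show ?case
      unfolding Let_def by (intro impI two_stage_error_bound) auto
  qed
qed simp

end
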